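(* Let $(Q, N, C_1, C_2, \dots)$ be a nonnegative random vector, with $N \in \{0,1,2,\dots\} \cup \{\infty\}$ and $P(Q > 0) > 0$, and let $R = \sum_{k=0}^\infty W_k$ be the solution to $$R \stackrel{\mathcal{D}}{=} \sum_{i=1}^N C_i R_i + Q$$ constructed on the weighted branching tree (see context). Suppose that there exists $j \geq 1$ with $P(N\ge j,\,C_j>0)>0$ such that the measure $P\left(\log C_j\in du,\, C_j > 0,\, N\ge j\right)$ is nonarithmetic, and that for some $\alpha > 0$, $E[Q^\alpha] < \infty$, $0 < E \left[ \sum_{i=1}^N C_i^\alpha \log C_i \right] < \infty$ and $E \left[ \sum_{i=1}^N C_i^\alpha \right] = 1$. In addition, assume 1. $E\left[ \sum_{i=1}^N C_i \right] < 1$ and $E\left[ \left( \sum_{i=1}^N C_i \right)^\alpha \right] < \infty$, if $\alpha > 1$; or, 2. $E\left[ \left( \sum_{i=1}^N C_i^{\alpha/(1+\epsilon)}\right)^{1+\epsilon} \right] < \infty$ for some $0 < \epsilon< 1$, if $0 < \alpha \leq 1$. Then $$P(R > t) \sim H t^{-\alpha}, \qquad t \to \infty,$$ where $0 \leq H < \infty$ is given by $$H = \frac{1}{E\left[ \sum_{i=1}^N C_i^\alpha \log C_i \right] } \int_{0}^\infty v^{\alpha-1} \left( P(R > v) - E\left[ \sum_{i=1}^{N} 1(C_{i} R > v ) \right] \right) dv = \frac{E\left[ \left( \sum_{i=1}^N C_i R_i +Q \right)^\alpha - \sum_{i=1}^N (C_i R_i )^\alpha \right]}{\alpha E\left[ \sum_{i=1}^N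 C_i^\alpha \log C_i \right] }.$$
   Context: Construction of $R$. Let $U=\bigcup_{k=0}^\infty \{1,2,3,\dots\}^k$ be the set of finite sequences of positive integers, with $\{1,2,\dots\}^0=\{\emptyset\}$; $(\mathbf{i},j)$ denotes concatenation, $(\emptyset,j)=j$. Let $\{(Q_{\mathbf i}, N_{\mathbf i}, C_{(\mathbf i,1)}, C_{(\mathbf i,2)},\dots)\}_{\mathbf i\in U}$ be iid copies of $(Q,N,C_1,C_2,\dots)$, the copy at the root $\emptyset$ being $(Q,N,C_1,C_2,\dots)$ itself. Put $A_0=\{\emptyset\}$ and $A_n=\{(i_1,\dots,i_n)\in U: (i_1,\dots,i_{n-1})\in A_{n-1},\ 1\le i_n\le N_{(i_1,\dots,i_{n-1})}\}$ for $n\ge1$. The weights are $\Pi_\emptyset=1$ and $\Pi_{(i_1,\dots,i_n)}=C_{(i_1,\dots,i_n)}\Pi_{(i_1,\dots,i_{n-1})}$. Define $W_n=\sum_{\mathbf i\in A_n}Q_{\mathbf i}\Pi_{\mathbf i}$, $n\ge0$ (so $W_0=Q$), and $R=\sum_{k=0}^\infty W_k$; $R$ satisfies the displayed distributional equation. In the distributional equation and in the second expression for $H$, $\{R_i\}$ are iid copies of $R$, independent of $(Q,N,C_1,C_2,\dots)$; in the first expression $R$ is taken independent of $(N,C_1,C_2,\dots)$. $1(\cdot)$ is the indicator function; $\stackrel{\mathcal D}{=}$ is equality in distribution. Convention: $0^\alpha\log 0=0$ for $\alpha>0$. When $N=\infty$, $\sum_{i=1}^N$ is an infinite series. A measure on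 $\mathbb{R}$ is nonarithmetic if it is not concentrated on $d\mathbb{Z}$ for any $d>0$. $P(R>t)\sim Ht^{-\alpha}$ means $\lim_{t\to\infty}t^\alpha P(R>t)=H$. *)

theory Defs
  imports "HOL-Probability.Probability"
begin

text \<open>
  Nodes of the tree are lists of positive integers; the child \<open>(i, j)\<close> of \<open>i\<close> is \<open>i @ [j]\<close>.
\<close>

definition nodes :: "nat list set" where
  "nodes = {i. \<forall>j\<in>set i. 1 \<le> j}"

text \<open>
  The sum over \<open>1 \<le> i \<le> n\<close>, an infinite series for \<open>n = \<infinity>\<close>. For \<^typ>\<open>ennreal\<close>-valued
  terms it always exists; for real terms the series is understood as absolutely convergent.
\<close>

definition sum_upto :: "enat \<Rightarrow> (nat \<Rightarrow> 'a::{comm_monoid_add, t2_space}) \<Rightarrow> 'a" where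
  "sum_upto n f = (\<Sum>\<^sub>\<infinity>i\<in>{i. 1 \<le> i \<and> enat i \<le> n}. f i)"

text \<open>Powers in \<open>[0, \<infinity>]\<close>; only used for exponents \<open>a > 0\<close>.\<close>

definition epowr :: "ennreal \<Rightarrow> real \<Rightarrow> ennreal" where
  "epowr x a = (if x = \<infinity> then \<infinity> else ennreal (enn2real x powr a))"

definition nonarithmetic :: "real measure \<Rightarrow> bool" where
  "nonarithmetic \<mu> \<longleftrightarrow> (\<forall>d>0. emeasure \<mu> (- {d * of_int k | k. True}) \<noteq> 0)"

text \<open>
  The mark of node \<open>i\<close> is the vector \<open>(Q\<^sub>i, N\<^sub>i, C\<^sub>(\<^sub>i\<^sub>,\<^sub>1\<^sub>), C\<^sub>(\<^sub>i\<^sub>,\<^sub>2\<^sub>), \<dots>)\<close>: the family \<open>C\<close> is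
  indexed by the child, so the weights \<open>C (i @ [j])\<close> belong to the mark of \<open>i\<close>, and \<open>C []\<close> is
  irrelevant.
\<close>

definition mark_space :: "(real \<times> enat \<times> (nat \<Rightarrow> real)) measure" where
  "mark_space = borel \<Otimes>\<^sub>M count_space UNIV \<Otimes>\<^sub>M (\<Pi>\<^sub>M j\<in>{1..}. borel)"

definition mark ::
  "(nat list \<Rightarrow> 'w \<Rightarrow> real) \<Rightarrow> (nat list \<Rightarrow> 'w \<Rightarrow> enat) \<Rightarrow> (nat list \<Rightarrow> 'w \<Rightarrow> real) \<Rightarrow>
   nat list \<Rightarrow> 'w \<Rightarrow> real \<times> enat \<times> (nat \<Rightarrow> real)" where
  "mark Q N C i \<omega> = (Q i \<omega>, N i \<omega>, (\<lambda>j\<in>{1..}. C (i @ [j]) \<omega>))"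

locale weighted_branching_tree = prob_space M
  for M :: "'w measure" +
  fixes Q :: "nat list \<Rightarrow> 'w \<Rightarrow> real"
    and N :: "nat list \<Rightarrow> 'w \<Rightarrow> enat"
    and C :: "nat list \<Rightarrow> 'w \<Rightarrow> real"
  assumes indep_marks: "indep_vars (\<lambda>_. mark_space) (mark Q N C) nodes"
    and distr_marks: "\<And>i. i \<in> nodes \<Longrightarrow>
      distr M mark_space (mark Q N C i) = distr M mark_space (mark Q N C [])"
    and nonneg_marks: "AE \<omega> in M. 0 \<le> Q [] \<omega> \<and> (\<forall>j\<ge>1. 0 \<le> C [j] \<omega>)"

text \<open>\<open>generation N n \<omega>\<close> is the random set \<open>A\<^sub>n\<close>, and \<open>path_weight C i \<omega>\<close> is \<open>\<Pi>\<^sub>i\<close>.\<close>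

primrec generation :: "(nat list \<Rightarrow> 'w \<Rightarrow> enat) \<Rightarrow> nat \<Rightarrow> 'w \<Rightarrow> nat list set" where
  "generation N 0 \<omega> = {[]}"
| "generation N (Suc n) \<omega> = {i @ [j] | i j. i \<in> generation N n \<omega> \<and> 1 \<le> j \<and> enat j \<le> N i \<omega>}"

fun path_weight :: "(nat list \<Rightarrow> 'w \<Rightarrow> real) \<Rightarrow> nat list \<Rightarrow> 'w \<Rightarrow> real" where
  "path_weight C i \<omega> = (if i = [] then 1 else C i \<omega> * path_weight C (butlast i) \<omega>)"

declare path_weight.simps [simp del]

lemma path_weight_Nil [simp]: "path_weight C [] \<omega> = 1"
  by (subst path_weight.simps) simp

lemma path_weight_snoc [simp]:
  "path_weight C (i @ [j]) \<omega> = C (i @ [j]) \<omega> * path_weight C i \<omega>"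
  by (subst path_weight.simps) simp

text \<open>
  \<open>W\<^sub>n\<close> and \<open>R\<close> take values in \<open>[0, \<infinity>]\<close>, so that they are defined at every sample point.
\<close>

definition tree_W :: "(nat list \<Rightarrow> 'w \<Rightarrow> real) \<Rightarrow> (nat list \<Rightarrow> 'w \<Rightarrow> enat) \<Rightarrow>
    (nat list \<Rightarrow> 'w \<Rightarrow> real) \<Rightarrow> nat \<Rightarrow> 'w \<Rightarrow> ennreal" where
  "tree_W Q N C n \<omega> = (\<Sum>\<^sub>\<infinity>i\<in>generation N n \<omega>. ennreal (Q i \<omega> * path_weight C i \<omega>))"

definition tree_R :: "(nat list \<Rightarrow> 'w \<Rightarrow> real) \<Rightarrow> (nat list \<Rightarrow> 'w \<Rightarrow> enat) \<Rightarrow>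
    (nat list \<Rightarrow> 'w \<Rightarrow> real) \<Rightarrow> 'w \<Rightarrow> ennreal" where
  "tree_R Q N C \<omega> = (\<Sum>k. tree_W Q N C k \<omega>)"

text \<open>
  Copies of \<open>R\<close> independent of the root mark are realised on product spaces: on \<open>M \<Otimes>\<^sub>M M\<close> the
  root mark is read off the first coordinate and \<open>R\<close> off the second; on
  \<open>M \<Otimes>\<^sub>M (\<Pi>\<^sub>M i\<in>UNIV. M)\<close> the iid copies \<open>R\<^sub>i\<close> are \<open>tree_R\<close> evaluated at the independent
  coordinates \<open>snd p i\<close>.
\<close>

definition expected_exceedances :: "'w measure \<Rightarrow> (nat list \<Rightarrow> 'w \<Rightarrow> real) \<Rightarrow>
    (nat list \<Rightarrow> 'w \<Rightarrow> enat) \<Rightarrow> (nat list \<Rightarrow> 'w \<Rightarrow> real) \<Rightarrow> real \<Rightarrow> ennreal" where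
  "expected_exceedances M Q N C v =
     (\<integral>\<^sup>+p. sum_upto (N [] (fst p))
            (\<lambda>i. of_bool (ennreal (C [i] (fst p)) * tree_R Q N C (snd p) > ennreal v))
      \<partial>(M \<Otimes>\<^sub>M M))"

definition copies_space :: "'w measure \<Rightarrow> ('w \<times> (nat \<Rightarrow> 'w)) measure" where
  "copies_space M = M \<Otimes>\<^sub>M (\<Pi>\<^sub>M i\<in>UNIV. M)"

definition power_of_sum :: "(nat list \<Rightarrow> 'w \<Rightarrow> real) \<Rightarrow> (nat list \<Rightarrow> 'w \<Rightarrow> enat) \<Rightarrow>
    (nat list \<Rightarrow> 'w \<Rightarrow> real) \<Rightarrow> real \<Rightarrow> 'w \<times> (nat \<Rightarrow> 'w) \<Rightarrow> ennreal" where
  "power_of_sum Q N C a p =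
     epowr (sum_upto (N [] (fst p)) (\<lambda>i. ennreal (C [i] (fst p)) * tree_R Q N C (snd p i))
            + ennreal (Q [] (fst p))) a"

definition sum_of_powers :: "(nat list \<Rightarrow> 'w \<Rightarrow> real) \<Rightarrow> (nat list \<Rightarrow> 'w \<Rightarrow> enat) \<Rightarrow>
    (nat list \<Rightarrow> 'w \<Rightarrow> real) \<Rightarrow> real \<Rightarrow> 'w \<times> (nat \<Rightarrow> 'w) \<Rightarrow> ennreal" where
  "sum_of_powers Q N C a p =
     sum_upto (N [] (fst p)) (\<lambda>i. epowr (ennreal (C [i] (fst p)) * tree_R Q N C (snd p i)) a)"

end

theory Submission
  imports Defs
begin

text \<open>
  With \<open>r t = exp (\<alpha> t) P(R > exp t)\<close> and \<open>\<eta>(du)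
      = E[\<Sum>\<^sub>i 1(log C\<^sub>i \<in> du) C\<^sub>i\<^sup>\<alpha>]\<close>, a probability measure
  of mean \<open>m\<close>, the function \<open>r\<close> solves the renewal equation \<open>r = g + \<eta> * r\<close>, where
  \<open>g t = exp (\<alpha> t) (P(R > exp t) - E[\<Sum>\<^sub>i 1(C\<^sub>i R > exp t)])\<close>.

  That \<open>g\<close> is integrable, and the second formula for \<open>H\<close>, follow by integrating
  \<open>1(\<Sum>\<^sub>i y\<^sub>i > v) - \<Sum>\<^sub>i 1(y\<^sub>i > v)\<close>, with \<open>y\<^sub>i = C\<^sub>i R\<^sub>i\<close> and \<open>Q\<close> as an additional summand, against
  \<open>\<alpha> v\<^sup>\<alpha>\<^sup>-\<^sup>1 dv\<close>: in absolute value the integral is bounded by mixed products \<open>y\<^sub>i\<^sup>s y\<^sub>j\<^sup>t\<close> with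
  \<open>i \<noteq> j\<close>, whose expectations only need moments of \<open>R\<close> of order less than \<open>\<alpha>\<close>.

  The renewal theorem is obtained without renewal measures. As \<open>\<integral> exp (- \<theta> u) \<eta>(du) < 1\<close> for small
  \<open>\<theta> > 0\<close>, testing the equation against \<open>min 1 (exp (- \<theta> (s - t)))\<close> shows that \<open>r\<close> is bounded.
  Window integrals of \<open>r\<close> are asymptotically harmonic for \<open>\<eta>\<close>, and a quantitative Choquet--Deny
  argument shows that \<open>r (t - s) - r t \<longrightarrow> 0\<close> for every \<open>s\<close>. Integrating the equation over
  \<open>{..t}\<close> then gives \<open>m r t + o(1) = \<integral>\<^sub>-\<^sub>\<infinity>\<^sup>t g\<close>.
\<close>

section \<open>Asymptotically harmonic functions\<close>

text \<open>Two obstacles shape the proof. The function \<open>g\<close> is only known to be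
  integrable, not directly Riemann integrable, so a key renewal theorem cannot be applied to it. The
  missing regularity is recovered from \<open>r\<close>, because
  \<open>exp (- \<alpha> t) * r t\<close> is a decreasing tail probability: the Choquet-Deny
  argument runs on averages of \<open>r\<close> over short windows, which are Lipschitz, and
  monotonicity carries the conclusion over to the values of \<open>r\<close>. Secondly,
  \<open>R\<close> may have an infinite moment of order \<open>\<alpha>\<close>, and then the two
  expectations whose difference is suggested by the second formula for \<open>H\<close> are
  infinite. Every cancellation is therefore carried out at a fixed sample point, where both terms
  are finite almost surely, and only the difference is integrated. The moments of order less than
  \<open>\<alpha>\<close> come from an affine recursion along the partial sums of \<open>R\<close>
  with factor \<open>E[\<Sum> C_i^b]\<close>; this factor is below 1 for \<open>b\<close> slightly
  below \<open>\<alpha>\<close>, because it equals 1 at \<open>\<alpha>\<close> with derivative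
  \<open>m > 0\<close>.\<close>

lemma (in real_distribution) tendsto_convolution_zero:
  fixes h :: "real \<Rightarrow> real"
  assumes [measurable]: "h \<in> borel_measurable borel"
    and bnd: "\<And>x. \<bar>h x\<bar> \<le> c" and lim: "(h \<longlongrightarrow> 0) at_top"
  shows "((\<lambda>x. \<integral>u. h (x - u) \<partial>M) \<longlongrightarrow> 0) at_top"
proof -
  have "((\<lambda>x. \<integral>u. h (x - u) \<partial>M) \<longlongrightarrow> (\<integral>u. 0 \<partial>M)) at_top"
  proof (rule integral_dominated_convergence_at_top[where w = "\<lambda>_. c"])
    show "AE u in M. ((\<lambda>x. h (x - u)) \<longlongrightarrow> 0) at_top"
    proof (rule AE_I2)
      fix u
      have "filterlim (\<lambda>x::real. - u + x) at_top at_top"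
        by (rule filterlim_tendsto_add_at_top[OF tendsto_const filterlim_ident])
      then show "((\<lambda>x. h (x - u)) \<longlongrightarrow> 0) at_top"
        using filterlim_compose[OF lim, of "\<lambda>x. x - u" at_top] by simp
    qed
  qed (use bnd in \<open>auto intro!: always_eventually\<close>)
  then show ?thesis by simp
qed

lemma (in real_distribution) integrable_convolution:
  fixes h :: "real \<Rightarrow> real"
  assumes [measurable]: "h \<in> borel_measurable borel" and bnd: "\<And>x. \<bar>h x\<bar> \<le> c"
  shows "integrable M (\<lambda>u. h (x - u))"
  by (rule integrable_const_bound[where B = c]) (use bnd in auto)

text \<open>
  A quantitative form of the Choquet--Deny theorem. With \<open>P h x = E h(x - X)\<close> and
  \<open>\<Gamma> x = E (f(x - X) - f x)\<^sup>2\<close>, one has \<open>P f\<^sup>2 = f\<^sup>2 + \<Gamma> + o(1)\<close>, and Jensen's inequality gives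
  \<open>P \<Gamma> \<ge> \<Gamma> - o(1)\<close>; iterating, \<open>N \<Gamma> \<le> K\<^sup>2 + o(1)\<close> for every \<open>N\<close>.
\<close>

lemma (in real_distribution) asymptotically_harmonic_increment:
  fixes f :: "real \<Rightarrow> real"
  assumes [measurable]: "f \<in> borel_measurable borel"
    and bnd: "\<And>x. \<bar>f x\<bar> \<le> K"
    and lim: "((\<lambda>x. f x - (\<integral>u. f (x - u) \<partial>M)) \<longlongrightarrow> 0) at_top"
  shows "((\<lambda>x. \<integral>u. (f (x - u) - f x)\<^sup>2 \<partial>M) \<longlongrightarrow> 0) at_top"
proof -
  define P where "P h x = (\<integral>u. h (x - u) \<partial>M)" for h :: "real \<Rightarrow> real" and x
  define e where "e x = f x - P f x" for x
  define \<Gamma> where "\<Gamma> x = (\<integral>u. (f (x - u) - f x)\<^sup>2 \<partial>M)" for x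
  \<comment> \<open>The o(1) terms of the iteration. Boundedness is carried along with the limit: by
    dominated convergence it makes the averages of such functions vanish at infinity again.\<close>
  define Null where "Null = {h::real \<Rightarrow> real. h \<in> borel_measurable borel \<and> (\<exists>c. \<forall>x. \<bar>h x\<bar>
      \<le> c) \<and> (h \<longlongrightarrow> 0) at_top}"
  have K0: "0 \<le> K" using bnd[of 0] by simp
  have P_meas [measurable]: "P h \<in> borel_measurable borel" if [measurable]: "h \<in> borel_measurable
      borel" for h
    unfolding P_def by measurable
  have P_bnd: "\<bar>P h x\<bar> \<le> c" if [measurable]: "h \<in> borel_measurable borel" and "\<And>x. \<bar>h x\<bar>
      \<le> c" for h c x
  proof -
    have "\<bar>P h x\<bar> \<le> (\<integral>u. \<bar>h (x - u)\<bar> \<partial>M)"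
      unfolding P_def by (rule integral_abs_bound)
    also have "\<dots> \<le> c"
      using that(2) by (intro integral_le_const integrable_convolution[of "\<lambda>x. \<bar>h x\<bar>" c]) auto
    finally show ?thesis .
  qed
  have NullI: "h \<in> Null" if "h \<in> borel_measurable borel" "\<And>x. \<bar>h x\<bar> \<le> c" "(h \<longlongrightarrow> 0) at_top" for h c
    using that unfolding Null_def by blast
  have Null_P: "P h \<in> Null" if h: "h \<in> Null" for h
  proof -
    obtain c where c: "\<And>x. \<bar>h x\<bar> \<le> c"
      using h unfolding Null_def by blast
    have [measurable]: "h \<in> borel_measurable borel" and "(h \<longlongrightarrow> 0) at_top"
      using that unfolding Null_def by auto
    with c have "(P h \<longlongrightarrow> 0) at_top"
      unfolding P_def using tendsto_convolution_zero by blast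
    then show ?thesis
      using P_bnd[OF _ c] by (intro NullI[of _ c]) auto
  qed
  have Null_add: "(\<lambda>x. h x + k x) \<in> Null" if hk: "h \<in> Null" "k \<in> Null" for h k
  proof -
    obtain c d where "\<And>x. \<bar>h x\<bar> \<le> c" "\<And>x. \<bar>k x\<bar> \<le> d"
      using hk unfolding Null_def by blast
    then have "\<bar>h x + k x\<bar> \<le> c + d" for x
      using abs_triangle_ineq[of "h x" "k x"] by (smt (verit))
    then show ?thesis
      using hk tendsto_add[of h 0 at_top k 0] by (intro NullI[of _ "c + d"]) (auto simp: Null_def)
  qed
  have Null_mult: "(\<lambda>x. h x * k x) \<in> Null" if "h \<in> borel_measurable borel" "\<And>x. \<bar>h x\<bar>
      \<le> d" and k: "k \<in> Null" for h k d
  proof -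
    obtain c where c: "\<And>x. \<bar>k x\<bar> \<le> c"
      using k unfolding Null_def by blast
    have "\<bar>h x * k x\<bar> \<le> d * c" for x
      using that(2)[of x] c[of x] by (auto simp: abs_mult intro!: mult_mono)
    moreover have "((\<lambda>x. h x * k x) \<longlongrightarrow> 0) at_top"
    proof (rule Lim_null_comparison)
      show "\<forall>\<^sub>F x in at_top. norm (h x * k x) \<le> d * \<bar>k x\<bar>"
        using that(2) by (auto intro!: always_eventually mult_right_mono simp: abs_mult)
      show "((\<lambda>x. d * \<bar>k x\<bar>) \<longlongrightarrow> 0) at_top"
        using that(3) unfolding Null_def by (auto intro!: tendsto_mult_right_zero tendsto_rabs_zero)
    qed
    ultimately show ?thesis
      using that by (intro NullI[of _ "d * c"]) (auto simp: Null_def)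
  qed
  have e_meas [measurable]: "e \<in> borel_measurable borel"
    unfolding e_def by measurable
  have e_bnd: "\<bar>e x\<bar> \<le> 2 * K" for x
    unfolding e_def using bnd[of x] P_bnd[of f K x, OF _ bnd] by auto
  have e_Null: "e \<in> Null"
    using e_bnd lim by (intro NullI[of _ "2 * K"]) (auto simp: e_def[abs_def] P_def)
  have abs_e_Null: "(\<lambda>x. \<bar>e x\<bar>) \<in> Null"
    using e_Null unfolding Null_def by (auto intro!: tendsto_rabs_zero)
  have sq_bnd: "\<bar>(f x - f y)\<^sup>2\<bar> \<le> (2 * K)\<^sup>2" for x y
  proof -
    have "\<bar>f x - f y\<bar> \<le> 2 * K" using bnd[of x] bnd[of y] by linarith
    then show ?thesis using abs_le_square_iff[of "f x - f y" "2 * K"] K0 by simp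
  qed
  have Gam_meas [measurable]: "\<Gamma> \<in> borel_measurable borel"
    unfolding \<Gamma>_def by measurable
  have Gam_bnd: "\<bar>\<Gamma> x\<bar> \<le> (2 * K)\<^sup>2" for x
  proof -
    have "\<bar>\<Gamma> x\<bar> \<le> (\<integral>u. \<bar>(f (x - u) - f x)\<^sup>2\<bar> \<partial>M)"
      unfolding \<Gamma>_def by (rule integral_abs_bound)
    also have "\<dots> \<le> (2 * K)\<^sup>2"
      using sq_bnd by (intro integral_le_const integrable_convolution[of "\<lambda>y. \<bar>(f y - f x)\<^sup>2\<bar>" "(2
          * K)\<^sup>2"]) auto
    finally show ?thesis .
  qed
  have f2_bnd: "\<bar>(f x)\<^sup>2\<bar> \<le> K\<^sup>2" for x
    using bnd[of x] abs_le_square_iff[of "f x" K] K0 by simp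
  have Pf2: "P (\<lambda>y. (f y)\<^sup>2) x = (f x)\<^sup>2 + \<Gamma> x - 2 * f x * e x" for x
  proof -
    have "\<Gamma> x = (\<integral>u. (f (x - u))\<^sup>2 - 2 * f x * f (x - u) + (f x)\<^sup>2 \<partial>M)"
      unfolding \<Gamma>_def by (intro Bochner_Integration.integral_cong) (auto simp: power2_eq_square
          algebra_simps)
    also have "\<dots> = P (\<lambda>y. (f y)\<^sup>2) x - 2 * f x * P f x + (f x)\<^sup>2"
      unfolding P_def
      using integrable_convolution[of "\<lambda>y. (f y)\<^sup>2", OF _ f2_bnd] integrable_convolution[of f, OF _
          bnd] prob_space
      by simp
    finally show ?thesis
      unfolding e_def by (simp add: algebra_simps power2_eq_square)
  qed
  \<comment> \<open>For fixed \<open>u\<close>, the increment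
    \<open>f (x - y - u) - f (x - y)\<close> as a function of \<open>y\<close> has mean
    \<open>f (x - u) - f x\<close> up to the errors \<open>e\<close>, and its mean square is at
    least the square of that mean. Exchanging the integrals over \<open>u\<close> and
    \<open>y\<close> turns this into a bound for the average of \<open>\<Gamma>\<close>.\<close>
  have PG: "P \<Gamma> x \<ge> \<Gamma> x - 4 * K * (P (\<lambda>y. \<bar>e y\<bar>) x + \<bar>e x\<bar>)" for x
  proof -
    interpret MM: pair_prob_space M M ..
    have "P \<Gamma> x = (\<integral>y. \<integral>u. (f (x - y - u) - f (x - y))\<^sup>2 \<partial>M \<partial>M)"
      unfolding P_def \<Gamma>_def ..
    also have "\<dots> = (\<integral>u. \<integral>y. (f (x - y - u) - f (x - y))\<^sup>2 \<partial>M \<partial>M)"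
    proof (rule MM.Fubini_integral[symmetric])
      show "integrable (M \<Otimes>\<^sub>M M) (\<lambda>(y, u). (f (x - y - u) - f (x - y))\<^sup>2)"
        by (rule MM.P.integrable_const_bound[where B = "(2 * K)\<^sup>2"]) (use sq_bnd in auto)
    qed
    also have "\<dots> \<ge> (\<integral>u. (f (x - u) - f x)\<^sup>2 - 4 * K * (\<bar>e (x - u)\<bar> + \<bar>e x\<bar>) \<partial>M)"
    proof (rule integral_mono)
      show "integrable M (\<lambda>u. (f (x - u) - f x)\<^sup>2 - 4 * K * (\<bar>e (x - u)\<bar> + \<bar>e x\<bar>))"
        using sq_bnd e_bnd by (intro Bochner_Integration.integrable_diff integrable_mult_right
            Bochner_Integration.integrable_add
          integrable_convolution[of "\<lambda>y. (f y - f x)\<^sup>2" "(2 * K)\<^sup>2"] integrable_convolution[of "\<lambda>y.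
              \<bar>e y\<bar>" "2 * K"]) auto
      have "\<bar>\<integral>y. (f (x - y - u) - f (x - y))\<^sup>2 \<partial>M\<bar> \<le> (2 * K)\<^sup>2" for u
        using P_bnd[of "\<lambda>z. (f (z - u) - f z)\<^sup>2" "(2 * K)\<^sup>2" x] sq_bnd by (simp add: P_def)
      then show "integrable M (\<lambda>u. \<integral>y. (f (x - y - u) - f (x - y))\<^sup>2 \<partial>M)"
        by (intro integrable_const_bound[where B = "(2 * K)\<^sup>2"]) auto
      fix u
      define q where "q y = f (x - y - u) - f (x - y)" for y
      have q_meas [measurable]: "q \<in> borel_measurable borel"
        unfolding q_def by measurable
      have "\<bar>q y\<bar> \<le> 2 * K" for y
        unfolding q_def using bnd[of "x - y - u"] bnd[of "x - y"] by linarith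
      then have q_int: "integrable M q"
        by (intro integrable_const_bound[where B = "2 * K"]) auto
      have q2_int: "integrable M (\<lambda>y. (q y)\<^sup>2)"
        using sq_bnd by (intro integrable_const_bound[where B = "(2 * K)\<^sup>2"]) (auto simp: q_def)
      define c where "c = integral\<^sup>L M q"
      have "c = (\<integral>y. f (x - u - y) \<partial>M) - (\<integral>y. f (x - y) \<partial>M)"
        unfolding c_def q_def
        using integrable_convolution[of f, OF _ bnd, of "x - u"] integrable_convolution[of f, OF _
            bnd, of x]
        by (simp add: algebra_simps)
      then have c_eq: "c = (f (x - u) - f x) - (e (x - u) - e x)"
        unfolding e_def P_def by simp
      have "0 \<le> (\<integral>y. (q y - c)\<^sup>2 \<partial>M)"
        by (rule Bochner_Integration.integral_nonneg) simp
      also have "\<dots> = (\<integral>y. (q y)\<^sup>2 - 2 * c * q y + c\<^sup>2 \<partial>M)"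
        by (intro Bochner_Integration.integral_cong) (auto simp: power2_eq_square algebra_simps)
      also have "\<dots> = (\<integral>y. (q y)\<^sup>2 \<partial>M) - 2 * c * c + c\<^sup>2"
        using q_int q2_int prob_space unfolding c_def by simp
      finally have "c\<^sup>2 \<le> (\<integral>y. (q y)\<^sup>2 \<partial>M)"
        by (simp add: power2_eq_square)
      \<comment> \<open>The factor \<open>4 * K\<close> is twice the bound \<open>2 * K\<close> for
        the increment \<open>a\<close>; the errors are collected in \<open>b\<close>, and the square
        of \<open>a - b\<close> is at least the square of \<open>a\<close> minus
        \<open>2 * a * b\<close>.\<close>
      moreover have "(f (x - u) - f x)\<^sup>2 - 4 * K * (\<bar>e (x - u)\<bar> + \<bar>e x\<bar>) \<le> c\<^sup>2"
      proof -
        define a b where "a = f (x - u) - f x" and "b = e (x - u) - e x"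
        have "\<bar>a\<bar> \<le> 2 * K" unfolding a_def using bnd[of "x - u"] bnd[of x] by linarith
        moreover have "\<bar>b\<bar> \<le> \<bar>e (x - u)\<bar> + \<bar>e x\<bar>" unfolding b_def by linarith
        ultimately have "\<bar>a * b\<bar> \<le> 2 * K * (\<bar>e (x - u)\<bar> + \<bar>e x\<bar>)"
          unfolding abs_mult by (intro mult_mono) (use K0 in auto)
        moreover have "(a - b)\<^sup>2 = a\<^sup>2 - 2 * (a * b) + b\<^sup>2"
          by (simp add: power2_eq_square algebra_simps)
        moreover have "0 \<le> b\<^sup>2" by simp
        ultimately show ?thesis
          unfolding c_eq a_def[symmetric] b_def[symmetric] by linarith
      qed
      ultimately show "(f (x - u) - f x)\<^sup>2 - 4 * K * (\<bar>e (x - u)\<bar> + \<bar>e x\<bar>)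
          \<le> (\<integral>y. (f (x - y - u) - f (x - y))\<^sup>2 \<partial>M)"
        unfolding q_def by linarith
    qed
    also have "(\<integral>u. (f (x - u) - f x)\<^sup>2 - 4 * K * (\<bar>e (x - u)\<bar> + \<bar>e x\<bar>) \<partial>M) =
        \<Gamma> x - 4 * K * (P (\<lambda>y. \<bar>e y\<bar>) x + \<bar>e x\<bar>)"
    proof -
      have i1: "integrable M (\<lambda>u. (f (x - u) - f x)\<^sup>2)"
        using integrable_convolution[of "\<lambda>y. (f y - f x)\<^sup>2" "(2 * K)\<^sup>2"] sq_bnd by simp
      have i2: "integrable M (\<lambda>u. \<bar>e (x - u)\<bar>)"
        using integrable_convolution[of "\<lambda>y. \<bar>e y\<bar>" "2 * K"] e_bnd by simp
      show ?thesis
        unfolding \<Gamma>_def P_def using i1 i2 prob_space by simp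
    qed
    finally show ?thesis by simp
  qed
  \<comment> \<open>The witness \<open>h\<close> is the \<open>n\<close>-fold average of the square
    of \<open>f\<close>. It keeps the bound for every \<open>n\<close>, while each further average
    releases one more copy of \<open>\<Gamma>\<close>.\<close>
  have claim: "\<exists>h \<epsilon>. h \<in> borel_measurable borel \<and> (\<forall>x. \<bar>h x\<bar> \<le> K\<^sup>2) \<and> \<epsilon> \<in> Null \<and>
      (\<forall>x. (f x)\<^sup>2 + real n * \<Gamma> x - \<epsilon> x \<le> h x)" for n
  proof (induction n)
    case 0
    have "(\<lambda>x. 0) \<in> Null" by (intro NullI[of _ 0]) auto
    then show ?case
      using f2_bnd by (intro exI[of _ "\<lambda>x. (f x)\<^sup>2"] exI[of _ "\<lambda>_. 0"]) auto
  next
    case (Suc n)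
    then obtain h \<epsilon> where h[measurable]: "h \<in> borel_measurable borel" and h_bnd: "\<And>x. \<bar>h x\<bar> \<le> K\<^sup>2"
      and \<epsilon>: "\<epsilon> \<in> Null" and le: "\<And>x. (f x)\<^sup>2 + real n * \<Gamma> x - \<epsilon> x \<le> h x" by blast
    have [measurable]: "\<epsilon> \<in> borel_measurable borel" using \<epsilon> by (simp add: Null_def)
    obtain c where c: "\<And>x. \<bar>\<epsilon> x\<bar> \<le> c" using \<epsilon> by (auto simp: Null_def)
    define e' where "e' x = 4 * K * (P (\<lambda>y. \<bar>e y\<bar>) x + \<bar>e x\<bar>)" for x
    define \<epsilon>' where "\<epsilon>' x = 2 * f x * e x + (real n * e' x + P \<epsilon> x)" for x
    have "e' \<in> Null"
      unfolding e'_def by (intro Null_mult[of _ "4 * K"] Null_add Null_P abs_e_Null) (use K0 in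
          auto)
    then have "\<epsilon>' \<in> Null"
      unfolding \<epsilon>'_def
      by (intro Null_add Null_mult[of _ "2 * K"] Null_mult[of _ "real n"] Null_P \<epsilon> e_Null)
         (use bnd in \<open>auto simp: abs_mult\<close>)
    moreover have "(f x)\<^sup>2 + real (Suc n) * \<Gamma> x - \<epsilon>' x \<le> P h x" for x
    proof -
      have i1: "integrable M (\<lambda>u. (f (x - u))\<^sup>2)" "integrable M (\<lambda>u. \<Gamma> (x - u))" "integrable M
          (\<lambda>u. \<epsilon> (x - u))"
        using integrable_convolution[of "\<lambda>y. (f y)\<^sup>2", OF _ f2_bnd] integrable_convolution[of \<Gamma>, OF
            _ Gam_bnd]
          integrable_convolution[of \<epsilon>, OF _ c] by auto
      have "P (\<lambda>y. (f y)\<^sup>2) x + real n * P \<Gamma> x - P \<epsilon> x = P (\<lambda>y. (f y)\<^sup>2 + real n * \<Gamma> y - \<epsilon> y) x"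
        unfolding P_def using i1 by simp
      also have "\<dots> \<le> P h x"
        unfolding P_def
        using i1 le integrable_convolution[OF h h_bnd, of x] by (intro integral_mono) auto
      finally have "P (\<lambda>y. (f y)\<^sup>2) x + real n * P \<Gamma> x - P \<epsilon> x \<le> P h x" .
      moreover have "real n * (\<Gamma> x - e' x) \<le> real n * P \<Gamma> x"
        using PG[of x] by (intro mult_left_mono) (auto simp: e'_def)
      ultimately show ?thesis
        unfolding Pf2 \<epsilon>'_def by (simp add: algebra_simps)
    qed
    ultimately show ?case
      using P_bnd[OF h h_bnd] by (intro exI[of _ "P h"] exI[of _ \<epsilon>']) auto
  qed
  have "(\<Gamma> \<longlongrightarrow> 0) at_top"
  proof (rule tendstoI)
    fix r :: real assume r: "r > 0"
    \<comment> \<open>The error term depends on \<open>n\<close>, so \<open>n\<close> is fixed from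
      \<open>r\<close> before \<open>x\<close> tends to infinity.\<close>
    obtain n :: nat where n: "(K\<^sup>2 + 1) / r < real n"
      using reals_Archimedean2 by blast
    obtain h \<epsilon> where h_bnd: "\<And>x. \<bar>h x\<bar> \<le> K\<^sup>2" and \<epsilon>: "\<epsilon> \<in> Null"
      and le: "\<And>x. (f x)\<^sup>2 + real n * \<Gamma> x - \<epsilon> x \<le> h x" using claim[of n] by blast
    have "\<forall>\<^sub>F x in at_top. \<epsilon> x < 1"
      using \<epsilon> order_tendstoD(2)[of \<epsilon> 0 at_top 1] by (auto simp: Null_def)
    then show "\<forall>\<^sub>F x in at_top. dist (\<Gamma> x) 0 < r"
    proof eventually_elim
      case (elim x)
      have "0 \<le> \<Gamma> x" unfolding \<Gamma>_def by (rule Bochner_Integration.integral_nonneg) simp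
      have "real n * \<Gamma> x \<le> K\<^sup>2 + 1"
        using le[of x] h_bnd[of x] elim zero_le_power2[of "f x"] by linarith
      also have "\<dots> < real n * r" using n r by (simp add: field_simps)
      finally have "\<Gamma> x < r" by (rule mult_left_less_imp_less) simp
      with \<open>0 \<le> \<Gamma> x\<close> show ?case by simp
    qed
  qed
  then show ?thesis unfolding \<Gamma>_def .
qed

text \<open>An increment of size at least \<open>r\<close> at \<open>y\<close> forces increments of
  size at least \<open>r / 2\<close> on a whole \<open>\<delta>\<close>-neighbourhood of
  \<open>y\<close>. This neighbourhood has a fixed positive mass, so the mean square increment would
  stay away from 0.\<close>

lemma (in real_distribution) lipschitz_increments_vanish_on_support:
  fixes f :: "real \<Rightarrow> real"
  assumes lip: "\<And>x y. \<bar>f x - f y\<bar> \<le> L * \<bar>x - y\<bar>" and bnd: "\<And>x. \<bar>f x\<bar> \<le> K"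
    and meas[measurable]: "f \<in> borel_measurable borel"
    and lim: "((\<lambda>x. f x - (\<integral>u. f (x - u) \<partial>M)) \<longlongrightarrow> 0) at_top"
    and supp: "\<And>\<delta>. \<delta> > 0 \<Longrightarrow> measure M {y - \<delta><..<y + \<delta>} > 0"
  shows "((\<lambda>x. f (x - y) - f x) \<longlongrightarrow> 0) at_top"
proof (rule tendstoI)
  fix r :: real assume r: "r > 0"
  have L0: "0 \<le> L" using lip[of 1 0] by simp
  \<comment> \<open>Using \<open>L + 1\<close> instead of \<open>L\<close> keeps the denominator
    positive when \<open>L = 0\<close>.\<close>
  define \<delta> where "\<delta> = r / (2 * (L + 1))"
  have \<delta>: "\<delta> > 0" "L * \<delta> \<le> r / 2" unfolding \<delta>_def using r L0 by (auto simp: field_simps)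
  define c where "c = measure M {y - \<delta><..<y + \<delta>}"
  have c: "c > 0" unfolding c_def using supp[OF \<delta>(1)] .
  have "\<forall>\<^sub>F x in at_top. (\<integral>u. (f (x - u) - f x)\<^sup>2 \<partial>M) < c * (r / 2)\<^sup>2"
    using asymptotically_harmonic_increment[OF meas bnd lim] c r by (intro order_tendstoD(2)) auto
  then show "\<forall>\<^sub>F x in at_top. dist (f (x - y) - f x) 0 < r"
  proof eventually_elim
    case (elim x)
    show ?case
    proof (rule ccontr)
      assume "\<not> dist (f (x - y) - f x) 0 < r"
      then have big: "\<bar>f (x - y) - f x\<bar> \<ge> r" by simp
      have sq_bnd: "\<bar>(f (x - u) - f x)\<^sup>2\<bar> \<le> (2 * K)\<^sup>2" for u
      proof -
        have "\<bar>f (x - u) - f x\<bar> \<le> \<bar>2 * K\<bar>" using bnd[of "x - u"] bnd[of x] by linarith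
        then show ?thesis using abs_le_square_iff[of "f (x - u) - f x" "2 * K"] by simp
      qed
      have "c * (r / 2)\<^sup>2 = (\<integral>u. (r / 2)\<^sup>2 * indicator {y - \<delta><..<y + \<delta>} u \<partial>M)"
        unfolding c_def by simp
      also have "\<dots> \<le> (\<integral>u. (f (x - u) - f x)\<^sup>2 \<partial>M)"
      proof (rule integral_mono)
        show "integrable M (\<lambda>u. (r / 2)\<^sup>2 * indicator {y - \<delta><..<y + \<delta>} u :: real)"
          by (intro integrable_mult_right integrable_real_indicator) (auto simp:
              emeasure_eq_measure)
        show "integrable M (\<lambda>u. (f (x - u) - f x)\<^sup>2)"
          by (rule integrable_const_bound[where B = "(2 * K)\<^sup>2"]) (use sq_bnd in auto)
        fix u
        show "(r / 2)\<^sup>2 * indicator {y - \<delta><..<y + \<delta>} u \<le> (f (x - u) - f x)\<^sup>2"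
        proof (cases "u \<in> {y - \<delta><..<y + \<delta>}")
          case True
          have "\<bar>f (x - u) - f (x - y)\<bar> \<le> L * \<bar>(x - u) - (x - y)\<bar>" by (rule lip)
          also have "\<dots> \<le> L * \<delta>" using True L0 by (intro mult_left_mono) auto
          finally have "r / 2 \<le> \<bar>f (x - u) - f x\<bar>" using big \<delta>(2) by linarith
          then have "\<bar>r / 2\<bar> \<le> \<bar>f (x - u) - f x\<bar>" using r by simp
          then show ?thesis using True abs_le_square_iff[of "r / 2"] by simp
        qed simp
      qed
      finally show False using elim by simp
    qed
  qed
qed

text \<open>A set without support points is covered by open intervals of measure zero; by Lindelof
  countably many of them suffice, so the set is null.\<close>

lemma (in real_distribution) exists_support_point:
  assumes [measurable]: "A \<in> sets borel" and A: "emeasure M A \<noteq> 0"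
  shows "\<exists>y\<in>A. \<forall>\<delta>>0. measure M {y - \<delta><..<y + \<delta>} > 0"
proof (rule ccontr)
  assume *: "\<not> ?thesis"
  define \<F> where "\<F> = {{y - \<delta><..<y + \<delta>} | y \<delta>. \<delta> > 0 \<and> measure M {y - \<delta><..<y + \<delta>} = 0}"
  obtain \<G> where \<G>: "\<G> \<subseteq> \<F>" "countable \<G>" "\<Union>\<G> = \<Union>\<F>"
    by (rule Lindelof[of \<F>]) (auto simp: \<F>_def)
  have "A \<subseteq> \<Union>\<F>"
  proof
    fix y assume "y \<in> A"
    then obtain \<delta> where "\<delta> > 0" "\<not> measure M {y - \<delta><..<y + \<delta>} > 0" using * by blast
    then have "\<delta> > 0 \<and> measure M {y - \<delta><..<y + \<delta>} = 0" "y \<in> {y - \<delta><..<y + \<delta>}"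
      using measure_nonneg[of M "{y - \<delta><..<y + \<delta>}"] by auto
    then have "{y - \<delta><..<y + \<delta>} \<in> \<F>" "y \<in> {y - \<delta><..<y + \<delta>}"
      unfolding \<F>_def by blast+
    then show "y \<in> \<Union>\<F>" by blast
  qed
  have "X \<in> null_sets M" if "X \<in> \<G>" for X
  proof -
    have "X \<in> \<F>" using \<G>(1) that by blast
    then obtain y \<delta> where "X = {y - \<delta><..<y + \<delta>}" "measure M X = 0" unfolding \<F>_def by blast
    then show ?thesis by (simp add: null_sets_def emeasure_eq_measure)
  qed
  then have "(\<Union>X\<in>\<G>. X) \<in> null_sets M"
    by (rule null_sets_UN'[OF \<G>(2)])
  then have "A \<in> null_sets M"
    by (rule null_sets_subset) (use \<open>A \<subseteq> \<Union>\<F>\<close> \<G>(3) in auto)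
  then show False using A by auto
qed

text \<open>The shifts with vanishing increments form an additive group that contains the support. A
  group of reals without arbitrarily small positive elements lies in a lattice, which a
  nonarithmetic law excludes; hence the group is dense, and the Lipschitz bound extends the
  conclusion to every shift.\<close>

lemma (in real_distribution) lipschitz_asymptotically_translation_invariant:
  fixes f :: "real \<Rightarrow> real"
  assumes lip: "\<And>x y. \<bar>f x - f y\<bar> \<le> L * \<bar>x - y\<bar>" and bnd: "\<And>x. \<bar>f x\<bar> \<le> K"
    and meas[measurable]: "f \<in> borel_measurable borel"
    and lim: "((\<lambda>x. f x - (\<integral>u. f (x - u) \<partial>M)) \<longlongrightarrow> 0) at_top"
    and nonarith: "\<And>d. d > 0 \<Longrightarrow> emeasure M (- {d * of_int k | k. True}) \<noteq> 0"
  shows "((\<lambda>x. f (x - y) - f x) \<longlongrightarrow> 0) at_top"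
proof -
  define G where "G = {y. ((\<lambda>x. f (x - y) - f x) \<longlongrightarrow> 0) at_top}"
  have L0: "0 \<le> L" using lip[of 1 0] by simp
  have shift: "filterlim (\<lambda>x::real. x - c) at_top at_top" for c
    using filterlim_tendsto_add_at_top[OF tendsto_const[of "- c"] filterlim_ident] by simp
  have G_add: "y + z \<in> G" if "y \<in> G" "z \<in> G" for y z
  proof -
    have "((\<lambda>x. (f ((x - y) - z) - f (x - y)) + (f (x - y) - f x)) \<longlongrightarrow> 0 + 0) at_top"
      using that by (intro tendsto_add filterlim_compose[OF _ shift, of "\<lambda>x. f (x - z) - f x"])
          (auto simp: G_def)
    then show ?thesis by (simp add: G_def diff_diff_eq)
  qed
  have G_minus: "- y \<in> G" if "y \<in> G" for y
  proof -
    have "((\<lambda>x. - (f ((x - (- y)) - y) - f (x - (- y)))) \<longlongrightarrow> - 0) at_top"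
      using that by (intro tendsto_minus filterlim_compose[OF _ shift, of "\<lambda>x. f (x - y) - f x"])
          (auto simp: G_def)
    then show ?thesis by (simp add: G_def)
  qed
  have G0: "0 \<in> G" by (simp add: G_def)
  have G_nat: "real n * y \<in> G" if "y \<in> G" for n y
    by (induction n) (use G0 G_add that in \<open>auto simp: algebra_simps\<close>)
  have G_int: "of_int k * y \<in> G" if "y \<in> G" for k y
  proof (cases "k \<ge> 0")
    case True
    then show ?thesis using G_nat[OF that, of "nat k"] by simp
  next
    case False
    then show ?thesis using G_minus[OF G_nat[OF that, of "nat (- k)"]] by simp
  qed
  have G_floor: "w - of_int \<lfloor>w / y\<rfloor> * y \<in> G" if "y \<in> G" "w \<in> G" for w y
    using G_add[OF that(2) G_minus[OF G_int[OF that(1)]]] by simp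
  have floor_bounds: "0 \<le> w - of_int \<lfloor>w / y\<rfloor> * y" "w - of_int \<lfloor>w / y\<rfloor> * y < y" if "y > 0" for w y
      :: real
    using that floor_divide_lower[OF that, of w] floor_divide_upper[OF that, of w]
        by (auto simp: algebra_simps)
  have small: "\<exists>y\<in>G. 0 < y \<and> y < \<epsilon>" if \<epsilon>: "\<epsilon> > 0" for \<epsilon>
  proof (rule ccontr)
    assume no: "\<not> ?thesis"
    have "\<exists>d>0. G \<subseteq> {d * of_int k | k. True}"
    proof (cases "\<exists>y\<in>G. y > 0")
      case False
      then have "y = 0" if "y \<in> G" for y
        using that G_minus[OF that] by (meson linorder_neqE_linordered_idom neg_0_less_iff_less)
      then have "G \<subseteq> {0}" by blast
      also have "\<dots> \<subseteq> {1 * of_int k | k. True}" by (auto intro!: exI[of _ 0])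
      finally show ?thesis by (intro exI[of _ 1]) simp
    next
      case True
      \<comment> \<open>The infimum of the positive elements is attained, since two different
        elements within \<open>\<epsilon>\<close> above it would differ by a positive element below
        \<open>\<epsilon>\<close>. Division with remainder then makes it a generator.\<close>
      define d where "d = Inf (G \<inter> {0<..})"
      have bdd: "bdd_below (G \<inter> {0<..})" by (intro bdd_belowI[of _ 0]) auto
      have d_le: "d \<le> y" if "y \<in> G" "y > 0" for y
        unfolding d_def using that bdd by (intro cInf_lower) auto
      have "d \<ge> \<epsilon>"
        unfolding d_def using True no by (intro cInf_greatest) force+
      obtain y where y: "y \<in> G" "y > 0" "y < d + \<epsilon>"
        using cInf_lessD[of "G \<inter> {0<..}" "d + \<epsilon>"] True \<epsilon> unfolding d_def by auto
      have "y = d"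
      proof (rule ccontr)
        assume "y \<noteq> d"
        then have "d < y" using d_le[OF y(1,2)] by simp
        then obtain z where z: "z \<in> G" "z > 0" "z < y"
          using cInf_lessD[of "G \<inter> {0<..}" y] True unfolding d_def by auto
        have "y - z \<in> G" using G_add[OF y(1) G_minus[OF z(1)]] by simp
        moreover have "y - z < \<epsilon>" using y d_le[OF z(1,2)] by linarith
        ultimately show False using no z(3) by force
      qed
      then have d: "d \<in> G" "d > 0" using y by auto
      have "w \<in> {d * of_int k | k. True}" if "w \<in> G" for w
      proof -
        have "w - of_int \<lfloor>w / d\<rfloor> * d = 0"
          using d_le[OF G_floor[OF d(1) that]] floor_bounds[OF d(2), of w] by linarith
        then show ?thesis by (intro CollectI exI[of _ "\<lfloor>w / d\<rfloor>"]) (simp add: mult.commute)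
      qed
      then show ?thesis using d by blast
    qed
    then obtain d where d: "d > 0" "G \<subseteq> {d * of_int k | k. True}" by blast
    have "{d * of_int k | k. True} = range (\<lambda>k::int. d * of_int k)" by auto
    moreover have "countable (range (\<lambda>k::int. d * of_int k))" by simp
    ultimately have "{d * of_int k | k. True} \<in> sets borel"
      using sets.countable[of "range (\<lambda>k::int. d * of_int k)" borel] by simp
    then have "- {d * of_int k | k. True} \<in> sets borel"
      by (rule borel_comp)
    from exists_support_point[OF this nonarith[OF d(1)]]
    obtain z where z: "z \<notin> {d * of_int k | k. True}" "\<And>\<delta>. \<delta> > 0
        \<Longrightarrow> measure M {z - \<delta><..<z + \<delta>} > 0" by auto
    from lipschitz_increments_vanish_on_support[OF lip bnd meas lim z(2)] have "z \<in> G"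
      by (simp add: G_def)
    with d z(1) show False by blast
  qed
  have "y \<in> G"
    unfolding G_def
  proof (rule CollectI, rule tendstoI)
    fix r :: real assume r: "r > 0"
    define \<epsilon> where "\<epsilon> = r / (2 * (L + 1))"
    have \<epsilon>: "\<epsilon> > 0" "L * \<epsilon> \<le> r / 2" unfolding \<epsilon>_def using r L0 by (auto simp: field_simps)
    obtain z where z: "z \<in> G" "0 < z" "z < \<epsilon>" using small[OF \<epsilon>(1)] by blast
    \<comment> \<open>The multiple of \<open>z\<close> next below \<open>y\<close>, hence an element
      of the group within \<open>\<epsilon>\<close> of \<open>y\<close>.\<close>
    define w where "w = of_int \<lfloor>y / z\<rfloor> * z"
    have "w \<in> G" unfolding w_def by (rule G_int[OF z(1)])
    then have "\<forall>\<^sub>F x in at_top. dist (f (x - w) - f x) 0 < r / 2"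
      using r by (intro tendstoD) (auto simp: G_def)
    then show "\<forall>\<^sub>F x in at_top. dist (f (x - y) - f x) 0 < r"
    proof eventually_elim
      case (elim x)
      have "\<bar>f (x - y) - f (x - w)\<bar> \<le> L * \<bar>(x - y) - (x - w)\<bar>" by (rule lip)
      also have "\<dots> \<le> L * \<epsilon>"
        using floor_bounds[OF z(2), of y] z L0 by (intro mult_left_mono) (auto simp: w_def)
      finally show ?case using elim \<epsilon>(2) unfolding dist_real_def by linarith
    qed
  qed
  then show ?thesis by (simp add: G_def)
qed

text \<open>The kernel is at most \<open>1 / \<kappa>\<close> times the sum of an exponential
  density started at \<open>t\<close> and its mirror image, each of total mass one.\<close>

lemma nn_integral_exp_abs_less_top:
  fixes \<kappa> t :: real
  assumes "\<kappa> > 0"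
  shows "(\<integral>\<^sup>+s. ennreal (exp (- \<kappa> * \<bar>s - t\<bar>)) \<partial>lborel) < \<infinity>"
proof -
  let ?d = "\<lambda>x. ennreal (exponential_density \<kappa> x)"
  interpret prob_space "density lborel (exponential_density \<kappa>)"
    by (rule prob_space_exponential_density) fact
  have 1: "(\<integral>\<^sup>+x. ?d x \<partial>lborel) = 1"
    using emeasure_space_1 by (simp add: emeasure_density)
  have 2: "(\<integral>\<^sup>+x. ?d (- t + 1 * x) \<partial>lborel) = 1"
    using nn_integral_real_affine[of ?d 1 "- t"] 1 by simp
  have 3: "(\<integral>\<^sup>+x. ?d (t + (- 1) * x) \<partial>lborel) = 1"
    using nn_integral_real_affine[of ?d "-1" t] 1 by simp
  have "(\<integral>\<^sup>+s. ennreal (exp (- \<kappa> * \<bar>s - t\<bar>)) \<partial>lborel)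
      \<le> (\<integral>\<^sup>+s. ennreal (1 / \<kappa>) * (?d (- t + 1 * s) + ?d (t + (- 1) * s)) \<partial>lborel)"
  proof (rule nn_integral_mono)
    fix s :: real
    have d0: "0 \<le> exponential_density \<kappa> x" for x using assms by (rule exponential_density_nonneg)
    have "exp (- \<kappa> * \<bar>s - t\<bar>) = 1 / \<kappa> * exponential_density \<kappa> \<bar>s - t\<bar>"
      using assms by (simp add: exponential_density_def mult.commute)
    also have "\<dots> \<le> 1 / \<kappa> * (exponential_density \<kappa> (- t + 1 * s) + exponential_density \<kappa> (t
        + (- 1) * s))"
    proof (intro mult_left_mono)
      show "exponential_density \<kappa> \<bar>s - t\<bar>
          \<le> exponential_density \<kappa> (- t + 1 * s) + exponential_density \<kappa> (t + (- 1) * s)"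
        using d0[of "s - t"] d0[of "t - s"] by (cases "s \<ge> t") simp_all
    qed (use assms in simp)
    finally show "ennreal (exp (- \<kappa> * \<bar>s - t\<bar>))
        \<le> ennreal (1 / \<kappa>) * (?d (- t + 1 * s) + ?d (t + (- 1) * s))"
      using assms d0 ennreal_leI by (subst ennreal_plus[symmetric], simp, simp, subst
          ennreal_mult[symmetric]) auto
  qed
  also have "\<dots> = ennreal (1 / \<kappa>) * ((\<integral>\<^sup>+x. ?d (- t + 1 * x) \<partial>lborel) + (\<integral>\<^sup>+x. ?d (t
      + (- 1) * x) \<partial>lborel))"
    by (subst nn_integral_cmult, measurable, subst nn_integral_add, measurable)
  also have "\<dots> = ennreal (1 / \<kappa>) * 2"
    unfolding 2 3 one_add_one ..
  also have "\<dots> < \<infinity>" using ennreal_mult_less_top by fastforce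
  finally show ?thesis .
qed

section \<open>The renewal theorem\<close>

text \<open>
  Here \<open>M\<close> is the step distribution of the walk. Integrability at both ends comes from the
  exponential growth rate \<open>\<theta>'\<close> of \<open>r\<close> being strictly smaller than an exponent \<open>\<theta>\<close> with
  \<open>E exp (- \<theta> X) < 1\<close>.
\<close>

locale renewal_equation = real_distribution M for M +
  fixes r g :: "real \<Rightarrow> real" and a \<theta> \<theta>' B :: real
  assumes r_meas [measurable]: "r \<in> borel_measurable borel"
    and r_nonneg: "\<And>t. 0 \<le> r t"
    and a_nonneg: "0 \<le> a"
    and r_decay: "\<And>s t. s \<le> t \<Longrightarrow> r t \<le> exp (a * (t - s)) * r s"
    and r_growth: "\<And>t. r t \<le> B * exp (\<theta>' * t)"
    and \<theta>'_pos: "0 < \<theta>'" and \<theta>'_less: "\<theta>' < \<theta>"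
    and g_int: "integrable lborel g"
    and r_int: "\<And>t. integrable M (\<lambda>u. r (t - u))"
    and eq: "\<And>t. r t = g t + (\<integral>u. r (t - u) \<partial>M)"
    and laplace: "(\<integral>\<^sup>+u. ennreal (exp (- \<theta> * u)) \<partial>M) < 1"
    and mean_int: "integrable M (\<lambda>u. u)"
begin

lemma g_meas [measurable]: "g \<in> borel_measurable borel"
  using borel_measurable_integrable[OF g_int] by simp

lemma B_nonneg: "0 \<le> B"
  using r_nonneg[of 0] r_growth[of 0] by simp

text \<open>
  Testing the equation against \<open>\<phi> s = min 1 (exp (- \<theta> (s - t)))\<close>: since \<open>E exp (- \<theta> X) < 1\<close>,
  this function is superharmonic for the walk, with a definite drop on \<open>[t, t + 1]\<close>.
\<close>

lemma r_bounded: "\<exists>c. \<forall>t. r t \<le> c"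
proof -
  obtain \<rho> where \<rho>: "(\<integral>\<^sup>+u. ennreal (exp (- \<theta> * u)) \<partial>M) = ennreal \<rho>" "0 \<le> \<rho>"
    using laplace by (cases "\<integral>\<^sup>+u. ennreal (exp (- \<theta> * u)) \<partial>M") auto
  then have "\<rho> < 1" using laplace by simp
  note \<rho> = \<rho> this
  have \<theta>: "0 < \<theta>" using \<theta>'_pos \<theta>'_less by simp
  \<comment> \<open>A lower bound for \<open>(1 - \<rho>) * \<phi>\<close> on
    \<open>{t..t+1}\<close>, where \<open>\<phi>\<close> is at least
    \<open>exp (- \<theta>)\<close>; this is the drop that remains after averaging.\<close>
  define c where "c = (1 - \<rho>) * exp (- \<theta>)"
  have c: "0 < c" unfolding c_def using \<rho> by simp
  define G0 where "G0 = (\<integral>\<^sup>+s. ennreal \<bar>g s\<bar> \<partial>lborel)"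
  have G0: "G0 < \<infinity>"
    using g_int unfolding G0_def integrable_iff_bounded by simp
  have step: "ennreal c * ennreal (r (t + 1)) \<le> ennreal (exp a) * G0" for t
  proof -
    define \<phi> where "\<phi> s = min 1 (exp (- \<theta> * (s - t)))" for s
    have [measurable]: "\<phi> \<in> borel_measurable borel" unfolding \<phi>_def by measurable
    have \<phi>01: "0 \<le> \<phi> s" "\<phi> s \<le> 1" for s unfolding \<phi>_def by auto
    define I where "I = (\<integral>\<^sup>+s. ennreal (\<phi> s) * ennreal (r s) \<partial>lborel)"
    \<comment> \<open>Relative to its value at \<open>t\<close>, the product
      \<open>\<phi> s * exp (\<theta>' * s)\<close> decays at rate \<open>\<theta>'\<close> to the
      left of \<open>t\<close> and at rate \<open>\<theta> - \<theta>'\<close> to the right.\<close>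
    define \<kappa> where "\<kappa> = min \<theta>' (\<theta> - \<theta>')"
    have \<kappa>: "\<kappa> > 0" using \<theta>'_pos \<theta>'_less by (simp add: \<kappa>_def)
    have I_fin: "I < \<infinity>"
    proof -
      have "I \<le> (\<integral>\<^sup>+s. ennreal (B * exp (\<theta>' * t)) * ennreal (exp (- \<kappa> * \<bar>s - t\<bar>)) \<partial>lborel)"
        unfolding I_def
      proof (rule nn_integral_mono)
        fix s
        have "\<phi> s * r s \<le> \<phi> s * (B * exp (\<theta>' * s))"
          using \<phi>01 r_growth by (intro mult_left_mono) auto
        also have "\<dots> = B * exp (\<theta>' * t) * (\<phi> s * exp (\<theta>' * (s - t)))"
          by (simp add: exp_add[symmetric] algebra_simps)
        also have "\<dots> \<le> B * exp (\<theta>' * t) * exp (- \<kappa> * \<bar>s - t\<bar>)"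
        proof (intro mult_left_mono)
          show "\<phi> s * exp (\<theta>' * (s - t)) \<le> exp (- \<kappa> * \<bar>s - t\<bar>)"
          proof (cases "s \<ge> t")
            case True
            have "\<phi> s * exp (\<theta>' * (s - t)) \<le> exp (- \<theta> * (s - t)) * exp (\<theta>' * (s - t))"
              unfolding \<phi>_def by (intro mult_right_mono) auto
            also have "\<dots> = exp (- (\<theta> - \<theta>') * (s - t))"
                by (simp add: exp_add[symmetric] algebra_simps)
            also have "\<dots> \<le> exp (- \<kappa> * \<bar>s - t\<bar>)"
              using True mult_right_mono[of \<kappa> "\<theta> - \<theta>'" "s - t"] by (auto simp: \<kappa>_def algebra_simps)
            finally show ?thesis .
          next
            case False
            have "\<phi> s * exp (\<theta>' * (s - t)) \<le> 1 * exp (\<theta>' * (s - t))"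
              using \<phi>01 by (intro mult_right_mono) auto
            also have "\<dots> \<le> exp (- \<kappa> * \<bar>s - t\<bar>)"
              using False mult_right_mono[of \<kappa> \<theta>' "t - s"] by (auto simp: \<kappa>_def algebra_simps)
            finally show ?thesis .
          qed
        qed (use B_nonneg in simp)
        finally show "ennreal (\<phi> s) * ennreal (r s)
            \<le> ennreal (B * exp (\<theta>' * t)) * ennreal (exp (- \<kappa> * \<bar>s - t\<bar>))"
          using \<phi>01 r_nonneg B_nonneg by (simp add: ennreal_mult[symmetric] ennreal_leI)
      qed
      also have "\<dots> = ennreal (B * exp (\<theta>' * t)) * (\<integral>\<^sup>+s. ennreal (exp (- \<kappa> * \<bar>s - t\<bar>)) \<partial>lborel)"
        by (rule nn_integral_cmult) measurable
      also have "\<dots> < \<infinity>"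
        using nn_integral_exp_abs_less_top[OF \<kappa>, of t] by (simp add: ennreal_mult_less_top)
      finally show ?thesis .
    qed
    define J where "J s = (\<integral>\<^sup>+u. ennreal (\<phi> (s + u)) \<partial>M)" for s
    have [measurable]: "J \<in> borel_measurable borel" unfolding J_def by measurable
    \<comment> \<open>To the right of \<open>t\<close>, averaging a pure exponential costs the
      factor \<open>\<rho>\<close>; to the left, \<open>\<phi>\<close> has its maximal value 1,
      which no average exceeds.\<close>
    have J_le: "J s + ennreal c * indicator {t..t+1} s \<le> ennreal (\<phi> s)" for s
    proof (cases "s \<ge> t")
      case True
      have "J s \<le> (\<integral>\<^sup>+u. ennreal (exp (- \<theta> * (s - t))) * ennreal (exp (- \<theta> * u)) \<partial>M)"
        unfolding J_def
        by (intro nn_integral_mono) (auto simp: \<phi>_def ennreal_mult[symmetric] exp_add[symmetric]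
            algebra_simps intro!: ennreal_leI min.coboundedI2)
      also have "\<dots> = ennreal (exp (- \<theta> * (s - t)) * \<rho>)"
        using \<rho> by (simp add: nn_integral_cmult ennreal_mult)
      finally have J1: "J s \<le> ennreal (exp (- \<theta> * (s - t)) * \<rho>)" .
      have \<phi>s: "\<phi> s = exp (- \<theta> * (s - t))" using True \<theta> by (simp add: \<phi>_def)
      have "c * indicator {t..t+1} s \<le> exp (- \<theta> * (s - t)) * (1 - \<rho>)"
      proof (cases "s \<in> {t..t+1}")
        case True
        have "\<theta> * (s - t) \<le> \<theta>" using True \<theta> by simp
        then have "exp (- \<theta>) \<le> exp (- \<theta> * (s - t))" by simp
        then show ?thesis using True \<rho> unfolding c_def
            by (simp add: mult.commute[of "1 - \<rho>"] mult_right_mono)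
      qed (use \<rho> in simp)
      then have "ennreal (exp (- \<theta> * (s - t)) * \<rho>) + ennreal (c * indicator {t..t+1} s)
          \<le> ennreal (\<phi> s)"
        unfolding \<phi>s using \<rho>(2) c
        by (subst ennreal_plus[symmetric]) (auto simp: algebra_simps simp del: ennreal_plus intro!:
            ennreal_leI)
      moreover have "ennreal (c * indicator {t..t+1} s) = ennreal c * indicator {t..t+1} s"
        by (simp add: indicator_def)
      ultimately show ?thesis using J1 by (metis add_right_mono order_trans)
    next
      case False
      have "J s \<le> (\<integral>\<^sup>+u. 1 \<partial>M)"
        unfolding J_def using \<phi>01 by (intro nn_integral_mono) (simp add: ennreal_le_1)
      then show ?thesis using False \<theta> emeasure_space_1 by (simp add: \<phi>_def mult_nonneg_nonpos)
    qed
    define J' where "J' = (\<integral>\<^sup>+s. J s * ennreal (r s) \<partial>lborel)"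
    define A where "A = (\<integral>\<^sup>+s. ennreal (r s) * indicator {t..t+1} s \<partial>lborel)"
    interpret ps: pair_sigma_finite lborel M ..
    have Pr: "ennreal (\<integral>u. r (s - u) \<partial>M) = (\<integral>\<^sup>+u. ennreal (r (s - u)) \<partial>M)" for s
      using r_int r_nonneg by (intro nn_integral_eq_integral[symmetric]) auto
    \<comment> \<open>For \<open>g\<close> the bound \<open>\<phi> \<le> 1\<close> is enough. In the
      convolution, Fubini and translation invariance of \<open>lborel\<close> move the shift from
      \<open>r\<close> to \<open>\<phi>\<close>, which turns it into \<open>J'\<close>.\<close>
    have "I \<le> (\<integral>\<^sup>+s. ennreal \<bar>g s\<bar> + ennreal (\<phi> s) * (\<integral>\<^sup>+u. ennreal (r (s - u)) \<partial>M) \<partial>lborel)"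
      unfolding I_def
    proof (rule nn_integral_mono)
      fix s
      have nn: "0 \<le> (\<integral>u. r (s - u) \<partial>M)" using r_nonneg by simp
      have "\<phi> s * g s \<le> \<phi> s * \<bar>g s\<bar>" using \<phi>01[of s] by (intro mult_left_mono) auto
      also have "\<dots> \<le> 1 * \<bar>g s\<bar>" using \<phi>01[of s] by (intro mult_right_mono) auto
      finally have "\<phi> s * g s \<le> \<bar>g s\<bar>" by simp
      then have "\<phi> s * r s \<le> \<bar>g s\<bar> + \<phi> s * (\<integral>u. r (s - u) \<partial>M)"
        unfolding eq[of s] by (simp add: algebra_simps)
      then have "ennreal (\<phi> s) * ennreal (r s) \<le> ennreal (\<bar>g s\<bar> + \<phi> s * (\<integral>u. r (s - u) \<partial>M))"
        using \<phi>01 r_nonneg by (simp add: ennreal_mult[symmetric] ennreal_leI del: ennreal_plus)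
      also have "\<dots> = ennreal \<bar>g s\<bar> + ennreal (\<phi> s) * ennreal (\<integral>u. r (s - u) \<partial>M)"
        using \<phi>01 nn by (simp add: ennreal_mult)
      finally show "ennreal (\<phi> s) * ennreal (r s)
          \<le> ennreal \<bar>g s\<bar> + ennreal (\<phi> s) * (\<integral>\<^sup>+u. ennreal (r (s - u)) \<partial>M)"
        unfolding Pr .
    qed
    also have "\<dots> = G0 + (\<integral>\<^sup>+s. ennreal (\<phi> s) * (\<integral>\<^sup>+u. ennreal (r (s - u)) \<partial>M) \<partial>lborel)"
      unfolding G0_def by (rule nn_integral_add) measurable
    also have "(\<integral>\<^sup>+s. ennreal (\<phi> s) * (\<integral>\<^sup>+u. ennreal (r (s - u)) \<partial>M) \<partial>lborel)
        = (\<integral>\<^sup>+s. \<integral>\<^sup>+u. ennreal (\<phi> s) * ennreal (r (s - u)) \<partial>M \<partial>lborel)"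
      by (intro nn_integral_cong nn_integral_cmult[symmetric]) measurable
    also have "\<dots> = (\<integral>\<^sup>+u. \<integral>\<^sup>+s. ennreal (\<phi> s) * ennreal (r (s - u)) \<partial>lborel \<partial>M)"
      by (rule ps.Fubini'[symmetric]) measurable
    also have "\<dots> = (\<integral>\<^sup>+u. \<integral>\<^sup>+s. ennreal (\<phi> (s + u)) * ennreal (r s) \<partial>lborel \<partial>M)"
    proof (rule nn_integral_cong)
      fix u
      show "(\<integral>\<^sup>+s. ennreal (\<phi> s) * ennreal (r (s - u)) \<partial>lborel)
          = (\<integral>\<^sup>+s. ennreal (\<phi> (s + u)) * ennreal (r s) \<partial>lborel)"
        using nn_integral_real_affine[of "\<lambda>s. ennreal (\<phi> s) * ennreal (r (s - u))" 1 u]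
            by (simp add: add.commute)
    qed
    also have "\<dots> = (\<integral>\<^sup>+s. \<integral>\<^sup>+u. ennreal (\<phi> (s + u)) * ennreal (r s) \<partial>M \<partial>lborel)"
      by (rule ps.Fubini') measurable
    also have "\<dots> = J'"
      unfolding J'_def J_def by (intro nn_integral_cong nn_integral_multc) measurable
    finally have I_le: "I \<le> G0 + J'" .
    have "J' + ennreal c * A = (\<integral>\<^sup>+s. J s * ennreal (r s)
        + ennreal c * (ennreal (r s) * indicator {t..t+1} s) \<partial>lborel)"
      unfolding J'_def A_def by (subst nn_integral_cmult[symmetric], measurable, rule
          nn_integral_add[symmetric], measurable)
    also have "\<dots> = (\<integral>\<^sup>+s. (J s + ennreal c * indicator {t..t+1} s) * ennreal (r s) \<partial>lborel)"
      by (intro nn_integral_cong) (simp add: algebra_simps)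
    also have "\<dots> \<le> I"
      unfolding I_def by (intro nn_integral_mono mult_right_mono J_le) simp
    finally have lower: "J' + ennreal c * A \<le> I" .
    \<comment> \<open>Finiteness, which rests on the growth bound for \<open>r\<close>, allows
      \<open>J'\<close> to be cancelled. What is left bounds the mass of \<open>r\<close> on
      \<open>{t..t+1}\<close> by \<open>g\<close> alone, uniformly in \<open>t\<close>.\<close>
    then have "J' \<noteq> \<infinity>" using I_fin by (auto simp: top_unique)
    have "J' + ennreal c * A \<le> J' + G0"
      using order_trans[OF lower I_le] by (metis add.commute)
    with \<open>J' \<noteq> \<infinity>\<close> have cA: "ennreal c * A \<le> G0"
      by (simp only: ennreal_add_left_cancel_le simp_thms)
    \<comment> \<open>By \<open>r_decay\<close>, the value at \<open>t + 1\<close> is at most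
      \<open>exp a\<close> times every value on \<open>{t..t+1}\<close>, so the mass of the interval
      controls a point value.\<close>
    have "ennreal (r (t + 1)) = (\<integral>\<^sup>+s. ennreal (r (t + 1)) * indicator {t..t+1} s \<partial>lborel)"
      by (simp add: nn_integral_cmult)
    also have "\<dots> \<le> (\<integral>\<^sup>+s. ennreal (exp a) * (ennreal (r s) * indicator {t..t+1} s) \<partial>lborel)"
    proof (rule nn_integral_mono)
      fix s
      show "ennreal (r (t + 1)) * indicator {t..t+1} s
          \<le> ennreal (exp a) * (ennreal (r s) * indicator {t..t+1} s)"
      proof (cases "s \<in> {t..t+1}")
        case True
        have "r (t + 1) \<le> exp (a * (t + 1 - s)) * r s" using True by (intro r_decay) auto
        also have "\<dots> \<le> exp a * r s"
          using True a_nonneg r_nonneg mult_left_mono[of "t + 1 - s" 1 a]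
              by (intro mult_right_mono) auto
        finally show ?thesis using True r_nonneg by (simp add: ennreal_mult[symmetric] ennreal_leI)
      qed simp
    qed
    also have "\<dots> = ennreal (exp a) * A"
      unfolding A_def by (rule nn_integral_cmult) measurable
    finally have "ennreal (r (t + 1)) \<le> ennreal (exp a) * A" .
    then have "ennreal c * ennreal (r (t + 1)) \<le> ennreal c * (ennreal (exp a) * A)"
      by (rule mult_left_mono) simp
    also have "\<dots> = ennreal (exp a) * (ennreal c * A)" by (simp add: ac_simps)
    also have "\<dots> \<le> ennreal (exp a) * G0" by (intro mult_left_mono cA) simp
    finally show ?thesis .
  qed
  define D where "D = enn2real (ennreal (exp a) * G0)"
  have "ennreal (exp a) * G0 < \<infinity>" using G0 by (simp add: ennreal_mult_less_top)
  then have D: "ennreal (exp a) * G0 = ennreal D" unfolding D_def by (simp add: less_top)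
  have "r t \<le> D / c" for t
  proof -
    have "ennreal (c * r t) \<le> ennreal D"
      using step[of "t - 1"] D c r_nonneg by (simp add: ennreal_mult)
    then have "c * r t \<le> D" by (subst (asm) ennreal_le_iff) (simp add: D_def)
    then show ?thesis using c by (simp add: field_simps)
  qed
  then show ?thesis by blast
qed

text \<open>Once \<open>r\<close> is bounded this antiderivative is Lipschitz, so its increments
  over windows have the continuity that \<open>r\<close> may lack.\<close>

definition F :: "real \<Rightarrow> real" where
  "F t = (LINT s:{..t}|lborel. r s)"

lemma r_set_integrable: "set_integrable lborel {..t} r"
proof -
  have int: "integrable lborel (\<lambda>s. B * exp (\<theta>' * t) * exp (- \<theta>' * \<bar>s - t\<bar>))"
    using nn_integral_exp_abs_less_top[OF \<theta>'_pos, of t]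
    by (intro integrable_mult_right) (simp add: integrable_iff_bounded)
  show ?thesis
    unfolding set_integrable_def
  proof (rule Bochner_Integration.integrable_bound[OF int])
    have "norm (indicator {..t} s *\<^sub>R r s) \<le> norm (B * exp (\<theta>' * t) * exp (- \<theta>' * \<bar>s - t\<bar>))" for s
    proof (cases "s \<le> t")
      case True
      have "r s \<le> B * exp (\<theta>' * s)" by (rule r_growth)
      also have "\<dots> = B * exp (\<theta>' * t) * exp (- \<theta>' * \<bar>s - t\<bar>)"
        using True by (simp add: exp_add[symmetric] algebra_simps)
      finally show ?thesis using True r_nonneg[of s] B_nonneg by simp
    qed simp
    then show "AE s in lborel. norm (indicator {..t} s *\<^sub>R r s)
        \<le> norm (B * exp (\<theta>' * t) * exp (- \<theta>' * \<bar>s - t\<bar>))"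
      by simp
  qed measurable
qed

lemma F_diff:
  assumes "x \<le> y"
  shows "F y - F x = (LINT s:{x<..y}|lborel. r s)"
proof -
  have "{..y} = {..x} \<union> {x<..y}" using assms by auto
  moreover have "set_integrable lborel {x<..y} r"
    by (rule set_integrable_subset[OF r_set_integrable[of y]]) auto
  ultimately have "F y = F x + (LINT s:{x<..y}|lborel. r s)"
    unfolding F_def by (simp only:) (rule set_integral_Un, use r_set_integrable in auto)
  then show ?thesis by simp
qed

lemma F_diff_bounds:
  assumes "x \<le> y" and "\<And>s. x < s \<Longrightarrow> s \<le> y \<Longrightarrow> l \<le> r s" and "\<And>s. x < s \<Longrightarrow> s \<le> y \<Longrightarrow> r s \<le> c"
  shows "l * (y - x) \<le> F y - F x" and "F y - F x \<le> c * (y - x)"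
proof -
  have int: "set_integrable lborel {x<..y} r"
    by (rule set_integrable_subset[OF r_set_integrable[of y]]) auto
  have const: "(LINT s:{x<..y}|lborel. k)
      = k * (y - x)" "set_integrable lborel {x<..y} (\<lambda>_. k)" for k :: real
    using assms(1) by (simp_all add: set_lebesgue_integral_def set_integrable_def)
  have "(LINT s:{x<..y}|lborel. l) \<le> (LINT s:{x<..y}|lborel. r s)"
    using assms(2) by (intro set_integral_mono const int) auto
  then show "l * (y - x) \<le> F y - F x" unfolding const F_diff[OF assms(1)] .
  have "(LINT s:{x<..y}|lborel. r s) \<le> (LINT s:{x<..y}|lborel. c)"
    using assms(3) by (intro set_integral_mono const int) auto
  then show "F y - F x \<le> c * (y - x)" unfolding const F_diff[OF assms(1)] .
qed

lemma F_lipschitz: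
  assumes "\<And>t. r t \<le> c"
  shows "\<bar>F x - F y\<bar> \<le> c * \<bar>x - y\<bar>"
  using F_diff_bounds[of x y 0 c] F_diff_bounds[of y x 0 c] assms r_nonneg
  by (cases "x \<le> y") auto

lemma F_meas [measurable]: "F \<in> borel_measurable borel"
proof -
  obtain c where c: "\<And>t. r t \<le> c" using r_bounded by blast
  have "c-lipschitz_on UNIV F"
    using F_lipschitz[OF c] order_trans[OF r_nonneg c]
        by (intro lipschitz_onI) (auto simp: dist_real_def)
  then have "continuous_on UNIV F" by (rule lipschitz_on_continuous_on)
  then show ?thesis by (rule borel_measurable_continuous_onI)
qed

text \<open>Boundedness of \<open>r\<close> limits \<open>F\<close> to linear growth, so a finite
  mean of the step is enough.\<close>

lemma integrable_shifted_F: "integrable M (\<lambda>u. F (t - u))"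
proof -
  obtain c where c: "\<And>t. r t \<le> c" using r_bounded by blast
  have c0: "0 \<le> c" using order_trans[OF r_nonneg c] .
  have "integrable M (\<lambda>u. \<bar>F t\<bar> + c * \<bar>u\<bar>)"
    using mean_int by auto
  then show ?thesis
  proof (rule Bochner_Integration.integrable_bound)
    have "norm (F (t - u)) \<le> norm (\<bar>F t\<bar> + c * \<bar>u\<bar>)" for u
      using F_lipschitz[OF c, of "t - u" t] c0 by (auto simp: abs_if split: if_splits)
    then show "AE u in M. norm (F (t - u)) \<le> norm (\<bar>F t\<bar> + c * \<bar>u\<bar>)" by simp
  qed measurable
qed

lemma F_renewal: "F t - (\<integral>u. F (t - u) \<partial>M) = (LINT s:{..t}|lborel. g s)"
proof -
  interpret ps: pair_sigma_finite lborel M ..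
  define f where "f s u = indicator {..t} s * r (s - u)" for s u :: real
  have Pr: "(\<integral>u. f s u \<partial>M) = indicator {..t} s * r s - indicator {..t} s * g s" for s
    unfolding f_def using eq[of s] by (simp add: algebra_simps)
  have i1: "integrable lborel (\<lambda>s. indicator {..t} s * r s)"
    using r_set_integrable[of t] by (simp add: set_integrable_def)
  have i2: "integrable lborel (\<lambda>s. indicator {..t} s * g s)"
    using integrable_mult_indicator[OF _ g_int, of "{..t}"] by simp
  \<comment> \<open>The function \<open>f\<close> is nonnegative, and by the equation its integral
    over \<open>u\<close> is \<open>r - g\<close> cut off at \<open>t\<close>; absolute
    integrability thus reduces to that of \<open>r\<close> and \<open>g\<close> on
    \<open>{..t}\<close>.\<close>
  have "integrable (lborel \<Otimes>\<^sub>M M) (\<lambda>(s, u). f s u)"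
  proof (rule ps.Fubini_integrable)
    show "(\<lambda>(s, u). f s u) \<in> borel_measurable (lborel \<Otimes>\<^sub>M M)"
      unfolding f_def by measurable
    have "(\<lambda>s. \<integral>u. norm (case (s, u) of (s, u) \<Rightarrow> f s u) \<partial>M) = (\<lambda>s. \<integral>u. f s u \<partial>M)"
      using r_nonneg by (intro ext Bochner_Integration.integral_cong) (auto simp: f_def)
    then show "integrable lborel (\<lambda>s. \<integral>u. norm (case (s, u) of (s, u) \<Rightarrow> f s u) \<partial>M)"
      using i1 i2 by (simp add: Pr)
    show "AE s in lborel. integrable M (\<lambda>u. case (s, u) of (s, u) \<Rightarrow> f s u)"
      using r_int by (auto simp: f_def)
  qed
  then have "(\<integral>u. \<integral>s. f s u \<partial>lborel \<partial>M) = (\<integral>s. \<integral>u. f s u \<partial>M \<partial>lborel)"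
    by (rule ps.Fubini_integral)
  moreover have "(\<integral>s. f s u \<partial>lborel) = F (t - u)" for u
    unfolding f_def F_def set_lebesgue_integral_def
    by (subst lborel_integral_real_affine[where t = u and c = 1])
       (auto simp: indicator_def algebra_simps intro!: Bochner_Integration.integral_cong)
  moreover have "(\<integral>s. \<integral>u. f s u \<partial>M \<partial>lborel) = F t - (LINT s:{..t}|lborel. g s)"
    using i1 i2 by (simp add: Pr F_def set_lebesgue_integral_def)
  ultimately show ?thesis by simp
qed

lemma integral_g_at_top: "((\<lambda>t. LINT s:{..t}|lborel. g s) \<longlongrightarrow> integral\<^sup>L lborel g) at_top"
  unfolding set_lebesgue_integral_def by (rule tendsto_integral_at_top[OF _ g_int]) simp

text \<open>Windows of length \<open>\<delta>\<close> are bounded and Lipschitz. By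
  \<open>F_renewal\<close> their defect from harmonicity is the integral of \<open>g\<close> from
  \<open>x\<close> to \<open>x + \<delta>\<close>, which vanishes at infinity because
  \<open>g\<close> is integrable.\<close>

lemma window_translation_invariant:
  assumes nonarith: "\<And>d. d > 0 \<Longrightarrow> emeasure M (- {d * of_int k | k. True}) \<noteq> 0" and \<delta>: "0 < \<delta>"
  shows "((\<lambda>x. (F (x - y + \<delta>) - F (x - y)) - (F (x + \<delta>) - F x)) \<longlongrightarrow> 0) at_top"
proof -
  obtain c where c: "\<And>t. r t \<le> c" using r_bounded by blast
  have c0: "0 \<le> c" using order_trans[OF r_nonneg c] .
  define f where "f x = F (x + \<delta>) - F x" for x
  have "((\<lambda>x. f (x - y) - f x) \<longlongrightarrow> 0) at_top"
  proof (rule lipschitz_asymptotically_translation_invariant[of f "2 * c" "c * \<delta>"])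
    show "\<bar>f x - f y\<bar> \<le> 2 * c * \<bar>x - y\<bar>" for x y
      using F_lipschitz[OF c, of "x + \<delta>" "y + \<delta>"] F_lipschitz[OF c, of x y] unfolding f_def by simp
    show "\<bar>f x\<bar> \<le> c * \<delta>" for x
      using F_lipschitz[OF c, of "x + \<delta>" x] \<delta> unfolding f_def by simp
    show "f \<in> borel_measurable borel" unfolding f_def by measurable
    have "f x - (\<integral>u. f (x - u) \<partial>M) = (LINT s:{..x+\<delta>}|lborel. g s) - (LINT s:{..x}|lborel. g s)" for
        x
      using integrable_shifted_F[of "x + \<delta>"] integrable_shifted_F[of x]
      unfolding F_renewal[symmetric] f_def by (simp add: algebra_simps)
    moreover have "((\<lambda>x. (LINT s:{..x+\<delta>}|lborel. g s) - (LINT s:{..x}|lborel. g s)) \<longlongrightarrow> integral\<^sup>L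
        lborel g - integral\<^sup>L lborel g) at_top"
      using filterlim_tendsto_add_at_top[OF tendsto_const[of \<delta>] filterlim_ident]
      by (intro tendsto_diff integral_g_at_top filterlim_compose[OF integral_g_at_top]) (simp add:
          add.commute)
    ultimately show "((\<lambda>x. f x - (\<integral>u. f (x - u) \<partial>M)) \<longlongrightarrow> 0) at_top" by simp
  qed (use nonarith in auto)
  then show ?thesis unfolding f_def .
qed

text \<open>By \<open>r_decay\<close>, \<open>r x * \<delta>\<close> agrees with the windows on
  either side of \<open>x\<close> up to a factor \<open>exp (a * \<delta>)\<close>. As
  \<open>r\<close> is bounded, this loss is uniformly small for small \<open>\<delta>\<close>, so
  invariance passes from the windows to \<open>r\<close> itself.\<close>

lemma r_asymptotically_translation_invariant:
  assumes nonarith: "\<And>d. d > 0 \<Longrightarrow> emeasure M (- {d * of_int k | k. True}) \<noteq> 0"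
  shows "((\<lambda>x. r (x - y) - r x) \<longlongrightarrow> 0) at_top"
proof -
  obtain c where c: "\<And>t. r t \<le> c" using r_bounded by blast
  have shift: "filterlim (\<lambda>x::real. x - c) at_top at_top" for c
    using filterlim_tendsto_add_at_top[OF tendsto_const[of "- c"] filterlim_ident] by simp
  have upper: "\<forall>\<^sub>F x in at_top. r (x - y) - r x < \<epsilon>" if \<epsilon>: "\<epsilon> > 0" for \<epsilon> y
  proof -
    \<comment> \<open>Two comparisons are made, one with the window above \<open>x\<close> and one
      with the window below \<open>x - y\<close>; each costs a factor
      \<open>exp (a * \<delta>)\<close>.\<close>
    have "((\<lambda>\<delta>. (exp (2 * (a * \<delta>)) - 1) * c) \<longlongrightarrow> (exp (2 * (a * 0)) - 1) * c) (at_right 0)"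
      by (intro tendsto_intros)
    then have "\<forall>\<^sub>F \<delta> in at_right 0. (exp (2 * (a * \<delta>)) - 1) * c < \<epsilon> / 2"
      using \<epsilon> by (intro order_tendstoD(2)) auto
    then have "\<forall>\<^sub>F \<delta> in at_right 0. (exp (2 * (a * \<delta>)) - 1) * c < \<epsilon> / 2 \<and> 0 < \<delta>"
      using eventually_at_right_less by (rule eventually_conj)
    then obtain \<delta> where \<delta>: "(exp (2 * (a * \<delta>)) - 1) * c < \<epsilon> / 2" "0 < \<delta>"
      using eventually_happens'[OF trivial_limit_at_right_real] by blast
    define h where "h x = F (x + \<delta>) - F x" for x
    have h_le: "h x \<le> exp (a * \<delta>) * r x * \<delta>" for x
    proof -
      have "r s \<le> exp (a * \<delta>) * r x" if "x < s" "s \<le> x + \<delta>" for s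
      proof -
        have "r s \<le> exp (a * (s - x)) * r x" using that by (intro r_decay) auto
        also have "\<dots> \<le> exp (a * \<delta>) * r x"
          using that a_nonneg r_nonneg by (intro mult_right_mono) (auto intro: mult_left_mono)
        finally show ?thesis .
      qed
      then show ?thesis
        unfolding h_def using F_diff_bounds(2)[of x "x + \<delta>" 0 "exp (a * \<delta>) * r x"] \<delta> r_nonneg
            by simp
    qed
    have h_ge: "r x * \<delta> \<le> exp (a * \<delta>) * h (x - \<delta>)" for x
    proof -
      have "exp (- (a * \<delta>)) * r x \<le> r s" if "x - \<delta> < s" "s \<le> x" for s
      proof -
        have "r x \<le> exp (a * (x - s)) * r s" using that by (intro r_decay) auto
        also have "\<dots> \<le> exp (a * \<delta>) * r s"
          using that a_nonneg r_nonneg by (intro mult_right_mono) (auto intro: mult_left_mono)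
        finally show ?thesis by (simp add: exp_minus field_simps)
      qed
      then have "exp (- (a * \<delta>)) * r x * \<delta> \<le> h (x - \<delta>)"
        unfolding h_def using F_diff_bounds(1)[of "x - \<delta>" x "exp (- (a * \<delta>)) * r x" c] \<delta> c by simp
      then show ?thesis by (simp add: exp_minus field_simps)
    qed
    have "((\<lambda>x. exp (a * \<delta>) * (h (x - (y + \<delta>)) - h x)) \<longlongrightarrow> exp (a * \<delta>) * 0) at_top"
      unfolding h_def by (intro tendsto_mult_left window_translation_invariant nonarith \<delta>)
    then have "\<forall>\<^sub>F x in at_top. exp (a * \<delta>) * (h (x - (y + \<delta>)) - h x) < \<epsilon> / 2 * \<delta>"
      using \<epsilon> \<delta> by (intro order_tendstoD(2)) auto
    then show ?thesis
    proof eventually_elim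
      case (elim x)
      have "(r (x - y) - r x) * \<delta> \<le> exp (a * \<delta>) * h (x - y - \<delta>) - r x * \<delta>"
        using h_ge[of "x - y"] by (simp add: algebra_simps)
      also have "\<dots> = exp (a * \<delta>) * (h (x - (y + \<delta>)) - h x) + exp (a * \<delta>) * h x - r x * \<delta>"
        by (simp add: algebra_simps)
      also have "\<dots> < \<epsilon> / 2 * \<delta> + exp (a * \<delta>) * (exp (a * \<delta>) * r x * \<delta>) - r x * \<delta>"
        using elim mult_left_mono[OF h_le[of x] exp_ge_zero[of "a * \<delta>"]]
        unfolding right_diff_distrib by linarith
      also have "\<dots> = (\<epsilon> / 2 + (exp (2 * (a * \<delta>)) - 1) * r x) * \<delta>"
        by (simp add: algebra_simps flip: exp_add)
      also have "\<dots> \<le> (\<epsilon> / 2 + (exp (2 * (a * \<delta>)) - 1) * c) * \<delta>"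
        using \<delta>(2) a_nonneg c by (intro mult_right_mono add_left_mono mult_left_mono) auto
      also have "\<dots> < \<epsilon> * \<delta>" using \<delta> by simp
      finally show ?case using \<delta>(2) by simp
    qed
  qed
  show ?thesis
  proof (rule tendstoI)
    \<comment> \<open>The lower bound is the upper bound for the shift \<open>- y\<close>, read at
      the point \<open>x - y\<close>.\<close>
    fix \<epsilon> :: real assume \<epsilon>: "\<epsilon> > 0"
    have "\<forall>\<^sub>F x in at_top. r ((x - y) - (- y)) - r (x - y) < \<epsilon>"
      using eventually_compose_filterlim[OF upper[OF \<epsilon>, of "- y"] shift[of y]] .
    with upper[OF \<epsilon>, of y] show "\<forall>\<^sub>F x in at_top. dist (r (x - y) - r x) 0 < \<epsilon>"
      by eventually_elim (auto simp: dist_real_def)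
  qed
qed

text \<open>
  Integrating the equation over \<open>{..t}\<close> gives \<open>E (F t - F (t - X)) = \<integral>\<^sub>-\<^sub>\<infinity>\<^sup>t g\<close>. Since
  \<open>r (t - s) - r t\<close> tends to \<open>0\<close> for every \<open>s\<close>, the left-hand side is \<open>E X \<cdot> r t + o(1)\<close>.
\<close>

theorem renewal_limit:
  assumes nonarith: "\<And>d. d > 0 \<Longrightarrow> emeasure M (- {d * of_int k | k. True}) \<noteq> 0"
    and mean_pos: "0 < (\<integral>u. u \<partial>M)"
  shows "(r \<longlongrightarrow> integral\<^sup>L lborel g / (\<integral>u. u \<partial>M)) at_top"
proof -
  obtain c where c: "\<And>t. r t \<le> c" using r_bounded by blast
  have c0: "0 \<le> c" using order_trans[OF r_nonneg c] .
  define m where "m = (\<integral>u. u \<partial>M)"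
  define D where "D t u = F t - F (t - u) - u * r t" for t u
  note inv = r_asymptotically_translation_invariant[OF nonarith]
  \<comment> \<open>\<open>D t u\<close> is the error made when the integral of \<open>r\<close>
    over the stretch of length \<open>u\<close> below \<open>t\<close> is replaced by
    \<open>u * r t\<close>. Pointwise convergence of the increments suffices, since they are bounded
    by \<open>c\<close>.\<close>
  have D_pos: "((\<lambda>t. D t u) \<longlongrightarrow> 0) at_top" if u: "0 \<le> u" for u
  proof -
    have "D t u = (\<integral>s. indicator {0..<u} s * (r (t - s) - r t) \<partial>lborel)" for t
    proof -
      have "F t - F (t - u) = (\<integral>s. indicator {t-u<..t} s * r s \<partial>lborel)"
        using F_diff[of "t - u" t] u by (simp add: set_lebesgue_integral_def)
      also have "\<dots> = (\<integral>s. indicator {0..<u} s * r (t - s) \<partial>lborel)"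
        by (subst lborel_integral_real_affine[where t = t and c = "-1"])
           (auto simp: indicator_def intro!: Bochner_Integration.integral_cong)
      finally have 1: "F t - F (t - u) = (\<integral>s. indicator {0..<u} s * r (t - s) \<partial>lborel)" .
      have 2: "(\<integral>s. indicator {0..<u} s * r t \<partial>lborel) = u * r t"
        using u by simp
      have "integrable lborel (\<lambda>s. indicator {0..<u} s * c)" using u by simp
      then have "integrable lborel (\<lambda>s. indicator {0..<u} s * r (t - s))"
        by (rule Bochner_Integration.integrable_bound) (use c r_nonneg c0 in \<open>auto simp:
            indicator_def\<close>)
      moreover have "integrable lborel (\<lambda>s. indicator {0..<u} s * r t)" using u by simp
      ultimately show ?thesis
        unfolding D_def 1 2[symmetric] by (simp add: right_diff_distrib)
    qed
    moreover have "((\<lambda>t. \<integral>s. indicator {0..<u} s * (r (t - s) - r t) \<partial>lborel) \<longlongrightarrow>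
        (\<integral>s. 0 \<partial>(lborel :: real measure))) at_top"
    proof (rule integral_dominated_convergence_at_top[where w = "\<lambda>s. indicator {0..<u} s * c"])
      show "integrable lborel (\<lambda>s. indicator {0..<u} s * c)" using u by simp
      show "AE s in lborel. ((\<lambda>t. indicator {0..<u} s * (r (t - s) - r t)) \<longlongrightarrow> 0) at_top"
        using inv by (auto intro!: tendsto_mult_right_zero)
      have "\<bar>r (t - s) - r t\<bar> \<le> c" for t s
        using c[of "t - s"] c[of t] r_nonneg[of t] r_nonneg[of "t - s"] by simp
      then show "\<forall>\<^sub>F t in at_top. AE s in lborel. norm (indicator {0..<u} s * (r (t - s) - r t))
          \<le> indicator {0..<u} s * c"
        by (auto simp: indicator_def)
    qed measurable
    ultimately show ?thesis by simp
  qed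
  have D_lim: "((\<lambda>t. D t u) \<longlongrightarrow> 0) at_top" for u
  proof (cases "0 \<le> u")
    case False
    have shift: "filterlim (\<lambda>x::real. x - u) at_top at_top"
      using filterlim_tendsto_add_at_top[OF tendsto_const[of "- u"] filterlim_ident] by simp
    \<comment> \<open>For negative \<open>u\<close> the stretch lies above \<open>t\<close>; it is
      viewed from its right end \<open>t - u\<close>, and \<open>r (t - u)\<close> is then exchanged
      for \<open>r t\<close>.\<close>
    have "((\<lambda>t. - D (t - u) (- u) + u * (r (t - u) - r t)) \<longlongrightarrow> - 0 + u * 0) at_top"
      using False by (intro tendsto_add tendsto_minus tendsto_mult_left inv filterlim_compose[OF
          D_pos shift]) auto
    moreover have "- D (t - u) (- u) + u * (r (t - u) - r t) = D t u" for t
      unfolding D_def by (simp add: algebra_simps)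
    ultimately show ?thesis by simp
  qed (rule D_pos)
  have "((\<lambda>t. \<integral>u. D t u \<partial>M) \<longlongrightarrow> (\<integral>u. 0 \<partial>M)) at_top"
  proof (rule integral_dominated_convergence_at_top[where w = "\<lambda>u. 2 * c * \<bar>u\<bar>"])
    have "\<bar>D t u\<bar> \<le> 2 * c * \<bar>u\<bar>" for t u
    proof -
      have "\<bar>u * r t\<bar> \<le> \<bar>u\<bar> * c"
        using c r_nonneg[of t] by (auto simp: abs_mult intro!: mult_left_mono)
      moreover have "\<bar>F t - F (t - u)\<bar> \<le> \<bar>u\<bar> * c"
        using F_lipschitz[OF c, of t "t - u"] by (simp add: mult.commute)
      ultimately have "\<bar>D t u\<bar> \<le> \<bar>u\<bar> * c + \<bar>u\<bar> * c" unfolding D_def by linarith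
      then show ?thesis by (simp add: mult_ac)
    qed
    then show "\<forall>\<^sub>F t in at_top. AE u in M. norm (D t u) \<le> 2 * c * \<bar>u\<bar>" by simp
    show "AE u in M. ((\<lambda>t. D t u) \<longlongrightarrow> 0) at_top" using D_lim by simp
    show "(\<lambda>u. D t u) \<in> borel_measurable M" for t unfolding D_def by measurable
  qed (use mean_int in auto)
  moreover have "(\<integral>u. D t u \<partial>M) = (LINT s:{..t}|lborel. g s) - m * r t" for t
    unfolding D_def F_renewal[symmetric] m_def
    using integrable_shifted_F[of t] mean_int prob_space by simp
  ultimately have "((\<lambda>t. (LINT s:{..t}|lborel. g s) - m * r t) \<longlongrightarrow> 0) at_top" by simp
  from tendsto_diff[OF integral_g_at_top this]
  have "((\<lambda>t. m * r t / m) \<longlongrightarrow> (integral\<^sup>L lborel g - 0) / m) at_top"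
    using mean_pos by (intro tendsto_divide) (auto simp: m_def)
  then show ?thesis using mean_pos by (simp add: m_def)
qed

end

section \<open>The weighted branching tree\<close>

lemma infsum_ennreal_eq_suminf:
  fixes f :: "nat \<Rightarrow> ennreal"
  shows "(\<Sum>\<^sub>\<infinity>i\<in>A. f i) = (\<Sum>i. if i \<in> A then f i else 0)"
proof -
  define g where "g i = (if i \<in> A then f i else 0)" for i
  have "infsum f A = infsum g UNIV"
    by (rule infsum_cong_neutral) (auto simp: g_def)
  also have "\<dots> = (SUP F\<in>{F. finite F \<and> F \<subseteq> UNIV}. sum g F)"
    by (rule nonneg_infsum_complete) simp
  also have "\<dots> = (SUP n. sum g {..<n})"
  proof (rule antisym)
    show "(SUP F\<in>{F. finite F \<and> F \<subseteq> UNIV}. sum g F) \<le> (SUP n. sum g {..<n})"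
    proof (rule SUP_least)
      fix F :: "nat set" assume "F \<in> {F. finite F \<and> F \<subseteq> UNIV}"
      then have F: "finite F" by simp
      then obtain n where "F \<subseteq> {..<n}" using finite_nat_iff_bounded by blast
      then have "sum g F \<le> sum g {..<n}" by (intro sum_mono2) auto
      then show "sum g F \<le> (SUP n. sum g {..<n})" by (rule order_trans) (rule SUP_upper, simp)
    qed
    show "(SUP n. sum g {..<n}) \<le> (SUP F\<in>{F. finite F \<and> F \<subseteq> UNIV}. sum g F)"
      by (rule SUP_least) (rule SUP_upper, simp)
  qed
  also have "\<dots> = suminf g" by (rule suminf_eq_SUP[symmetric])
  finally show ?thesis by (simp add: g_def[abs_def])
qed

lemma nn_integral_count_space_countable:
  fixes g :: "'a::countable \<Rightarrow> ennreal"
  shows "(\<integral>\<^sup>+i. g i \<partial>count_space UNIV)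
      = (\<Sum>n. if n \<in> range (to_nat :: 'a \<Rightarrow> nat) then g (from_nat n) else 0)"
proof -
  have "(\<integral>\<^sup>+i. g (from_nat (to_nat (i :: 'a))) \<partial>count_space UNIV)
      = (\<integral>\<^sup>+n. g (from_nat n) \<partial>count_space (range (to_nat :: 'a \<Rightarrow> nat)))"
    by (rule nn_integral_bij_count_space) (simp add: bij_betw_def)
  also have "\<dots> = (\<integral>\<^sup>+n. (if n \<in> range (to_nat :: 'a \<Rightarrow> nat) then g (from_nat n)
      else 0) \<partial>count_space UNIV)"
    by (subst nn_integral_count_space_indicator) (auto intro!: nn_integral_cong)
  also have "\<dots> = (\<Sum>n. if n \<in> range (to_nat :: 'a \<Rightarrow> nat) then g (from_nat n) else 0)"
    by (rule nn_integral_count_space_nat)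
  finally show ?thesis by simp
qed

text \<open>With the index set moved into the integrand, measurability and Tonelli become available
  for sums over a random set of nodes.\<close>

lemma infsum_ennreal_eq_nn_integral:
  fixes f :: "'a::countable \<Rightarrow> ennreal"
  shows "(\<Sum>\<^sub>\<infinity>i\<in>A. f i) = (\<integral>\<^sup>+i. (if i \<in> A then f i else 0) \<partial>count_space UNIV)"
proof -
  have "infsum f A = infsum (\<lambda>n. f (from_nat n)) (to_nat ` A)"
    by (subst infsum_reindex) (auto simp: o_def)
  also have "\<dots> = (\<Sum>n. if n \<in> to_nat ` A then f (from_nat n) else 0)"
    by (rule infsum_ennreal_eq_suminf)
  also have "\<dots> = (\<Sum>n. if n \<in> range (to_nat :: 'a \<Rightarrow> nat) then
      (if from_nat n \<in> A then f (from_nat n) else 0) else 0)"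
    by (intro arg_cong[where f = suminf] ext) force
  finally show ?thesis by (simp add: nn_integral_count_space_countable)
qed

lemma borel_measurable_nn_integral_count_space:
  fixes f :: "'w \<Rightarrow> 'a::countable \<Rightarrow> ennreal"
  assumes "\<And>i. (\<lambda>\<omega>. f \<omega> i) \<in> borel_measurable M"
  shows "(\<lambda>\<omega>. \<integral>\<^sup>+i. f \<omega> i \<partial>count_space UNIV) \<in> borel_measurable M"
proof -
  note assms[measurable]
  have "(\<lambda>\<omega>. if n \<in> range (to_nat :: 'a \<Rightarrow> nat) then f \<omega> (from_nat n)
      else 0) \<in> borel_measurable M" for n
    by (cases "n \<in> range (to_nat :: 'a \<Rightarrow> nat)") auto
  then show ?thesis
    unfolding nn_integral_count_space_countable by (rule borel_measurable_suminf_order)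
qed

lemma sum_upto_eq_suminf:
  fixes f :: "nat \<Rightarrow> ennreal"
  shows "sum_upto n f = (\<Sum>i. if 1 \<le> i \<and> enat i \<le> n then f i else 0)"
  unfolding sum_upto_def by (subst infsum_ennreal_eq_suminf) simp

lemma sum_upto_cong:
  "(\<And>i. 1 \<le> i \<Longrightarrow> enat i \<le> n \<Longrightarrow> f i = g i) \<Longrightarrow> sum_upto n f = sum_upto n g"
  unfolding sum_upto_def by (rule infsum_cong) auto

lemma borel_measurable_sum_upto:
  fixes f :: "'w \<Rightarrow> nat \<Rightarrow> ennreal"
  assumes [measurable]: "n \<in> measurable M (count_space UNIV)"
    and "\<And>i. 1 \<le> i \<Longrightarrow> (\<lambda>\<omega>. f \<omega> i) \<in> borel_measurable M"
  shows "(\<lambda>\<omega>. sum_upto (n \<omega>) (f \<omega>)) \<in> borel_measurable M"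
  unfolding sum_upto_eq_suminf
proof (intro borel_measurable_suminf_order)
  fix i
  show "(\<lambda>\<omega>. if 1 \<le> i \<and> enat i \<le> n \<omega> then f \<omega> i else 0) \<in> borel_measurable M"
  proof (cases "1 \<le> i")
    case True
    note assms(2)[OF True, measurable]
    show ?thesis by measurable
  next
    case False
    then show ?thesis by simp
  qed
qed

section \<open>Decomposition of the tree at its first generation\<close>

lemma snoc_in_generation_iff:
  "i @ [j] \<in> generation N (Suc n) \<omega> \<longleftrightarrow> i \<in> generation N n \<omega> \<and> 1 \<le> j \<and> enat j \<le> N i \<omega>"
  by auto

lemma Nil_in_generation_iff: "[] \<in> generation N n \<omega> \<longleftrightarrow> n = 0"
  by (cases n) auto

lemma generation_subset_nodes: "i \<in> generation N n \<omega> \<Longrightarrow> i \<in> nodes"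
  by (induction n arbitrary: i) (auto simp: nodes_def)

text \<open>Generations grow by appending at the end of a word, whereas the distributional equation
  splits off the first letter; induction from the right reconciles the two.\<close>

lemma Cons_in_generation_iff:
  "j # i \<in> generation N (Suc n) \<omega> \<longleftrightarrow>
     1 \<le> j \<and> enat j \<le> N [] \<omega> \<and> i \<in> generation (\<lambda>i. N (j # i)) n \<omega>"
proof (induction i arbitrary: n rule: rev_induct)
  case Nil
  have "[j] \<in> generation N (Suc n) \<omega> \<longleftrightarrow> [] @ [j] \<in> generation N (Suc n) \<omega>" by simp
  also have "\<dots> \<longleftrightarrow> n = 0 \<and> 1 \<le> j \<and> enat j \<le> N [] \<omega>"
    by (simp only: snoc_in_generation_iff Nil_in_generation_iff)
  finally show ?case by (auto simp: Nil_in_generation_iff)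
next
  case (snoc k i)
  have *: "j # i @ [k] \<in> generation N (Suc n) \<omega> \<longleftrightarrow> j # i \<in> generation N n \<omega> \<and> 1 \<le> k \<and> enat k
      \<le> N (j # i) \<omega>"
    using snoc_in_generation_iff[of "j # i" k] by simp
  show ?case
  proof (cases n)
    case 0
    then show ?thesis unfolding * by simp
  next
    case (Suc n')
    show ?thesis unfolding * unfolding Suc snoc.IH snoc_in_generation_iff by auto
  qed
qed

lemma path_weight_Cons: "path_weight C (j # i) \<omega> = C [j] \<omega> * path_weight (\<lambda>i. C (j # i)) i \<omega>"
proof (induction i rule: rev_induct)
  case Nil
  show ?case using path_weight_snoc[of C "[]" j \<omega>] by simp
next
  case (snoc k i)
  show ?case using path_weight_snoc[of C "j # i" k \<omega>] snoc by simp
qed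

lemma tree_W_eq:
  "tree_W Q N C n \<omega> = (\<integral>\<^sup>+i. (if i \<in> generation N n \<omega> then ennreal (Q i \<omega> * path_weight C i \<omega>)
      else 0) \<partial>count_space UNIV)"
  unfolding tree_W_def by (rule infsum_ennreal_eq_nn_integral)

lemma tree_W_0: "tree_W Q N C 0 \<omega> = ennreal (Q [] \<omega>)"
  by (simp add: tree_W_def)

text \<open>A word of generation \<open>n + 1\<close> is a child \<open>j\<close> of the root
  followed by a word of generation \<open>n\<close> in the tree of \<open>j\<close>, and its weight
  factors accordingly. Tonelli for counting measures groups the words by \<open>j\<close>.\<close>

lemma tree_W_Suc:
  assumes "\<And>j. 1 \<le> j \<Longrightarrow> 0 \<le> C [j] \<omega>"
  shows "tree_W Q N C (Suc n) \<omega> =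
    sum_upto (N [] \<omega>) (\<lambda>j. ennreal (C [j] \<omega>) * tree_W (\<lambda>i. Q (j # i)) (\<lambda>i. N (j # i))
        (\<lambda>i. C (j # i)) n \<omega>)"
proof -
  define F where "F l = (if l \<in> generation N (Suc n) \<omega> then ennreal (Q l \<omega> * path_weight C l \<omega>)
      else 0)" for l
  have "tree_W Q N C (Suc n) \<omega> = (\<integral>\<^sup>+l. F l \<partial>count_space UNIV)"
    unfolding tree_W_eq F_def ..
  also have "\<dots> = (\<integral>\<^sup>+l. F l \<partial>count_space {l. l \<noteq> []})"
    by (rule nn_integral_count_space_eq) (auto simp: F_def Nil_in_generation_iff simp del:
        generation.simps)
  also have "\<dots> = (\<integral>\<^sup>+x. F (case x of (j, i) \<Rightarrow> j # i) \<partial>count_space UNIV)"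
  proof (rule nn_integral_bij_count_space[symmetric])
    show "bij_betw (\<lambda>x. case x of (j, i) \<Rightarrow> j # i) UNIV {l::nat list. l \<noteq> []}"
      by (rule bij_betwI[where g = "\<lambda>l. (hd l, tl l)"]) auto
  qed
  also have "\<dots> = (\<integral>\<^sup>+j. \<integral>\<^sup>+i. F (j # i) \<partial>count_space UNIV \<partial>count_space UNIV)"
    by (subst nn_integral_fst_count_space[symmetric]) simp
  also have "\<dots> = (\<Sum>j. \<integral>\<^sup>+i. F (j # i) \<partial>count_space UNIV)"
    by (rule nn_integral_count_space_nat)
  also have "\<dots> = (\<Sum>j. if 1 \<le> j \<and> enat j \<le> N [] \<omega> then
      ennreal (C [j] \<omega>) * tree_W (\<lambda>i. Q (j # i)) (\<lambda>i. N (j # i)) (\<lambda>i. C (j # i)) n \<omega> else 0)"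
  proof (intro arg_cong[where f = suminf] ext)
    fix j
    show "(\<integral>\<^sup>+i. F (j # i) \<partial>count_space UNIV) = (if 1 \<le> j \<and> enat j \<le> N [] \<omega> then
      ennreal (C [j] \<omega>) * tree_W (\<lambda>i. Q (j # i)) (\<lambda>i. N (j # i)) (\<lambda>i. C (j # i)) n \<omega> else 0)"
    proof (cases "1 \<le> j \<and> enat j \<le> N [] \<omega>")
      case True
      have "F (j # i) = ennreal (C [j] \<omega>) * (if i \<in> generation
          (\<lambda>i. N (j # i)) n \<omega> then ennreal (Q (j # i) \<omega> * path_weight (\<lambda>i. C (j # i)) i \<omega>)
          else 0)" for i
        unfolding F_def Cons_in_generation_iff path_weight_Cons
        using True assms[of j] by (auto simp: ennreal_mult'[symmetric] mult_ac)
      then show ?thesis using True by (simp add: tree_W_eq nn_integral_cmult)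
    next
      case False
      then have "F (j # i) = 0" for i unfolding F_def Cons_in_generation_iff by auto
      then show ?thesis unfolding if_not_P[OF False] by simp
    qed
  qed
  finally show ?thesis unfolding sum_upto_eq_suminf .
qed

lemma ennreal_suminf_swap:
  fixes f :: "nat \<Rightarrow> nat \<Rightarrow> ennreal"
  shows "(\<Sum>i. \<Sum>k. f i k) = (\<Sum>k. \<Sum>i. f i k)"
  using nn_integral_suminf[of "\<lambda>i k. f i k" "count_space UNIV"]
  by (simp add: nn_integral_count_space_nat)

text \<open>Moment bounds are proved for these truncations, which start from 0, so that no
  finiteness of the moments of \<open>R\<close> has to be presupposed.\<close>

definition tree_partial :: "(nat list \<Rightarrow> 'w \<Rightarrow> real) \<Rightarrow> (nat list \<Rightarrow> 'w \<Rightarrow> enat) \<Rightarrow>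
    (nat list \<Rightarrow> 'w \<Rightarrow> real) \<Rightarrow> nat \<Rightarrow> 'w \<Rightarrow> ennreal" where
  "tree_partial Q N C n \<omega> = (\<Sum>k<n. tree_W Q N C k \<omega>)"

lemma tree_R_eq_SUP: "tree_R Q N C \<omega> = (SUP n. tree_partial Q N C n \<omega>)"
  unfolding tree_R_def tree_partial_def by (rule suminf_eq_SUP)

lemma tree_partial_mono: "m \<le> n \<Longrightarrow> tree_partial Q N C m \<omega> \<le> tree_partial Q N C n \<omega>"
  unfolding tree_partial_def by (intro sum_mono2) auto

lemma tree_partial_Suc:
  assumes "\<And>j. 1 \<le> j \<Longrightarrow> 0 \<le> C [j] \<omega>"
  shows "tree_partial Q N C (Suc n) \<omega> =
    sum_upto (N [] \<omega>) (\<lambda>j. ennreal (C [j] \<omega>) * tree_partial (\<lambda>i. Q (j # i)) (\<lambda>i. N (j # i))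
        (\<lambda>i. C (j # i)) n \<omega>)
    + ennreal (Q [] \<omega>)"
proof -
  have W: "tree_W Q N C (Suc k) \<omega> = sum_upto (N [] \<omega>)
      (\<lambda>j. ennreal (C [j] \<omega>) * tree_W (\<lambda>i. Q (j # i)) (\<lambda>i. N (j # i)) (\<lambda>i. C (j # i)) k \<omega>)" for k
    by (rule tree_W_Suc) (rule assms)
  have "tree_partial Q N C (Suc n) \<omega> = ennreal (Q [] \<omega>) + (\<Sum>k<n. tree_W Q N C (Suc k) \<omega>)"
    unfolding tree_partial_def by (subst sum.lessThan_Suc_shift) (simp add: tree_W_0)
  also have "(\<Sum>k<n. tree_W Q N C (Suc k) \<omega>) =
    sum_upto (N [] \<omega>) (\<lambda>j. ennreal (C [j] \<omega>) * tree_partial (\<lambda>i. Q (j # i)) (\<lambda>i. N (j # i))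
        (\<lambda>i. C (j # i)) n \<omega>)"
    unfolding W sum_upto_eq_suminf tree_partial_def
    by (subst suminf_sum[OF summableI, symmetric])
       (rule arg_cong[where f = suminf], auto simp: sum_distrib_left)
  finally show ?thesis by (simp add: add.commute)
qed

lemma tree_R_step:
  assumes "\<And>j. 1 \<le> j \<Longrightarrow> 0 \<le> C [j] \<omega>"
  shows "tree_R Q N C \<omega> =
    sum_upto (N [] \<omega>) (\<lambda>j. ennreal (C [j] \<omega>) * tree_R (\<lambda>i. Q (j # i)) (\<lambda>i. N (j # i))
        (\<lambda>i. C (j # i)) \<omega>)
    + ennreal (Q [] \<omega>)"
proof -
  have W: "tree_W Q N C (Suc k) \<omega> = sum_upto (N [] \<omega>)
      (\<lambda>j. ennreal (C [j] \<omega>) * tree_W (\<lambda>i. Q (j # i)) (\<lambda>i. N (j # i)) (\<lambda>i. C (j # i)) k \<omega>)" for k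
    by (rule tree_W_Suc) (rule assms)
  have "tree_R Q N C \<omega> = (\<Sum>k. tree_W Q N C (Suc k) \<omega>) + ennreal (Q [] \<omega>)"
    unfolding tree_R_def by (subst suminf_offset[of _ 1]) (auto simp: tree_W_0)
  also have "(\<Sum>k. tree_W Q N C (Suc k) \<omega>) =
    sum_upto (N [] \<omega>) (\<lambda>j. ennreal (C [j] \<omega>) * tree_R (\<lambda>i. Q (j # i)) (\<lambda>i. N (j # i))
        (\<lambda>i. C (j # i)) \<omega>)"
    unfolding W sum_upto_eq_suminf tree_R_def
  proof (subst ennreal_suminf_swap, rule arg_cong[where f = suminf], rule ext)
    fix j
    show "(\<Sum>k. if 1 \<le> j \<and> enat j \<le> N [] \<omega> then ennreal (C [j] \<omega>) * tree_W (\<lambda>i. Q (j # i))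
        (\<lambda>i. N (j # i)) (\<lambda>i. C (j # i)) k \<omega> else 0)
      = (if 1 \<le> j \<and> enat j \<le> N [] \<omega> then ennreal (C [j] \<omega>) * (\<Sum>k. tree_W (\<lambda>i. Q (j # i))
          (\<lambda>i. N (j # i)) (\<lambda>i. C (j # i)) k \<omega>) else 0)"
    proof (cases "1 \<le> j \<and> enat j \<le> N [] \<omega>")
      case True
      show ?thesis unfolding if_P[OF True] by simp
    next
      case False
      show ?thesis unfolding if_not_P[OF False] by simp
    qed
  qed
  finally show ?thesis .
qed

section \<open>Congruence and measurability of the tree functionals\<close>

lemma Nil_in_nodes [simp]: "[] \<in> nodes"
  by (simp add: nodes_def)

lemma snoc_in_nodes_iff [simp]: "i @ [j] \<in> nodes \<longleftrightarrow> i \<in> nodes \<and> 1 \<le> j"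
  by (auto simp: nodes_def)

lemma Cons_in_nodes_iff [simp]: "j # i \<in> nodes \<longleftrightarrow> 1 \<le> j \<and> i \<in> nodes"
  by (auto simp: nodes_def)

lemma generation_cong:
  assumes "\<And>i. i \<in> nodes \<Longrightarrow> N i \<omega> = N' i \<omega>'"
  shows "generation N n \<omega> = generation N' n \<omega>'"
proof (induction n)
  case (Suc n)
  show ?case
    using assms generation_subset_nodes[of _ N' n \<omega>'] by (auto simp: Suc)
qed simp

lemma path_weight_cong:
  assumes "\<And>i j. i \<in> nodes \<Longrightarrow> 1 \<le> j \<Longrightarrow> C (i @ [j]) \<omega> = C' (i @ [j]) \<omega>'" and "i \<in> nodes"
  shows "path_weight C i \<omega> = path_weight C' i \<omega>'"
  using assms(2) by (induction i rule: rev_induct) (use assms(1) in auto)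

text \<open>The two sides may live on different sample spaces; this moves the functionals to the
  canonical space of families of marks.\<close>

lemma tree_W_cong:
  assumes "\<And>i. i \<in> nodes \<Longrightarrow> Q i \<omega> = Q' i \<omega>'" and N: "\<And>i. i \<in> nodes \<Longrightarrow> N i \<omega> = N' i \<omega>'"
    and C: "\<And>i j. i \<in> nodes \<Longrightarrow> 1 \<le> j \<Longrightarrow> C (i @ [j]) \<omega> = C' (i @ [j]) \<omega>'"
  shows "tree_W Q N C n \<omega> = tree_W Q' N' C' n \<omega>'"
proof -
  have gen: "generation N n \<omega> = generation N' n \<omega>'"
    by (rule generation_cong) (rule N)
  show ?thesis
    unfolding tree_W_def gen
  proof (rule infsum_cong)
  fix i assume "i \<in> generation N' n \<omega>'"
  then have i: "i \<in> nodes" by (rule generation_subset_nodes)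
  show "ennreal (Q i \<omega> * path_weight C i \<omega>) = ennreal (Q' i \<omega>' * path_weight C' i \<omega>')"
    using assms(1)[OF i] path_weight_cong[of C \<omega> C' \<omega>' i] C i by simp
  qed
qed

lemma measurable_generation:
  assumes "\<And>i. i \<in> nodes \<Longrightarrow> N i \<in> measurable M (count_space UNIV)"
  shows "Measurable.pred M (\<lambda>\<omega>. i \<in> generation N n \<omega>)"
proof (induction i arbitrary: n rule: rev_induct)
  case Nil
  show ?case by (simp add: Nil_in_generation_iff)
next
  case (snoc j i)
  show ?case
  proof (cases n)
    case (Suc n')
    show ?thesis
    proof (cases "i \<in> nodes")
      case True
      note assms[OF True, measurable] snoc[measurable]
      show ?thesis unfolding Suc snoc_in_generation_iff by measurable
    next
      case False
      then have "i \<notin> generation N n' \<omega>" for \<omega> using generation_subset_nodes[of i N n' \<omega>] by blast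
      then show ?thesis unfolding Suc snoc_in_generation_iff by simp
    qed
  qed simp
qed

lemma measurable_path_weight:
  assumes "\<And>i j. i \<in> nodes \<Longrightarrow> 1 \<le> j \<Longrightarrow> C (i @ [j]) \<in> borel_measurable M" and "i \<in> nodes"
  shows "path_weight C i \<in> borel_measurable M"
  using assms(2)
proof (induction i rule: rev_induct)
  case (snoc j i)
  then have "(\<lambda>\<omega>. C (i @ [j]) \<omega> * path_weight C i \<omega>) \<in> borel_measurable M"
    using assms(1) by (intro borel_measurable_times) auto
  moreover have "path_weight C (i @ [j]) = (\<lambda>\<omega>. C (i @ [j]) \<omega> * path_weight C i \<omega>)"
    by (rule ext) simp
  ultimately show ?case by simp
next
  case Nil
  have "path_weight C [] = (\<lambda>_. 1)" by (rule ext) simp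
  then show ?case by simp
qed

lemma measurable_tree_W:
  assumes Q: "\<And>i. i \<in> nodes \<Longrightarrow> Q i \<in> borel_measurable M"
    and N: "\<And>i. i \<in> nodes \<Longrightarrow> N i \<in> measurable M (count_space UNIV)"
    and C: "\<And>i j. i \<in> nodes \<Longrightarrow> 1 \<le> j \<Longrightarrow> C (i @ [j]) \<in> borel_measurable M"
  shows "tree_W Q N C n \<in> borel_measurable M"
  unfolding tree_W_eq[abs_def]
proof (rule borel_measurable_nn_integral_count_space)
  fix i
  note measurable_generation[OF N, measurable]
  show "(\<lambda>\<omega>. if i \<in> generation N n \<omega> then ennreal (Q i \<omega> * path_weight C i \<omega>)
      else 0) \<in> borel_measurable M"
  proof (cases "i \<in> nodes")
    case True
    note Q[OF True, measurable]
    have [measurable]: "path_weight C i \<in> borel_measurable M"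
      by (rule measurable_path_weight) (use C True in auto)
    show ?thesis by measurable
  next
    case False
    then have "i \<notin> generation N n \<omega>" for \<omega> using generation_subset_nodes[of i N n \<omega>] by blast
    then show ?thesis by simp
  qed
qed

text \<open>The tree as a fixed measurable function of its whole family of marks. Questions about
  the laws of subtrees thereby reduce to the laws of families of marks.\<close>

definition family_Q :: "nat list \<Rightarrow> (nat list \<Rightarrow> real \<times> enat \<times> (nat \<Rightarrow> real)) \<Rightarrow> real" where
  "family_Q i x = fst (x i)"

definition family_N :: "nat list \<Rightarrow> (nat list \<Rightarrow> real \<times> enat \<times> (nat \<Rightarrow> real)) \<Rightarrow> enat" where
  "family_N i x = fst (snd (x i))"

text \<open>The weight of a node is stored in the mark of its parent \<open>butlast i\<close>, at
  position \<open>last i\<close>.\<close>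

definition family_C :: "nat list \<Rightarrow> (nat list \<Rightarrow> real \<times> enat \<times> (nat \<Rightarrow> real)) \<Rightarrow> real" where
  "family_C i x = snd (snd (x (butlast i))) (last i)"

abbreviation family_space :: "(nat list \<Rightarrow> real \<times> enat \<times> (nat \<Rightarrow> real)) measure" where
  "family_space \<equiv> PiM nodes (\<lambda>_. mark_space)"

lemma measurable_mark_space:
  "fst \<in> borel_measurable mark_space"
  "(\<lambda>x. fst (snd x)) \<in> measurable mark_space (count_space UNIV)"
  "1 \<le> j \<Longrightarrow> (\<lambda>x. snd (snd x) j) \<in> borel_measurable mark_space"
  unfolding mark_space_def by measurable

lemma measurable_family:
  "i \<in> nodes \<Longrightarrow> family_Q i \<in> borel_measurable family_space"
  "i \<in> nodes \<Longrightarrow> family_N i \<in> measurable family_space (count_space UNIV)"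
  "i \<in> nodes \<Longrightarrow> 1 \<le> j \<Longrightarrow> family_C (i @ [j]) \<in> borel_measurable family_space"
  unfolding family_Q_def[abs_def] family_N_def[abs_def] family_C_def[abs_def]
  by (auto intro!: measurable_compose[OF measurable_component_singleton] measurable_mark_space)

lemma measurable_family_tree_W: "tree_W family_Q family_N family_C n \<in> borel_measurable
    family_space"
  by (intro measurable_tree_W measurable_family)

lemma measurable_family_tree_partial: "tree_partial family_Q family_N family_C n \<in> borel_measurable
    family_space"
  unfolding tree_partial_def[abs_def] by (intro borel_measurable_sum measurable_family_tree_W)

lemma measurable_family_tree_R: "tree_R family_Q family_N family_C \<in> borel_measurable family_space"
  unfolding tree_R_def[abs_def] by (intro borel_measurable_suminf_order measurable_family_tree_W)

section \<open>Joint law of the root mark and of the subtrees\<close>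

context weighted_branching_tree
begin

lemma measurable_mark: "i \<in> nodes \<Longrightarrow> mark Q N C i \<in> measurable M mark_space"
  using indep_marks by (auto simp: indep_vars_def)

lemma measurable_Q: "i \<in> nodes \<Longrightarrow> Q i \<in> borel_measurable M"
  using measurable_compose[OF measurable_mark measurable_mark_space(1)] by (simp add: mark_def)

lemma measurable_N: "i \<in> nodes \<Longrightarrow> N i \<in> measurable M (count_space UNIV)"
  using measurable_compose[OF measurable_mark measurable_mark_space(2)] by (simp add: mark_def)

lemma measurable_C: "i \<in> nodes \<Longrightarrow> 1 \<le> j \<Longrightarrow> C (i @ [j]) \<in> borel_measurable M"
  using measurable_compose[OF measurable_mark measurable_mark_space(3)] by (simp add: mark_def)

lemma measurable_root [measurable]:
  "Q [] \<in> borel_measurable M" "N [] \<in> measurable M (count_space UNIV)"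
  using measurable_Q[of "[]"] measurable_N[of "[]"] by auto

lemma measurable_root_C: "1 \<le> j \<Longrightarrow> C [j] \<in> borel_measurable M"
  using measurable_C[of "[]" j] by simp

definition subfamily :: "nat list \<Rightarrow> 'w \<Rightarrow> nat list \<Rightarrow> real \<times> enat \<times> (nat \<Rightarrow> real)" where
  "subfamily k \<omega> = (\<lambda>i\<in>nodes. mark Q N C (k @ i) \<omega>)"

lemma append_in_nodes: "k \<in> nodes \<Longrightarrow> i \<in> nodes \<Longrightarrow> k @ i \<in> nodes"
  by (auto simp: nodes_def)

lemma tree_W_subfamily:
  assumes "k \<in> nodes"
  shows "tree_W (\<lambda>i. Q (k @ i)) (\<lambda>i. N (k @ i)) (\<lambda>i. C (k @ i)) n \<omega> =
    tree_W family_Q family_N family_C n (subfamily k \<omega>)"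
  by (rule tree_W_cong) (auto simp: family_Q_def family_N_def family_C_def subfamily_def mark_def)

lemma measurable_subfamily: "k \<in> nodes \<Longrightarrow> subfamily k \<in> measurable M family_space"
  unfolding subfamily_def[abs_def] by (intro measurable_restrict measurable_mark append_in_nodes)

lemma distr_subfamily_root:
  "distr M family_space (subfamily []) = PiM nodes (\<lambda>_. distr M mark_space (mark Q N C []))"
proof -
  have "distr M family_space (subfamily []) = PiM nodes (\<lambda>i. distr M mark_space (mark Q N C i))"
    using indep_marks measurable_mark indep_vars_iff_distr_eq_PiM'[of nodes "mark Q N C" "\<lambda>_.
        mark_space"]
    unfolding subfamily_def by (auto intro: Nil_in_nodes)
  also have "\<dots> = PiM nodes (\<lambda>_. distr M mark_space (mark Q N C []))"
    by (rule PiM_cong) (auto intro: distr_marks)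
  finally show ?thesis .
qed

text \<open>Under the product law of \<open>distr_subfamily_root\<close>, passing to the subtree at
  \<open>k\<close> only reindexes iid factors along the injection that prepends
  \<open>k\<close>.\<close>

lemma distr_subfamily:
  assumes k: "k \<in> nodes"
  shows "distr M family_space (subfamily k) = distr M family_space (subfamily [])"
proof -
  define \<mu> where "\<mu> = distr M mark_space (mark Q N C [])"
  have \<mu>: "prob_space \<mu>" unfolding \<mu>_def by (rule prob_space_distr) (rule measurable_mark, simp)
  have sets_eq: "sets (PiM nodes (\<lambda>_. \<mu>)) = sets family_space"
    by (rule sets_PiM_cong) (auto simp: \<mu>_def)
  have "distr M family_space (subfamily k)
      = distr (distr M family_space (subfamily [])) family_space (\<lambda>x. \<lambda>i\<in>nodes. x (k @ i))"
  proof (subst distr_distr)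
    show "(\<lambda>x. \<lambda>i\<in>nodes. x (k @ i)) \<in> measurable family_space family_space"
      using k append_in_nodes by (intro measurable_restrict measurable_component_singleton) auto
    show "distr M family_space (subfamily k)
        = distr M family_space ((\<lambda>x. \<lambda>i\<in>nodes. x (k @ i)) \<circ> subfamily [])"
      using k append_in_nodes by (intro arg_cong[where f
          = "distr M family_space"] ext) (auto simp: subfamily_def)
  qed (auto intro: measurable_subfamily)
  also have "\<dots> = distr (PiM nodes (\<lambda>_. \<mu>)) (PiM nodes (\<lambda>_. \<mu>)) (\<lambda>x. \<lambda>i\<in>nodes. x (k @ i))"
    unfolding distr_subfamily_root \<mu>_def[symmetric] by (rule distr_cong) (auto simp: sets_eq)
  also have "\<dots> = PiM nodes (\<lambda>_. \<mu>)"
    using distr_PiM_reindex[of nodes "\<lambda>_. \<mu>" "\<lambda>i. k @ i" nodes] \<mu> k append_in_nodes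
    by (auto simp: inj_on_def)
  finally show ?thesis unfolding distr_subfamily_root \<mu>_def .
qed

declare One_nat_def [simp del]

text \<open>The root and the sets of nodes below the different children are pairwise disjoint, so
  functions of these blocks of marks are independent.\<close>

lemma indep_subfamilies:
  fixes \<rho> :: "_ \<Rightarrow> ennreal"
  assumes [measurable]: "\<rho> \<in> borel_measurable family_space"
  shows "indep_vars (\<lambda>_. borel) (\<lambda>j \<omega>. \<rho> (subfamily [j] \<omega>)) {1..}"
    and "distr M (mark_space \<Otimes>\<^sub>M PiM {1..} (\<lambda>_. borel))
        (\<lambda>\<omega>. (mark Q N C [] \<omega>, \<lambda>j\<in>{1..}. \<rho> (subfamily [j] \<omega>))) =
      distr M mark_space (mark Q N C []) \<Otimes>\<^sub>M distr M (PiM {1..} (\<lambda>_. borel))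
          (\<lambda>\<omega>. \<lambda>j\<in>{1..}. \<rho> (subfamily [j] \<omega>))"
proof -
  have meas: "(\<lambda>x. \<lambda>i\<in>nodes. x (j # i)) \<in> measurable (PiM I (\<lambda>_. mark_space)) family_space"
    if "(#) j ` nodes \<subseteq> I" for j I
    using that by (intro measurable_restrict measurable_component_singleton) auto
  let ?K = "\<lambda>j. (#) j ` nodes"
  have "indep_vars (\<lambda>j. PiM (?K j) (\<lambda>_. mark_space)) (\<lambda>j \<omega>. restrict
      (\<lambda>i. mark Q N C i \<omega>) (?K j)) {1..}"
    by (rule indep_vars_restrict[OF indep_marks]) (auto simp: disjoint_family_on_def)
  then have "indep_vars (\<lambda>_. borel) (\<lambda>j \<omega>. \<rho> (\<lambda>i\<in>nodes. restrict
      (\<lambda>i. mark Q N C i \<omega>) (?K j) (j # i))) {1..}"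
    by (rule indep_vars_compose2) (rule measurable_compose[OF meas], auto)
  also have "(\<lambda>j \<omega>. \<rho> (\<lambda>i\<in>nodes. restrict (\<lambda>i. mark Q N C i \<omega>) (?K j) (j # i)))
      = (\<lambda>j \<omega>. \<rho> (subfamily [j] \<omega>))"
    by (intro ext arg_cong[where f = \<rho>]) (auto simp: subfamily_def)
  finally show "indep_vars (\<lambda>_. borel) (\<lambda>j \<omega>. \<rho> (subfamily [j] \<omega>)) {1..}" .
  define A where "A = (\<lambda>\<omega>. restrict (\<lambda>i. mark Q N C i \<omega>) {[]})"
  define B where "B = (\<lambda>\<omega>. restrict (\<lambda>i. mark Q N C i \<omega>) (nodes - {[]}))"
  define g where "g = (\<lambda>x. \<lambda>j\<in>{1..}. \<rho> (\<lambda>i\<in>nodes. x (j # i)))"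
  let ?PA = "PiM {[]} (\<lambda>_. mark_space)" and ?PB = "PiM (nodes - {[]}) (\<lambda>_. mark_space)"
    and ?PC = "PiM {1..} (\<lambda>_. borel) :: (nat \<Rightarrow> ennreal) measure"
  have ind: "indep_var ?PA A ?PB B"
    unfolding A_def B_def by (rule indep_var_restrict[OF indep_marks]) auto
  have [measurable]: "A \<in> measurable M ?PA" "B \<in> measurable M ?PB"
    using indep_var_rv1[OF ind] indep_var_rv2[OF ind] by auto
  have g_meas[measurable]: "g \<in> measurable ?PB ?PC"
    unfolding g_def by (intro measurable_restrict measurable_compose[OF meas]) auto
  have f_meas[measurable]: "(\<lambda>x. x []) \<in> measurable ?PA mark_space" by simp
  have fA: "(\<lambda>x. x []) \<circ> A = mark Q N C []" by (auto simp: A_def)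
  have gB: "g \<circ> B = (\<lambda>\<omega>. \<lambda>j\<in>{1..}. \<rho> (subfamily [j] \<omega>))"
    unfolding g_def B_def by (intro ext) (auto simp: subfamily_def restrict_def intro!:
        arg_cong[where f = \<rho>])
  have "distr M mark_space (mark Q N C []) \<Otimes>\<^sub>M distr M ?PC (g \<circ> B)
      = distr (distr M ?PA A) mark_space (\<lambda>x. x []) \<Otimes>\<^sub>M distr (distr M ?PB B) ?PC g"
    by (simp add: distr_distr fA)
  also have "\<dots> = distr (distr M ?PA A \<Otimes>\<^sub>M distr M ?PB B) (mark_space \<Otimes>\<^sub>M ?PC)
      (\<lambda>(x, y). (x [], g y))"
  proof (rule pair_measure_distr)
    have "prob_space (distr (distr M ?PB B) ?PC g)"
      by (intro prob_space.prob_space_distr prob_space_axioms) auto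
    then show "sigma_finite_measure (distr (distr M ?PB B) ?PC g)"
      by (rule prob_space_imp_sigma_finite)
  qed simp_all
  also have "distr M ?PA A \<Otimes>\<^sub>M distr M ?PB B = distr M (?PA \<Otimes>\<^sub>M ?PB) (\<lambda>\<omega>. (A \<omega>, B \<omega>))"
    using ind unfolding indep_var_distribution_eq by simp
  also have "distr \<dots> (mark_space \<Otimes>\<^sub>M ?PC) (\<lambda>(x, y). (x [], g y)) =
      distr M (mark_space \<Otimes>\<^sub>M ?PC) ((\<lambda>(x, y). (x [], g y)) \<circ> (\<lambda>\<omega>. (A \<omega>, B \<omega>)))"
    by (rule distr_distr) measurable
  also have "(\<lambda>(x, y). (x [], g y)) \<circ> (\<lambda>\<omega>. (A \<omega>, B \<omega>))
      = (\<lambda>\<omega>. (mark Q N C [] \<omega>, \<lambda>j\<in>{1..}. \<rho> (subfamily [j] \<omega>)))"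
    by (rule ext) (use fun_cong[OF fA] fun_cong[OF gB] in simp)
  finally show "distr M (mark_space \<Otimes>\<^sub>M PiM {1..} (\<lambda>_. borel))
      (\<lambda>\<omega>. (mark Q N C [] \<omega>, \<lambda>j\<in>{1..}. \<rho> (subfamily [j] \<omega>))) =
      distr M mark_space (mark Q N C []) \<Otimes>\<^sub>M distr M (PiM {1..} (\<lambda>_. borel))
          (\<lambda>\<omega>. \<lambda>j\<in>{1..}. \<rho> (subfamily [j] \<omega>))"
    unfolding gB by (rule sym)
qed

lemma indep_vars_coordinates:
  "prob_space.indep_vars (PiM UNIV (\<lambda>_. M)) (\<lambda>_. M) (\<lambda>j x. x j) (UNIV :: nat set)"
proof -
  interpret P: prob_space "PiM (UNIV :: nat set) (\<lambda>_. M)"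
    by (rule prob_space_PiM) (rule prob_space_axioms)
  have "distr (PiM (UNIV :: nat set) (\<lambda>_. M)) (PiM UNIV (\<lambda>_. M)) (\<lambda>x. \<lambda>i\<in>UNIV. x i)
      = PiM UNIV (\<lambda>i. distr (PiM UNIV (\<lambda>_. M)) M (\<lambda>x. x i))"
    using distr_PiM_component[of "UNIV :: nat set" "\<lambda>_. M"] prob_space_axioms
        by (simp add: restrict_UNIV)
  then show ?thesis
    by (subst P.indep_vars_iff_distr_eq_PiM) auto
qed

lemma prob_space_copies: "prob_space (copies_space M)"
proof -
  interpret P: prob_space "PiM (UNIV :: nat set) (\<lambda>_. M)"
    by (rule prob_space_PiM) (rule prob_space_axioms)
  interpret MP: pair_prob_space M "PiM (UNIV :: nat set) (\<lambda>_. M)" ..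
  show ?thesis unfolding copies_space_def by (rule MP.P.prob_space_axioms)
qed

text \<open>Both laws are the product of the law of the root mark with a countable power of the law
  of \<open>\<rho>\<close> on one tree: on the left by independence of the subtrees, on the right by
  the construction of \<open>copies_space\<close>.\<close>

lemma distr_root_and_subfamilies:
  fixes \<rho> :: "_ \<Rightarrow> ennreal"
  assumes \<rho>[measurable]: "\<rho> \<in> borel_measurable family_space"
  shows "distr M (mark_space \<Otimes>\<^sub>M PiM {1..} (\<lambda>_. borel))
      (\<lambda>\<omega>. (mark Q N C [] \<omega>, \<lambda>j\<in>{1..}. \<rho> (subfamily [j] \<omega>))) =
    distr (copies_space M) (mark_space \<Otimes>\<^sub>M PiM {1..} (\<lambda>_. borel))
      (\<lambda>p. (mark Q N C [] (fst p), \<lambda>j\<in>{1..}. \<rho> (subfamily [] (snd p j))))"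
proof -
  define Y where "Y \<omega> = \<rho> (subfamily [] \<omega>)" for \<omega>
  have Y_meas[measurable]: "Y \<in> borel_measurable M"
    unfolding Y_def by (rule measurable_compose[OF measurable_subfamily \<rho>]) simp
  have Yj: "distr M borel (\<lambda>\<omega>. \<rho> (subfamily [j] \<omega>)) = distr M borel Y" if "j \<in> {1..}" for j
  proof -
    have j: "[j] \<in> nodes" using that by simp
    have "distr M borel (\<lambda>\<omega>. \<rho> (subfamily [j] \<omega>))
        = distr (distr M family_space (subfamily [j])) borel \<rho>"
      using measurable_subfamily[OF j] by (simp add: distr_distr o_def)
    also have "\<dots> = distr (distr M family_space (subfamily [])) borel \<rho>"
      using distr_subfamily[OF j] by simp
    also have "\<dots> = distr M borel Y"
      using measurable_subfamily[of "[]"] by (simp add: distr_distr o_def Y_def[abs_def])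
    finally show ?thesis .
  qed
  have ne: "{1..} \<noteq> ({} :: nat set)" by auto
  have rv: "(\<lambda>\<omega>. \<rho> (subfamily [j] \<omega>)) \<in> borel_measurable M" if "j \<in> {1..}" for j
    using that by (intro measurable_compose[OF measurable_subfamily \<rho>]) simp
  have L: "distr M (PiM {1..} (\<lambda>_. borel)) (\<lambda>\<omega>. \<lambda>j\<in>{1..}. \<rho> (subfamily [j] \<omega>))
      = PiM {1..} (\<lambda>_. distr M borel Y)"
  proof -
    have "distr M (PiM {1..} (\<lambda>_. borel)) (\<lambda>\<omega>. \<lambda>j\<in>{1..}. \<rho> (subfamily [j] \<omega>))
        = PiM {1..} (\<lambda>j. distr M borel (\<lambda>\<omega>. \<rho> (subfamily [j] \<omega>)))"
      using indep_subfamilies(1)[OF \<rho>] rv by (subst (asm) indep_vars_iff_distr_eq_PiM'[OF ne]) auto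
    also have "\<dots> = PiM {1..} (\<lambda>_. distr M borel Y)"
      by (rule PiM_cong) (auto simp: Yj simp del: One_nat_def)
    finally show ?thesis .
  qed
  interpret P: prob_space "PiM (UNIV :: nat set) (\<lambda>_. M)"
    by (rule prob_space_PiM) (rule prob_space_axioms)
  have "P.indep_vars (\<lambda>_. borel) (\<lambda>j x. Y (x j)) UNIV"
    by (rule P.indep_vars_compose2[OF indep_vars_coordinates]) measurable
  then have indY: "P.indep_vars (\<lambda>_. borel) (\<lambda>j x. Y (x j)) {1..}"
    by (rule P.indep_vars_subset) simp
  have Yc: "distr (PiM UNIV (\<lambda>_. M)) borel (\<lambda>x. Y (x j)) = distr M borel Y" for j :: nat
  proof -
    have "distr (PiM UNIV (\<lambda>_. M)) borel (\<lambda>x. Y (x j))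
        = distr (distr (PiM UNIV (\<lambda>_. M)) M (\<lambda>x. x j)) borel Y"
      by (simp add: distr_distr o_def)
    then show ?thesis
      using distr_PiM_component[of "UNIV :: nat set" "\<lambda>_. M" j] prob_space_axioms by simp
  qed
  have R: "distr (PiM UNIV (\<lambda>_. M)) (PiM {1..} (\<lambda>_. borel)) (\<lambda>x. \<lambda>j\<in>{1::nat..}. Y (x j))
      = PiM {1..} (\<lambda>_. distr M borel Y)"
    using indY P.indep_vars_iff_distr_eq_PiM'[OF ne, of "\<lambda>j x. Y (x j)" "\<lambda>_. borel"]
    by (auto simp: Yc simp del: One_nat_def)
  have prob: "prob_space (PiM {1::nat..} (\<lambda>_. distr M borel Y))"
    by (intro prob_space_PiM prob_space_distr) measurable
  have "distr M (mark_space \<Otimes>\<^sub>M PiM {1..} (\<lambda>_. borel))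
      (\<lambda>\<omega>. (mark Q N C [] \<omega>, \<lambda>j\<in>{1..}. \<rho> (subfamily [j] \<omega>)))
      = distr M mark_space (mark Q N C []) \<Otimes>\<^sub>M PiM {1..} (\<lambda>_. distr M borel Y)"
    unfolding indep_subfamilies(2)[OF \<rho>] L ..
  also have "\<dots> = distr M mark_space (mark Q N C []) \<Otimes>\<^sub>M
      distr (PiM UNIV (\<lambda>_. M)) (PiM {1..} (\<lambda>_. borel)) (\<lambda>x. \<lambda>j\<in>{1::nat..}. Y (x j))"
    unfolding R ..
  also have "\<dots> = distr (M \<Otimes>\<^sub>M PiM UNIV (\<lambda>_. M)) (mark_space \<Otimes>\<^sub>M PiM {1..} (\<lambda>_. borel))
      (\<lambda>(\<omega>, x). (mark Q N C [] \<omega>, \<lambda>j\<in>{1::nat..}. Y (x j)))"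
  proof (rule pair_measure_distr)
    show "sigma_finite_measure (distr (PiM UNIV (\<lambda>_. M)) (PiM {1..} (\<lambda>_. borel))
        (\<lambda>x. \<lambda>j\<in>{1::nat..}. Y (x j)))"
      unfolding R using prob by (rule prob_space_imp_sigma_finite)
    show "mark Q N C [] \<in> measurable M mark_space" by (rule measurable_mark) simp
  qed measurable
  also have "\<dots> = distr (copies_space M) (mark_space \<Otimes>\<^sub>M PiM {1..} (\<lambda>_. borel))
      (\<lambda>p. (mark Q N C [] (fst p), \<lambda>j\<in>{1..}. \<rho> (subfamily [] (snd p j))))"
    unfolding copies_space_def Y_def by (simp add: case_prod_beta')
  finally show ?thesis .
qed

text \<open>The smoothing transform of the distributional equation, evaluated on independent copies
  of \<open>Y\<close>.\<close>

definition smoothing :: "('w \<Rightarrow> ennreal) \<Rightarrow> 'w \<times> (nat \<Rightarrow> 'w) \<Rightarrow> ennreal" where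
  "smoothing Y p = sum_upto (N [] (fst p)) (\<lambda>i. ennreal (C [i] (fst p)) * Y (snd p i))
      + ennreal (Q [] (fst p))"

text \<open>Both sides are images of the same joint law under one deterministic function
  \<open>h\<close> of the root mark and the copies.\<close>

lemma distr_smoothing:
  assumes \<rho>[measurable]: "\<rho> \<in> borel_measurable family_space"
    and Z[measurable]: "Z \<in> borel_measurable M"
    and ae: "AE \<omega> in M. Z \<omega> = sum_upto (N [] \<omega>) (\<lambda>i. ennreal (C [i] \<omega>) * \<rho> (subfamily [i] \<omega>))
        + ennreal (Q [] \<omega>)"
  shows "distr M borel Z = distr (copies_space M) borel (smoothing (\<lambda>\<omega>. \<rho> (subfamily [] \<omega>)))"
proof -
  let ?T = "mark_space \<Otimes>\<^sub>M PiM {1..} (\<lambda>_. borel :: ennreal measure)"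
  define h :: "(real \<times> enat \<times> (nat \<Rightarrow> real)) \<times> (nat \<Rightarrow> ennreal) \<Rightarrow> ennreal"
    where "h = (\<lambda>my. sum_upto (fst (snd (fst my)))
        (\<lambda>i. ennreal (snd (snd (fst my)) i) * snd my i) + ennreal (fst (fst my)))"
  note [measurable] = measurable_mark_space measurable_mark[OF Nil_in_nodes]
  have h_meas[measurable]: "h \<in> borel_measurable ?T"
    unfolding h_def
  proof (intro borel_measurable_add borel_measurable_sum_upto)
    show "(\<lambda>x. fst (snd (fst x))) \<in> measurable ?T (count_space UNIV)" by measurable
    show "(\<lambda>x. ennreal (fst (fst x))) \<in> borel_measurable ?T" by measurable
    fix i :: nat assume i: "1 \<le> i"
    note measurable_mark_space(3)[OF i, measurable]
    have "(\<lambda>x. snd x i) \<in> borel_measurable ?T"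
      by (rule measurable_compose[OF measurable_snd measurable_component_singleton]) (use i in simp)
    then show "(\<lambda>x. ennreal (snd (snd (fst x)) i) * snd x i) \<in> borel_measurable ?T"
      by measurable
  qed
  have m1: "(\<lambda>\<omega>. (mark Q N C [] \<omega>, \<lambda>j\<in>{1..}. \<rho> (subfamily [j] \<omega>))) \<in> measurable M ?T"
    by (intro measurable_Pair measurable_restrict measurable_compose[OF measurable_subfamily \<rho>]
        measurable_mark) auto
  have m2: "(\<lambda>p. (mark Q N C [] (fst p), \<lambda>j\<in>{1..}. \<rho> (subfamily [] (snd p j)))) \<in> measurable
      (copies_space M) ?T"
    unfolding copies_space_def
    using measurable_compose[OF measurable_subfamily[OF Nil_in_nodes] \<rho>] by measurable
  have "distr M borel Z = distr M borel (\<lambda>\<omega>. h (mark Q N C [] \<omega>, \<lambda>j\<in>{1..}. \<rho> (subfamily [j] \<omega>)))"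
  proof (rule distr_cong_AE)
    show "(\<lambda>\<omega>. h (mark Q N C [] \<omega>, \<lambda>j\<in>{1..}. \<rho> (subfamily [j] \<omega>))) \<in> borel_measurable M"
      by (rule measurable_compose[OF m1 h_meas])
    show "AE \<omega> in M. Z \<omega> = h (mark Q N C [] \<omega>, \<lambda>j\<in>{1..}. \<rho> (subfamily [j] \<omega>))"
      using ae by eventually_elim (auto simp: h_def mark_def intro!: sum_upto_cong)
  qed (use Z in auto)
  also have "\<dots> = distr (distr M ?T (\<lambda>\<omega>. (mark Q N C [] \<omega>, \<lambda>j\<in>{1..}. \<rho> (subfamily [j] \<omega>)))) borel h"
    by (subst distr_distr[OF h_meas m1]) (simp add: o_def)
  also have "\<dots> = distr (copies_space M) borel
      (\<lambda>p. h (mark Q N C [] (fst p), \<lambda>j\<in>{1..}. \<rho> (subfamily [] (snd p j))))"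
    unfolding distr_root_and_subfamilies[OF \<rho>]
        by (subst distr_distr[OF h_meas m2]) (simp add: o_def)
  also have "(\<lambda>p. h (mark Q N C [] (fst p), \<lambda>j\<in>{1..}. \<rho> (subfamily [] (snd p j))))
      = smoothing (\<lambda>\<omega>. \<rho> (subfamily [] \<omega>))"
    by (rule ext) (auto simp: h_def mark_def smoothing_def intro!: sum_upto_cong)
  finally show ?thesis .
qed

lemma tree_partial_subfamily:
  "k \<in> nodes \<Longrightarrow> tree_partial (\<lambda>i. Q (k @ i)) (\<lambda>i. N (k @ i)) (\<lambda>i. C (k @ i)) n \<omega> =
    tree_partial family_Q family_N family_C n (subfamily k \<omega>)"
  unfolding tree_partial_def by (simp add: tree_W_subfamily)

lemma tree_R_subfamily:
  "k \<in> nodes \<Longrightarrow> tree_R (\<lambda>i. Q (k @ i)) (\<lambda>i. N (k @ i)) (\<lambda>i. C (k @ i)) \<omega> =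
    tree_R family_Q family_N family_C (subfamily k \<omega>)"
  unfolding tree_R_def by (simp add: tree_W_subfamily)

lemma measurable_tree_partial [measurable]: "tree_partial Q N C n \<in> borel_measurable M"
  unfolding tree_partial_def[abs_def]
      by (intro borel_measurable_sum measurable_tree_W measurable_Q measurable_N measurable_C)

lemma measurable_tree_R [measurable]: "tree_R Q N C \<in> borel_measurable M"
  unfolding tree_R_def[abs_def] by (intro borel_measurable_suminf_order measurable_tree_W
      measurable_Q measurable_N measurable_C)

lemma AE_C_nonneg: "AE \<omega> in M. \<forall>j\<ge>1. 0 \<le> C [j] \<omega>"
  using nonneg_marks by eventually_elim auto

theorem distr_tree_partial_Suc:
  "distr M borel (tree_partial Q N C (Suc n))
      = distr (copies_space M) borel (smoothing (tree_partial Q N C n))"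
proof -
  have "AE \<omega> in M. tree_partial Q N C (Suc n) \<omega> =
      sum_upto (N [] \<omega>) (\<lambda>i. ennreal (C [i] \<omega>) * tree_partial family_Q family_N family_C n
          (subfamily [i] \<omega>)) + ennreal (Q [] \<omega>)"
    using AE_C_nonneg
  proof eventually_elim
    case (elim \<omega>)
    show ?case
      by (subst tree_partial_Suc) (use elim tree_partial_subfamily[of "[_]"] in \<open>auto intro!:
          sum_upto_cong\<close>)
  qed
  note step = distr_smoothing[OF measurable_family_tree_partial measurable_tree_partial this]
  have "(\<lambda>\<omega>. tree_partial family_Q family_N family_C n (subfamily [] \<omega>)) = tree_partial Q N C n"
    by (rule ext) (use tree_partial_subfamily[of "[]"] in simp)
  with step show ?thesis by (simp only:)
qed

declare One_nat_def [simp]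

theorem distr_tree_R:
  "distr M borel (tree_R Q N C) = distr (copies_space M) borel (smoothing (tree_R Q N C))"
proof -
  have "AE \<omega> in M. tree_R Q N C \<omega> =
      sum_upto (N [] \<omega>) (\<lambda>i. ennreal (C [i] \<omega>) * tree_R family_Q family_N family_C (subfamily [i]
          \<omega>)) + ennreal (Q [] \<omega>)"
    using AE_C_nonneg
  proof eventually_elim
    case (elim \<omega>)
    show ?case
      by (subst tree_R_step) (use elim tree_R_subfamily[of "[_]"] in \<open>auto intro!: sum_upto_cong\<close>)
  qed
  note step = distr_smoothing[OF measurable_family_tree_R measurable_tree_R this]
  have "(\<lambda>\<omega>. tree_R family_Q family_N family_C (subfamily [] \<omega>)) = tree_R Q N C"
    by (rule ext) (use tree_R_subfamily[of "[]"] in simp)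
  with step show ?thesis by (simp only:)
qed

end

section \<open>Powers of sums\<close>

lemma epowr_ennreal: "0 \<le> x \<Longrightarrow> epowr (ennreal x) a = ennreal (x powr a)"
  by (simp add: epowr_def)

lemma epowr_zero [simp]: "epowr 0 a = 0"
  using epowr_ennreal[of 0 a] by simp

lemma epowr_one [simp]: "epowr 1 a = 1"
  using epowr_ennreal[of 1 a] by simp

lemma epowr_top [simp]: "epowr top a = top"
  by (simp add: epowr_def)

lemma epowr_id [simp]: "epowr x 1 = x"
  by (cases x) (auto simp: epowr_ennreal)

lemma epowr_eq_0_iff [simp]: "epowr x a = 0 \<longleftrightarrow> x = 0"
  by (cases x) (auto simp: epowr_ennreal)

lemma epowr_eq_top_iff [simp]: "epowr x a = top \<longleftrightarrow> x = top"
  by (cases x) (auto simp: epowr_ennreal)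

lemma epowr_less_top_iff [simp]: "epowr x a < top \<longleftrightarrow> x < top"
  by (metis less_top epowr_eq_top_iff)

lemma epowr_mono: "0 \<le> a \<Longrightarrow> x \<le> y \<Longrightarrow> epowr x a \<le> epowr y a"
  by (cases x; cases y) (auto simp: epowr_ennreal top_unique intro!: ennreal_leI powr_mono2)

lemma epowr_mult: "epowr (x * y) a = epowr x a * epowr y a"
proof (cases x; cases y)
  fix r s assume "x = ennreal r" "0 \<le> r" "y = ennreal s" "0 \<le> s"
  then show ?thesis by (simp add: epowr_ennreal ennreal_mult[symmetric] powr_mult)
qed (auto simp: epowr_ennreal ennreal_mult_top ennreal_top_mult)

lemma epowr_epowr: "epowr (epowr x a) b = epowr x (a * b)"
  by (cases x) (auto simp: epowr_ennreal powr_powr)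

lemma epowr_add: "epowr x (a + b) = epowr x a * epowr x b"
  by (cases x) (auto simp: epowr_ennreal powr_add ennreal_mult ennreal_top_mult)

lemma epowr_Suc: "epowr x (1 + b) = x * epowr x b"
  by (simp add: epowr_add)

lemma borel_measurable_epowr [measurable]: "(\<lambda>x. epowr x a) \<in> borel_measurable borel"
  unfolding epowr_def by measurable

lemma epowr_le_one_add:
  assumes "0 < a" "a \<le> b"
  shows "epowr x a \<le> 1 + epowr x b"
proof (cases "x \<le> 1")
  case True
  then have "epowr x a \<le> 1" using epowr_mono[of a x 1] assms by simp
  then show ?thesis by (simp add: add_increasing2)
next
  case False
  have "epowr x b = epowr x a * epowr x (b - a)" using epowr_add[of x a "b - a"] by simp
  moreover have "1 \<le> epowr x (b - a)" using epowr_mono[of "b - a" 1 x] assms False by simp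
  ultimately have "epowr x a \<le> epowr x b"
      using mult_left_mono[of 1 "epowr x (b - a)" "epowr x a"] by simp
  then show ?thesis by (simp add: add_increasing)
qed

text \<open>Factor \<open>z i\<close> out of its own power and bound the remaining power of order
  \<open>a - 1\<close> by that of the total.\<close>

lemma suminf_epowr_le:
  assumes "1 \<le> a"
  shows "(\<Sum>i. epowr (z i) a) \<le> epowr (\<Sum>i. z i) a"
proof -
  have "epowr (z i) a \<le> z i * epowr (\<Sum>i. z i) (a - 1)" for i
  proof -
    have "z i \<le> (\<Sum>i. z i)"
      using sum_le_suminf[of z "{i}"] by simp
    then show ?thesis
      using epowr_Suc[of "z i" "a - 1"] assms by (auto intro!: mult_left_mono epowr_mono)
  qed
  then have "(\<Sum>i. epowr (z i) a) \<le> (\<Sum>i. z i * epowr (\<Sum>i. z i) (a - 1))"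
    by (intro suminf_le) auto
  also have "\<dots> = epowr (\<Sum>i. z i) a"
    using epowr_Suc[of "\<Sum>i. z i" "a - 1"] by simp
  finally show ?thesis .
qed

text \<open>Superadditivity for the exponent \<open>1 / a\<close>, applied to the terms
  \<open>epowr (y i) a\<close>.\<close>

lemma epowr_suminf_le:
  assumes "0 < a" "a \<le> 1"
  shows "epowr (\<Sum>i. y i) a \<le> (\<Sum>i. epowr (y i) a)"
proof -
  have "(\<Sum>i. y i) = (\<Sum>i. epowr (epowr (y i) a) (1 / a))"
    using assms by (simp add: epowr_epowr)
  also have "\<dots> \<le> epowr (\<Sum>i. epowr (y i) a) (1 / a)"
    using assms by (intro suminf_epowr_le) simp
  finally have "epowr (\<Sum>i. y i) a \<le> epowr (epowr (\<Sum>i. epowr (y i) a) (1 / a)) a"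
    using assms by (intro epowr_mono) auto
  then show ?thesis using assms by (simp add: epowr_epowr)
qed

text \<open>Large enough for both cases of \<open>powr_add_le\<close>: \<open>2 powr a\<close> when
  the increment dominates, and \<open>a * 2 powr a\<close> from the mean value theorem
  otherwise.\<close>

definition power_const :: "real \<Rightarrow> real" where
  "power_const a = (a + 1) * 2 powr a"

lemma power_const_ge_1: "0 < a \<Longrightarrow> 1 \<le> power_const a"
  using mult_mono[of 1 "a + 1" 1 "2 powr a"] ge_one_powr_ge_zero[of 2 a]
      unfolding power_const_def by simp

text \<open>If \<open>z \<le> y\<close>, then \<open>z + y \<le> 2 * y\<close>. Otherwise the
  intermediate point of the mean value theorem lies below \<open>2 * z\<close>.\<close>

lemma powr_add_le:
  fixes z y :: real
  assumes "1 < a" "0 \<le> z" "0 \<le> y"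
  shows "(z + y) powr a \<le> z powr a + power_const a * (y powr a + z powr (a - 1) * y)"
proof (cases "z \<le> y")
  case True
  have "(z + y) powr a \<le> (2 * y) powr a" using True assms by (intro powr_mono2) auto
  also have "\<dots> = 2 powr a * y powr a" using assms by (simp add: powr_mult)
  also have "\<dots> \<le> power_const a * y powr a"
    using assms by (intro mult_right_mono) (auto simp: power_const_def)
  also have "\<dots> \<le> z powr a + power_const a * (y powr a + z powr (a - 1) * y)"
    using assms power_const_ge_1[of a] by (simp add: distrib_left)
  finally show ?thesis .
next
  case False
  show ?thesis
  proof (cases "y = 0")
    case False
    have "\<exists>x. z < x \<and> x < z + y \<and> (z + y) powr a - z powr a = (z + y - z) * (a * x powr (a - 1))"
      using assms \<open>\<not> z \<le> y\<close> False
      by (intro MVT2) (auto intro!: derivative_eq_intros simp: powr_diff)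
    then obtain x where x: "z < x" "x < z + y" "(z + y) powr a - z powr a
        = y * (a * x powr (a - 1))" by auto
    have "x powr (a - 1) \<le> (2 * z) powr (a - 1)" using x assms \<open>\<not> z \<le> y\<close> by (intro powr_mono2) auto
    also have "\<dots> = 2 powr (a - 1) * z powr (a - 1)" using assms by (simp add: powr_mult)
    also have "\<dots> \<le> 2 powr a * z powr (a - 1)" by (intro mult_right_mono powr_mono) auto
    finally have "y * (a * x powr (a - 1)) \<le> y * (a * (2 powr a * z powr (a - 1)))"
      using assms by (intro mult_left_mono) auto
    also have "\<dots> \<le> power_const a * (z powr (a - 1) * y)"
      using assms by (simp add: power_const_def algebra_simps)
    also have "\<dots> \<le> power_const a * (y powr a + z powr (a - 1) * y)"
      using power_const_ge_1[of a] assms by (intro mult_left_mono) auto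
    finally show ?thesis using x(3) by simp
  qed simp
qed

lemma epowr_add_le:
  assumes "0 < a"
  shows "epowr (z + y) a \<le> epowr z a + ennreal (power_const a) * (epowr y a
      + (if 1 < a then epowr z (a - 1) * y else 0))"
proof (cases "1 < a")
  case True
  show ?thesis
  proof (cases z; cases y)
    fix r s assume *: "z = ennreal r" "0 \<le> r" "y = ennreal s" "0 \<le> s"
    have "epowr (z + y) a = ennreal ((r + s) powr a)"
      using * by (simp add: epowr_ennreal flip: ennreal_plus)
    also have "\<dots> \<le> ennreal (r powr a + power_const a * (s powr a + r powr (a - 1) * s))"
      using powr_add_le[OF True *(2,4)] by (rule ennreal_leI)
    also have "\<dots> = epowr z a + ennreal (power_const a) * (epowr y a + epowr z (a - 1) * y)"
      using * power_const_ge_1[OF assms] by (simp add: epowr_ennreal ennreal_mult)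
    finally show ?thesis using True by simp
  qed (use power_const_ge_1[OF assms] in \<open>auto simp: ennreal_mult_top\<close>)
next
  case False
  \<comment> \<open>Two summands written as a series, so that subadditivity for series
    applies.\<close>
  define f where "f i = (if i = 0 then z else if i = 1 then y else 0)" for i :: nat
  have f: "(\<Sum>i. f i) = z + y" "(\<Sum>i. epowr (f i) a) = epowr z a + epowr y a"
    by (subst suminf_finite[of "{0, 1}"], auto simp: f_def)+
  have "epowr (z + y) a \<le> epowr z a + epowr y a"
    using epowr_suminf_le[of a f] assms False f by simp
  also have "\<dots> \<le> epowr z a + ennreal (power_const a) * epowr y a"
    using power_const_ge_1[OF assms] mult_right_mono[of 1 "ennreal (power_const a)" "epowr y a"]
    by (intro add_left_mono) simp
  finally show ?thesis using False by simp
qed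

definition others :: "(nat \<Rightarrow> ennreal) \<Rightarrow> nat \<Rightarrow> ennreal" where
  "others z i = (\<Sum>j. if j = i then 0 else z j)"

text \<open>
  This quantity dominates both \<open>(\<Sum>z)\<^sup>p - \<Sum>z\<^sup>p\<close> for \<open>p = a + 1\<close> and the weighted number of pairs of
  exceedances. For \<open>z i = c i * \<xi> i\<close> with independent \<open>\<xi> i\<close> its expectation involves only the
  moments of \<open>\<xi>\<close> of orders \<open>1\<close> and \<open>a\<close>, not those of order \<open>p\<close>.
\<close>

definition cross_terms :: "real \<Rightarrow> (nat \<Rightarrow> ennreal) \<Rightarrow> ennreal" where
  "cross_terms a z = (\<Sum>i. z i * epowr (others z i) a
      + (if 1 < a then epowr (z i) a * others z i else 0))"

section \<open>Mixed products and counts of exceedances\<close>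

lemma suminf_single: "(\<Sum>j. if j = i then x else 0 :: ennreal) = x"
  by (subst suminf_finite[of "{i}"]) auto

lemma add_others: "z i + others z i = (\<Sum>j. z j)"
proof -
  have "z i + others z i = (\<Sum>j. if j = i then z i else 0) + (\<Sum>j. if j = i then 0 else z j)"
    unfolding others_def suminf_single ..
  also have "\<dots> = (\<Sum>j. (if j = i then z i else 0) + (if j = i then 0 else z j))"
    by (rule suminf_add) auto
  also have "\<dots> = (\<Sum>j. z j)" by (intro arg_cong[where f = suminf]) auto
  finally show ?thesis .
qed

lemma others_le: "others z i \<le> (\<Sum>j. z j)"
  unfolding others_def by (intro suminf_le) auto

lemma le_others: "j \<noteq> i \<Longrightarrow> z j \<le> others z i"
  using sum_le_suminf[of "\<lambda>j. if j = i then 0 else z j" "{j}"] unfolding others_def by simp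

text \<open>The power is the sum over \<open>i\<close> of \<open>z i\<close> times the power
  \<open>p - 1\<close> of \<open>z i + others z i\<close>, which \<open>epowr_add_le\<close>
  expands. The diagonal sum keeps the coefficient 1: it will be cancelled against an equal sum, and
  in the moment recursion a larger coefficient could destroy the contraction.\<close>

lemma epowr_suminf_le_cross_terms:
  assumes "1 < p"
  shows "epowr (\<Sum>i. z i) p \<le> (\<Sum>i. epowr (z i) p)
      + ennreal (power_const (p - 1)) * cross_terms (p - 1) z"
proof -
  define a where "a = p - 1"
  have a: "0 < a" "p = 1 + a" using assms by (auto simp: a_def)
  have "epowr (\<Sum>i. z i) p = (\<Sum>i. z i * epowr (\<Sum>i. z i) a)"
    unfolding a(2) epowr_Suc by simp
  also have "\<dots> \<le> (\<Sum>i. epowr (z i) p + ennreal (power_const a) *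
      (z i * epowr (others z i) a + (if 1 < a then epowr (z i) a * others z i else 0)))"
  proof (intro suminf_le)
    fix i
    have "z i * epowr (\<Sum>i. z i) a = z i * epowr (z i + others z i) a" by (simp add: add_others)
    also have "\<dots> \<le> z i * (epowr (z i) a + ennreal (power_const a) *
        (epowr (others z i) a + (if 1 < a then epowr (z i) (a - 1) * others z i else 0)))"
      using a by (intro mult_left_mono epowr_add_le) auto
    also have "\<dots> = epowr (z i) p + ennreal (power_const a) *
      (z i * epowr (others z i) a + (if 1 < a then epowr (z i) a * others z i else 0))"
    proof -
      have e: "epowr (z i) a = z i * epowr (z i) (a - 1)" using epowr_Suc[of "z i" "a - 1"] by simp
      show ?thesis unfolding a(2) epowr_Suc by (cases "1 < a") (simp_all add: algebra_simps e)
    qed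
    finally show "z i * epowr (\<Sum>i. z i) a \<le> epowr (z i) p + ennreal (power_const a) *
      (z i * epowr (others z i) a + (if 1 < a then epowr (z i) a * others z i else 0))" .
  qed auto
  also have "\<dots> = (\<Sum>i. epowr (z i) p) + ennreal (power_const a) * cross_terms a z"
    unfolding cross_terms_def by (subst suminf_add[symmetric]) auto
  finally show ?thesis unfolding a_def .
qed

lemma nn_integral_layer_cake:
  assumes "0 < a"
  shows "(\<integral>\<^sup>+v. ennreal (a * v powr (a - 1)) * (if 0 < v \<and> ennreal v < x then 1 else 0) \<partial>lborel)
      = epowr x a"
proof -
  have fin: "(\<integral>\<^sup>+v. ennreal (a * v powr (a - 1)) * (if 0 < v
      \<and> ennreal v < ennreal c then 1 else 0) \<partial>lborel) = ennreal (c powr a)"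
    if c: "0 \<le> c" for c
  proof -
    have "((\<lambda>v. v powr (a - 1)) has_integral (c powr (a - 1 + 1) / (a - 1 + 1))) {0..c}"
      using assms c by (intro has_integral_powr_from_0) auto
    then have "((\<lambda>v. a * v powr (a - 1)) has_integral (a * (c powr a / a))) {0..c}"
      by (intro has_integral_mult_right) simp
    then have "((\<lambda>v. a * v powr (a - 1)) has_integral (c powr a)) {0..c}"
      using assms by simp
    then have "(\<integral>\<^sup>+v. ennreal (a * v powr (a - 1)) * indicator {0..c} v \<partial>lborel)
        = ennreal (c powr a)"
      using assms by (intro nn_integral_has_integral_lebesgue') auto
    moreover have "(\<integral>\<^sup>+v. ennreal (a * v powr (a - 1)) * (if 0 < v
        \<and> ennreal v < ennreal c then 1 else 0) \<partial>lborel) =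
        (\<integral>\<^sup>+v. ennreal (a * v powr (a - 1)) * indicator {0..c} v \<partial>lborel)"
    proof (rule nn_integral_cong_AE)
      show "AE v in lborel. ennreal (a * v powr (a - 1)) * (if 0 < v
          \<and> ennreal v < ennreal c then 1 else 0) =
          ennreal (a * v powr (a - 1)) * indicator {0..c} v"
        using AE_lborel_singleton[of 0] AE_lborel_singleton[of c]
        by eventually_elim (auto simp: indicator_def ennreal_less_iff)
    qed
    ultimately show ?thesis by simp
  qed
  show ?thesis
  proof (cases x)
    case (real r)
    then show ?thesis using fin by (simp add: epowr_ennreal)
  next
    case top
    let ?I = "\<integral>\<^sup>+v. ennreal (a * v powr (a - 1)) * (if 0 < v \<and> ennreal v < x then 1 else 0) \<partial>lborel"
    \<comment> \<open>The infinite case dominates the truncation at level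
      \<open>n powr (1 / a)\<close>, whose integral is \<open>n\<close>.\<close>
    have le: "of_nat n \<le> ?I" for n
    proof -
      have "of_nat n = ennreal ((real n powr (1 / a)) powr a)"
        using assms by (simp add: powr_powr ennreal_of_nat_eq_real_of_nat)
      also have "\<dots> \<le> ?I"
        unfolding fin[OF powr_ge_zero, symmetric] top by (intro nn_integral_mono) auto
      finally show ?thesis .
    qed
    have "?I = top"
    proof (rule ccontr)
      assume "?I \<noteq> top"
      then obtain n where "?I < of_nat n" using ennreal_Ex_less_of_nat[of ?I]
          by (auto simp: less_top)
      then show False using le[of n] by (simp only: not_le[symmetric])
    qed
    then show ?thesis using top by simp
  qed
qed

text \<open>A level below \<open>y i\<close> and another \<open>y j\<close> is also below
  \<open>epowr (others z i) (1 / \<beta>)\<close>, as this bounds \<open>y j\<close>. The layer-cake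
  formula integrates the minimum \<open>u i\<close> of the two to its power
  \<open>\<beta> * p\<close>; of the \<open>p\<close> factors \<open>epowr (u i) \<beta>\<close>,
  one is bounded by \<open>z i\<close> and the remaining power \<open>p - 1\<close> by
  \<open>others z i\<close>.\<close>

lemma nn_integral_cross_count_le:
  assumes \<beta>: "0 < \<beta>" "\<beta> \<le> 1" and p: "1 < p" and z: "\<And>i. z i = epowr (y i) \<beta>"
  shows "(\<integral>\<^sup>+v. ennreal (\<beta> * p * v powr (\<beta> * p - 1)) *
      (if 0 < v then \<Sum>i. of_bool (ennreal v < y i \<and> (\<exists>j. j \<noteq> i \<and> ennreal v < y j)) else 0) \<partial>lborel)
    \<le> cross_terms (p - 1) z"
proof -
  define \<alpha> where "\<alpha> = \<beta> * p"
  have \<alpha>: "0 < \<alpha>" using \<beta> p by (simp add: \<alpha>_def)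
  define u where "u i = min (y i) (epowr (others z i) (1 / \<beta>))" for i
  have "(\<integral>\<^sup>+v. ennreal (\<alpha> * v powr (\<alpha> - 1)) *
      (if 0 < v then \<Sum>i. of_bool (ennreal v < y i \<and> (\<exists>j. j \<noteq> i \<and> ennreal v < y j)) else 0) \<partial>lborel)
    \<le> (\<integral>\<^sup>+v. (\<Sum>i. ennreal (\<alpha> * v powr (\<alpha> - 1)) * (if 0 < v
        \<and> ennreal v < u i then 1 else 0)) \<partial>lborel)"
  proof (rule nn_integral_mono)
    fix v :: real
    have "of_bool (ennreal v < y i \<and> (\<exists>j. j \<noteq> i \<and> ennreal v < y j))
        \<le> (if ennreal v < u i then 1 else 0 :: ennreal)" for i
    proof -
      have "ennreal v < u i" if "ennreal v < y i" "j \<noteq> i" "ennreal v < y j" for j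
      proof -
        have "y j = epowr (z j) (1 / \<beta>)" using \<beta> by (simp add: z epowr_epowr)
        also have "\<dots> \<le> epowr (others z i) (1 / \<beta>)"
          using \<beta> le_others[OF that(2), of z] by (intro epowr_mono) auto
        finally show ?thesis using that by (auto simp: u_def)
      qed
      then show ?thesis by auto
    qed
    then show "ennreal (\<alpha> * v powr (\<alpha> - 1)) * (if 0 < v then \<Sum>i. of_bool (ennreal v < y i
        \<and> (\<exists>j. j \<noteq> i \<and> ennreal v < y j)) else 0)
      \<le> (\<Sum>i. ennreal (\<alpha> * v powr (\<alpha> - 1)) * (if 0 < v \<and> ennreal v < u i then 1 else 0))"
      by (cases "0 < v") (auto intro!: mult_left_mono suminf_le)
  qed
  also have "\<dots> = (\<Sum>i. \<integral>\<^sup>+v. ennreal (\<alpha> * v powr (\<alpha> - 1)) * (if 0 < v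
      \<and> ennreal v < u i then 1 else 0) \<partial>lborel)"
    by (rule nn_integral_suminf) measurable
  also have "\<dots> = (\<Sum>i. epowr (u i) \<alpha>)"
    by (simp only: nn_integral_layer_cake[OF \<alpha>])
  also have "\<dots> \<le> (\<Sum>i. z i * epowr (others z i) (p - 1))"
  proof (intro suminf_le)
    fix i
    have "epowr (u i) \<alpha> = epowr (epowr (u i) \<beta>) (1 + (p - 1))"
      by (simp add: epowr_epowr \<alpha>_def)
    also have "\<dots> = epowr (u i) \<beta> * epowr (epowr (u i) \<beta>) (p - 1)"
      by (rule epowr_Suc)
    also have "\<dots> \<le> z i * epowr (others z i) (p - 1)"
    proof (intro mult_mono epowr_mono)
      show "epowr (u i) \<beta> \<le> z i" unfolding z using \<beta> by (intro epowr_mono) (auto simp: u_def)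
      have "epowr (u i) \<beta> \<le> epowr (epowr (others z i) (1 / \<beta>)) \<beta>"
        using \<beta> by (intro epowr_mono) (auto simp: u_def)
      then show "epowr (u i) \<beta> \<le> others z i" using \<beta> by (simp add: epowr_epowr)
    qed (use p in auto)
    finally show "epowr (u i) \<alpha> \<le> z i * epowr (others z i) (p - 1)" .
  qed auto
  also have "\<dots> \<le> cross_terms (p - 1) z"
    unfolding cross_terms_def by (intro suminf_le) auto
  finally show ?thesis unfolding \<alpha>_def .
qed

text \<open>Truncated subtraction in both directions makes up the absolute difference in \<open>[0, \<infinity>]\<close>.\<close>

definition edist_diff :: "ennreal \<Rightarrow> ennreal \<Rightarrow> ennreal" where
  "edist_diff x y = (x - y) + (y - x)"

lemma borel_measurable_edist_diff [measurable (raw)]: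
  "f \<in> borel_measurable M \<Longrightarrow> g \<in> borel_measurable M
      \<Longrightarrow> (\<lambda>x. edist_diff (f x) (g x)) \<in> borel_measurable M"
  unfolding edist_diff_def by (intro borel_measurable_add borel_measurable_minus_ennreal)

lemma edist_diff_ennreal: "0 \<le> x \<Longrightarrow> 0 \<le> y \<Longrightarrow> edist_diff (ennreal x) (ennreal y) = ennreal \<bar>x - y\<bar>"
  by (cases "x \<le> y") (auto simp: edist_diff_def ennreal_minus ennreal_neg)

lemma suminf_of_bool_le:
  assumes "\<And>i j. P i \<Longrightarrow> P j \<Longrightarrow> i = j"
  shows "(\<Sum>i. of_bool (P i) :: ennreal) \<le> 1"
proof (cases "\<exists>i. P i")
  case True
  then obtain i where i: "P i" by blast
  have "(\<Sum>j. of_bool (P j) :: ennreal) = (\<Sum>j. if j = i then 1 else 0)"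
    using assms i by (intro arg_cong[where f = suminf] ext) auto
  then show ?thesis by (simp add: suminf_single)
qed simp

text \<open>Let \<open>k\<close> be the number of exceedances. The last sum \<open>c\<close> equals
  \<open>k\<close> if there are at least two and 0 otherwise, so \<open>k \<le> 1 + c\<close>; and
  for \<open>k \<ge> 1\<close> the left side is \<open>2 * k - 1\<close>. The count on the left
  avoids a subtraction in \<open>[0, \<infinity>]\<close>; it is removed after integration, where it
  is finite.\<close>

lemma edist_diff_count_le:
  fixes y :: "nat \<Rightarrow> ennreal"
  shows "edist_diff (of_bool (t < (\<Sum>i. y i))) (\<Sum>i. of_bool (t < y i)) + (\<Sum>i. of_bool (t < y i))
    \<le> of_bool (t < (\<Sum>i. y i)) + 2 * (\<Sum>i. of_bool (t < y i \<and> (\<exists>j. j \<noteq> i \<and> t < y j)))"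
proof -
  define k where "k = (\<Sum>i. of_bool (t < y i) :: ennreal)"
  define c where "c = (\<Sum>i. of_bool (t < y i \<and> (\<exists>j. j \<noteq> i \<and> t < y j)) :: ennreal)"
  have y_le: "y i \<le> (\<Sum>i. y i)" for i using sum_le_suminf[of y "{i}"] by simp
  show ?thesis
  proof (cases "\<exists>i. t < y i")
    case False
    then have "k = 0" unfolding k_def by simp
    then show ?thesis unfolding k_def[symmetric] by (auto simp: edist_diff_def)
  next
    case True
    then obtain i where i: "t < y i" by blast
    then have t: "t < (\<Sum>i. y i)" using y_le[of i] by simp
    have k1: "1 \<le> k" unfolding k_def using sum_le_suminf[of "\<lambda>i. of_bool (t < y i) :: ennreal"
        "{i}"] i by simp
    have kc: "k \<le> 1 + c"
    proof (cases "\<exists>j. j \<noteq> i \<and> t < y j")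
      case True
      then have "t < y l \<longleftrightarrow> t < y l \<and> (\<exists>j. j \<noteq> l \<and> t < y j)" for l
        using i by metis
      then have "k = c" unfolding k_def c_def by simp
      then show ?thesis by (simp add: add_increasing)
    next
      case False
      then have "k \<le> 1" unfolding k_def by (intro suminf_of_bool_le) metis
      then show ?thesis by (simp add: add_increasing2)
    qed
    have "edist_diff 1 k + k \<le> 1 + 2 * c"
    proof (cases k)
      case (real r)
      show ?thesis
      proof (cases c)
        case c: (real s)
        have "ennreal r \<le> ennreal (1 + s)" using kc real c by (simp add: ennreal_plus)
        then have "r \<le> 1 + s" using c real by (subst (asm) ennreal_le_iff) auto
        have "1 \<le> r" using k1 real by simp
        have "edist_diff 1 k + k = ennreal (r - 1) + ennreal r"
          using edist_diff_ennreal[of 1 r] real \<open>1 \<le> r\<close> by simp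
        also have "\<dots> = ennreal (2 * r - 1)" using \<open>1 \<le> r\<close> by (simp flip: ennreal_plus)
        also have "\<dots> \<le> ennreal (1 + 2 * s)" using \<open>r \<le> 1 + s\<close> by (intro ennreal_leI) simp
        also have "\<dots> = 1 + 2 * c" using c by (simp add: ennreal_plus ennreal_mult)
        finally show ?thesis .
      qed (simp add: ennreal_mult_top)
    next
      case top
      then have "c = top" using kc by (simp add: top_unique)
      then show ?thesis by (simp add: ennreal_mult_top)
    qed
    then show ?thesis using t unfolding k_def[symmetric] c_def[symmetric] by simp
  qed
qed

lemma borel_measurable_of_bool_less [measurable (raw)]:
  fixes f g :: "'a \<Rightarrow> ennreal"
  assumes [measurable]: "f \<in> borel_measurable M" "g \<in> borel_measurable M"
  shows "(\<lambda>x. of_bool (f x < g x) :: ennreal) \<in> borel_measurable M"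
  unfolding of_bool_def by measurable

text \<open>Integrating the pointwise bound leaves the excess of the power of the sum over the sum
  of powers, plus twice the weighted pairs of exceedances; \<open>cross_terms\<close> dominates
  both. Subadditivity of the power \<open>\<beta> \<le> 1\<close> reduces the first to the exponent
  \<open>p > 1\<close> for the terms \<open>z i\<close>.\<close>

theorem nn_integral_edist_diff_count_le:
  assumes \<beta>: "0 < \<beta>" "\<beta> \<le> 1" and p: "1 < p" and z: "\<And>i. z i
      = epowr (y i) \<beta>" and fin: "(\<Sum>i. z i) < \<infinity>"
  shows "(\<integral>\<^sup>+v. ennreal (\<beta> * p * v powr (\<beta> * p - 1)) *
      (if 0 < v then edist_diff (of_bool (ennreal v < (\<Sum>i. y i)))
          (\<Sum>i. of_bool (ennreal v < y i)) else 0) \<partial>lborel)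
    \<le> ennreal (power_const (p - 1) + 2) * cross_terms (p - 1) z"
    and "epowr (\<Sum>i. y i) (\<beta> * p) < \<infinity>" and "(\<Sum>i. epowr (y i) (\<beta> * p)) < \<infinity>"
proof -
  define \<alpha> where "\<alpha> = \<beta> * p"
  have \<alpha>: "0 < \<alpha>" using \<beta> p by (simp add: \<alpha>_def)
  define w where "w v = (if 0 < v then ennreal (\<alpha> * v powr (\<alpha> - 1)) else 0)" for v
  have [measurable]: "w \<in> borel_measurable borel" unfolding w_def by measurable
  define D where "D v = edist_diff (of_bool (ennreal v < (\<Sum>i. y i)))
      (\<Sum>i. of_bool (ennreal v < y i))" for v
  have [measurable]: "D \<in> borel_measurable borel" unfolding D_def by measurable
  define c where "c v = (\<Sum>i. of_bool (ennreal v < y i \<and> (\<exists>j. j \<noteq> i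
      \<and> ennreal v < y j)) :: ennreal)" for v
  have [measurable]: "c \<in> borel_measurable borel" unfolding c_def of_bool_def by measurable
  have layer: "(\<integral>\<^sup>+v. w v * of_bool (ennreal v < x) \<partial>lborel) = epowr x \<alpha>" for x
    unfolding nn_integral_layer_cake[OF \<alpha>, of x, symmetric]
        by (intro nn_integral_cong) (auto simp: w_def)
  have Z: "epowr (\<Sum>i. y i) \<alpha> \<le> epowr (\<Sum>i. z i) p"
  proof -
    have "epowr (\<Sum>i. y i) \<alpha> = epowr (epowr (\<Sum>i. y i) \<beta>) p" by (simp add: epowr_epowr \<alpha>_def)
    also have "\<dots> \<le> epowr (\<Sum>i. z i) p"
      unfolding z using p by (intro epowr_mono epowr_suminf_le \<beta>) simp
    finally show ?thesis .
  qed
  also have Zp: "epowr (\<Sum>i. z i) p < \<infinity>" using fin by simp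
  finally show fin1: "epowr (\<Sum>i. y i) (\<beta> * p) < \<infinity>" unfolding \<alpha>_def .
  have sum_eq: "(\<Sum>i. epowr (y i) \<alpha>) = (\<Sum>i. epowr (z i) p)"
    unfolding z epowr_epowr \<alpha>_def ..
  also have "\<dots> \<le> epowr (\<Sum>i. z i) p" using p by (intro suminf_epowr_le) simp
  also note Zp
  finally have fin2: "(\<Sum>i. epowr (y i) \<alpha>) < \<infinity>" .
  then show "(\<Sum>i. epowr (y i) (\<beta> * p)) < \<infinity>" unfolding \<alpha>_def .
  have k: "(\<integral>\<^sup>+v. w v * (\<Sum>i. of_bool (ennreal v < y i)) \<partial>lborel) = (\<Sum>i. epowr (y i) \<alpha>)"
  proof -
    have "(\<integral>\<^sup>+v. w v * (\<Sum>i. of_bool (ennreal v < y i)) \<partial>lborel)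
        = (\<integral>\<^sup>+v. (\<Sum>i. w v * of_bool (ennreal v < y i)) \<partial>lborel)"
      by simp
    also have "\<dots> = (\<Sum>i. \<integral>\<^sup>+v. w v * of_bool (ennreal v < y i) \<partial>lborel)"
      by (rule nn_integral_suminf) measurable
    finally show ?thesis unfolding layer .
  qed
  have c: "(\<integral>\<^sup>+v. w v * c v \<partial>lborel) \<le> cross_terms (p - 1) z"
  proof -
    have "(\<integral>\<^sup>+v. w v * c v \<partial>lborel) = (\<integral>\<^sup>+v. ennreal (\<beta> * p * v powr (\<beta> * p - 1)) *
      (if 0 < v then \<Sum>i. of_bool (ennreal v < y i \<and> (\<exists>j. j \<noteq> i \<and> ennreal v < y j)) else 0) \<partial>lborel)"
      by (intro nn_integral_cong) (auto simp: w_def c_def \<alpha>_def)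
    then show ?thesis using nn_integral_cross_count_le[OF \<beta> p z] by simp
  qed
  have "(\<integral>\<^sup>+v. w v * D v \<partial>lborel) + (\<Sum>i. epowr (y i) \<alpha>)
      = (\<integral>\<^sup>+v. w v * D v + w v * (\<Sum>i. of_bool (ennreal v < y i)) \<partial>lborel)"
    unfolding k[symmetric] by (rule nn_integral_add[symmetric]) measurable
  also have "\<dots> \<le> (\<integral>\<^sup>+v. w v * of_bool (ennreal v < (\<Sum>i. y i)) + 2 * (w v * c v) \<partial>lborel)"
  proof (rule nn_integral_mono)
    fix v
    have "w v * (D v + (\<Sum>i. of_bool (ennreal v < y i)))
        \<le> w v * (of_bool (ennreal v < (\<Sum>i. y i)) + 2 * c v)"
      unfolding D_def c_def by (intro mult_left_mono edist_diff_count_le) simp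
    then show "w v * D v + w v * (\<Sum>i. of_bool (ennreal v < y i))
        \<le> w v * of_bool (ennreal v < (\<Sum>i. y i)) + 2 * (w v * c v)"
      by (simp only: distrib_left mult_ac)
  qed
  also have "\<dots> = epowr (\<Sum>i. y i) \<alpha> + 2 * (\<integral>\<^sup>+v. w v * c v \<partial>lborel)"
    unfolding layer[symmetric] by (subst nn_integral_cmult[symmetric], measurable, rule
        nn_integral_add, measurable)
  also have "\<dots> \<le> (\<Sum>i. epowr (y i) \<alpha>) + ennreal (power_const (p - 1)) * cross_terms (p - 1) z
      + 2 * cross_terms (p - 1) z"
  proof (intro add_mono mult_left_mono c)
    show "epowr (\<Sum>i. y i) \<alpha> \<le> (\<Sum>i. epowr (y i) \<alpha>)
        + ennreal (power_const (p - 1)) * cross_terms (p - 1) z"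
      using Z epowr_suminf_le_cross_terms[OF p, of z] unfolding sum_eq by (rule order_trans)
  qed simp
  also have "\<dots> = (\<Sum>i. epowr (y i) \<alpha>) + ennreal (power_const (p - 1) + 2) * cross_terms (p - 1) z"
    using p power_const_ge_1[of "p - 1"] by (simp add: ennreal_plus distrib_right add.assoc)
  finally have "(\<Sum>i. epowr (y i) \<alpha>) + (\<integral>\<^sup>+v. w v * D v \<partial>lborel) \<le>
      (\<Sum>i. epowr (y i) \<alpha>) + ennreal (power_const (p - 1) + 2) * cross_terms (p - 1) z"
    by (simp only: add.commute)
  \<comment> \<open>The sum of powers stands on both sides and is cancelled; it is finite by
    \<open>fin2\<close>.\<close>
  then have "(\<integral>\<^sup>+v. w v * D v \<partial>lborel) \<le> ennreal (power_const (p - 1) + 2) * cross_terms (p - 1) z"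
    using fin2 by (subst (asm) ennreal_add_left_cancel_le) auto
  moreover have "(\<integral>\<^sup>+v. w v * D v \<partial>lborel) = (\<integral>\<^sup>+v. ennreal (\<beta> * p * v powr (\<beta> * p - 1)) *
      (if 0 < v then edist_diff (of_bool (ennreal v < (\<Sum>i. y i)))
          (\<Sum>i. of_bool (ennreal v < y i)) else 0) \<partial>lborel)"
    by (intro nn_integral_cong) (auto simp: w_def D_def \<alpha>_def)
  ultimately show "(\<integral>\<^sup>+v. ennreal (\<beta> * p * v powr (\<beta> * p - 1)) *
      (if 0 < v then edist_diff (of_bool (ennreal v < (\<Sum>i. y i)))
          (\<Sum>i. of_bool (ennreal v < y i)) else 0) \<partial>lborel)
    \<le> ennreal (power_const (p - 1) + 2) * cross_terms (p - 1) z" by simp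
qed

section \<open>Moments\<close>

text \<open>Jensen's inequality for the weights \<open>w\<close>, up to the constant
  \<open>2 powr a\<close>. Take \<open>u\<close> as half of the weighted mean, so
  \<open>T = 2 W u\<close>. From
  \<open>s u\<^sup>a\<^sup>-\<^sup>1 \<le> s\<^sup>a + u\<^sup>a\<close>, summation with weights
  gives \<open>2 W u\<^sup>a \<le> S + W u\<^sup>a\<close>, hence
  \<open>W u\<^sup>a \<le> S\<close>.\<close>

lemma epowr_suminf_weighted_le:
  assumes a: "1 < a"
  shows "epowr (\<Sum>j. w j * s j) a \<le> ennreal (2 powr a) * epowr (\<Sum>j. w j) (a - 1) *
      (\<Sum>j. w j * epowr (s j) a)"
proof -
  define W T S where "W = (\<Sum>j. w j)" and "T = (\<Sum>j. w j * s j)" and "S = (\<Sum>j. w j * epowr (s j) a)"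
  have "epowr T a \<le> ennreal (2 powr a) * epowr W (a - 1) * S"
  proof (cases "T = 0 \<or> S = top")
    case True
    show ?thesis
    proof (cases "T = 0")
      case False
      then have "S = top" using True by simp
      moreover have "W \<noteq> 0"
      proof
        assume "W = 0"
        then have "w j = 0" for j using sum_le_suminf[of w "{j}"] by (simp add: W_def)
        then show False using False by (simp add: T_def)
      qed
      ultimately show ?thesis by (simp add: ennreal_mult_top)
    qed simp
  next
    case False
    then have T0: "T \<noteq> 0" and S: "S < top" by (auto simp: less_top)
    show ?thesis
    proof (cases "W = top")
      case True
      have "S \<noteq> 0"
      proof
        assume "S = 0"
        then have "w j * epowr (s j) a = 0" for j
          using sum_le_suminf[of "\<lambda>j. w j * epowr (s j) a" "{j}"] by (simp add: S_def)
        then have "(\<lambda>j. w j * s j) = (\<lambda>_. 0)" by auto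
        then show False using T0 by (simp add: T_def)
      qed
      then show ?thesis using True by (simp add: ennreal_mult_top ennreal_top_mult)
    next
      case False
      then obtain W' where W': "W = ennreal W'" "0 \<le> W'" by (cases W) auto
      have "W \<noteq> 0"
      proof
        assume "W = 0"
        then have "w j = 0" for j using sum_le_suminf[of w "{j}"] by (simp add: W_def)
        then show False using T0 by (simp add: T_def)
      qed
      then have W'0: "0 < W'" using W' by (cases "W' = 0") auto
      \<comment> \<open>Finiteness of \<open>T\<close> makes \<open>u\<close> a real number, which
        the cancellation below relies on.\<close>
      have "T \<le> (\<Sum>j. w j + w j * epowr (s j) a)"
        unfolding T_def
      proof (intro suminf_le)
        fix j
        have "w j * s j \<le> w j * (1 + epowr (s j) a)"
          using epowr_le_one_add[of 1 a "s j"] a by (intro mult_left_mono) auto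
        then show "w j * s j \<le> w j + w j * epowr (s j) a" by (simp add: distrib_left)
      qed auto
      also have "\<dots> = W + S" unfolding W_def S_def by (rule suminf_add[symmetric]) auto
      also have "\<dots> < top" using S W' by simp
      finally obtain T' where T': "T = ennreal T'" "0 \<le> T'" by (cases T) auto
      define u where "u = ennreal (T' / (2 * W'))"
      have Tu: "T = 2 * W * u"
      proof -
        have "2 * W * u = ennreal 2 * ennreal W' * ennreal (T' / (2 * W'))"
          unfolding u_def W'(1) by simp
        also have "\<dots> = ennreal (2 * W' * (T' / (2 * W')))"
          using W'0 T' by (simp only: ennreal_mult[symmetric] zero_le_numeral mult_nonneg_nonneg
              divide_nonneg_nonneg less_imp_le)
        finally have "2 * W * u = ennreal (2 * W' * (T' / (2 * W')))" .
        then show ?thesis using W'0 T' by simp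
      qed
      have "T * epowr u (a - 1) = (\<Sum>j. w j * (s j * epowr u (a - 1)))"
        unfolding T_def by (simp add: mult.assoc flip: ennreal_suminf_multc)
      also have "\<dots> \<le> (\<Sum>j. w j * epowr (s j) a + w j * epowr u a)"
      proof (intro suminf_le)
        fix j
        have "s j * epowr u (a - 1) \<le> epowr (s j) a + epowr u a"
        proof (cases "s j \<le> u")
          case True
          then have "s j * epowr u (a - 1) \<le> u * epowr u (a - 1)" by (intro mult_right_mono) auto
          then show ?thesis using epowr_Suc[of u "a - 1"] by (simp add: add_increasing)
        next
          case False
          then have "s j * epowr u (a - 1) \<le> s j * epowr (s j) (a - 1)"
            using a by (intro mult_left_mono epowr_mono) auto
          then show ?thesis using epowr_Suc[of "s j" "a - 1"] by (simp add: add_increasing2)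
        qed
        then show "w j * (s j * epowr u (a - 1)) \<le> w j * epowr (s j) a + w j * epowr u a"
          unfolding distrib_left[symmetric] by (rule mult_left_mono) simp
      qed auto
      also have "\<dots> = S + W * epowr u a"
        unfolding S_def W_def by (subst suminf_add[symmetric]) auto
      finally have "T * epowr u (a - 1) \<le> S + W * epowr u a" .
      moreover have "T * epowr u (a - 1) = W * epowr u a + W * epowr u a"
        unfolding Tu using epowr_Suc[of u "a - 1"]
            by (simp add: mult_2 distrib_left distrib_right mult_ac)
      ultimately have "W * epowr u a + W * epowr u a \<le> W * epowr u a + S"
          by (simp only: add.commute)
      moreover have "W * epowr u a \<noteq> top" unfolding W' u_def by (simp add: ennreal_mult_eq_top_iff)
      ultimately have Wu: "W * epowr u a \<le> S"
          by (simp only: ennreal_add_left_cancel_le infinity_ennreal_def simp_thms)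
      have "epowr T a = epowr 2 a * (W * epowr W (a - 1)) * epowr u a"
        unfolding Tu epowr_mult using epowr_Suc[of W "a - 1"] by simp
      also have "epowr 2 a = ennreal (2 powr a)" using epowr_ennreal[of 2 a] by simp
      also have "ennreal (2 powr a) * (W * epowr W (a - 1)) * epowr u a
          = ennreal (2 powr a) * epowr W (a - 1) * (W * epowr u a)"
        by (simp add: mult_ac)
      also have "\<dots> \<le> ennreal (2 powr a) * epowr W (a - 1) * S"
        by (intro mult_left_mono Wu) simp
      finally show ?thesis .
    qed
  qed
  then show ?thesis unfolding W_def T_def S_def .
qed

text \<open>The term \<open>Q\<close> of the distributional equation is treated as a child with index \<open>0\<close> whose copy
    is constantly \<open>1\<close>.\<close>

definition copy :: "('w \<Rightarrow> ennreal) \<Rightarrow> (nat \<Rightarrow> 'w) \<Rightarrow> nat \<Rightarrow> ennreal" where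
  "copy Y x i = (if i = 0 then 1 else Y (x i))"

lemma epowr_copy: "epowr (copy Y x i) b = copy (\<lambda>\<omega>. epowr (Y \<omega>) b) x i"
  by (simp add: copy_def)

lemma measurable_copy [measurable (raw)]:
  assumes [measurable]: "Y \<in> borel_measurable M" "f \<in> measurable L (PiM UNIV (\<lambda>_. M))"
  shows "(\<lambda>\<omega>. copy Y (f \<omega>) i) \<in> borel_measurable L"
proof (cases "i = 0")
  case False
  have "(\<lambda>\<omega>. Y (f \<omega> i)) \<in> borel_measurable L" by measurable
  then show ?thesis using False by (simp add: copy_def)
qed (simp add: copy_def)

lemma measurable_others [measurable (raw)]:
  assumes [measurable]: "\<And>i. (\<lambda>\<omega>. z \<omega> i) \<in> borel_measurable L"
  shows "(\<lambda>\<omega>. others (z \<omega>) i) \<in> borel_measurable L"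
  unfolding others_def by measurable

lemma measurable_cross_terms [measurable (raw)]:
  assumes [measurable]: "\<And>i. (\<lambda>\<omega>. z \<omega> i) \<in> borel_measurable L"
  shows "(\<lambda>\<omega>. cross_terms a (z \<omega>)) \<in> borel_measurable L"
  unfolding cross_terms_def by measurable

text \<open>As \<open>G\<close> ignores coordinate \<open>i\<close>, it is independent of it. The
  proof resamples: replacing coordinate \<open>i\<close> by a fresh sample preserves the product
  measure.\<close>

lemma (in prob_space) nn_integral_PiM_mult:
  fixes F :: "'a \<Rightarrow> ennreal" and G :: "(nat \<Rightarrow> 'a) \<Rightarrow> ennreal"
  assumes [measurable]: "F \<in> borel_measurable M" "G \<in> borel_measurable (PiM UNIV (\<lambda>_. M))"
    and G: "\<And>x \<omega>. G (x(i := \<omega>)) = G x"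
  shows "(\<integral>\<^sup>+x. F (x i) * G x \<partial>PiM UNIV (\<lambda>_. M)) = (\<integral>\<^sup>+\<omega>. F \<omega> \<partial>M) * (\<integral>\<^sup>+x. G x \<partial>PiM UNIV (\<lambda>_. M))"
proof -
  let ?P = "PiM (UNIV :: nat set) (\<lambda>_. M)"
  interpret P: prob_space ?P by (rule prob_space_PiM) (rule prob_space_axioms)
  have upd: "(\<lambda>(\<omega>, x). x(i := \<omega>)) \<in> measurable (M \<Otimes>\<^sub>M ?P) ?P"
    unfolding split_beta' by (rule measurable_fun_upd[where J = UNIV]) auto
  have "?P = distr (M \<Otimes>\<^sub>M ?P) ?P (\<lambda>(\<omega>, x). x(i := \<omega>))"
    using distr_pair_PiM_eq_PiM[of UNIV "\<lambda>_. M" i] prob_space_axioms by simp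
  then have "(\<integral>\<^sup>+x. F (x i) * G x \<partial>?P)
      = (\<integral>\<^sup>+x. F (x i) * G x \<partial>distr (M \<Otimes>\<^sub>M ?P) ?P (\<lambda>(\<omega>, x). x(i := \<omega>)))"
    by simp
  also have "\<dots> = (\<integral>\<^sup>+p. F (fst p) * G (snd p) \<partial>(M \<Otimes>\<^sub>M ?P))"
    by (subst nn_integral_distr[OF upd]) (auto simp: G split_beta intro!: nn_integral_cong)
  also have "\<dots> = (\<integral>\<^sup>+\<omega>. \<integral>\<^sup>+x. F \<omega> * G x \<partial>?P \<partial>M)"
    by (subst P.nn_integral_fst[symmetric]) auto
  also have "\<dots> = (\<integral>\<^sup>+\<omega>. F \<omega> \<partial>M) * (\<integral>\<^sup>+x. G x \<partial>?P)"
    by (simp add: nn_integral_cmult nn_integral_multc)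
  finally show ?thesis .
qed

lemma (in prob_space) nn_integral_PiM_coordinate:
  assumes [measurable]: "F \<in> borel_measurable M"
  shows "(\<integral>\<^sup>+x. F (x i) \<partial>PiM (UNIV :: nat set) (\<lambda>_. M)) = (\<integral>\<^sup>+\<omega>. F \<omega> \<partial>M)"
proof -
  interpret P: prob_space "PiM (UNIV :: nat set) (\<lambda>_. M)"
      by (rule prob_space_PiM) (rule prob_space_axioms)
  show ?thesis
    using nn_integral_PiM_mult[of F "\<lambda>_. 1" i] P.emeasure_space_1 by simp
qed

lemma (in prob_space) nn_integral_copy:
  assumes [measurable]: "Y \<in> borel_measurable M"
  shows "(\<integral>\<^sup>+x. copy Y x i \<partial>PiM UNIV (\<lambda>_. M)) = (if i = 0 then 1 else \<integral>\<^sup>+\<omega>. Y \<omega> \<partial>M)"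
proof -
  interpret P: prob_space "PiM (UNIV :: nat set) (\<lambda>_. M)"
      by (rule prob_space_PiM) (rule prob_space_axioms)
  show ?thesis
    using nn_integral_PiM_coordinate[of Y i] P.emeasure_space_1 by (auto simp: copy_def)
qed

text \<open>The bracket bounds the moment of order \<open>a\<close> of the other terms, relative to
  \<open>epowr S a\<close>, in both ranges \<open>a \<le> 1\<close> and \<open>a > 1\<close>. Its
  product with \<open>A\<close> serves the first kind of mixed term, and \<open>A * A\<close> serves
  the second.\<close>

definition cross_const :: "real \<Rightarrow> real \<Rightarrow> real" where
  "cross_const a A = A * (1 + A + 2 powr a * A) + A * A"

text \<open>\<open>V x i\<close> does not involve the copy with index \<open>i\<close>, so the
  expectation of each mixed product factorises. The coefficients recombine through
  \<open>(\<Sum>c) S\<^sup>a = S\<^sup>1\<^sup>+\<^sup>a\<close> and, for \<open>a > 1\<close>,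
  \<open>\<Sum>c\<^sup>a \<le> S\<^sup>a\<close>.\<close>

lemma (in prob_space) nn_integral_cross_terms_le:
  assumes Y[measurable]: "Y \<in> borel_measurable M" and a: "0 < a" and A: "1 \<le> A"
    and Y1: "(\<integral>\<^sup>+\<omega>. Y \<omega> \<partial>M) \<le> ennreal A" and Ya: "1 < a \<Longrightarrow> (\<integral>\<^sup>+\<omega>. epowr (Y \<omega>) a \<partial>M) \<le> ennreal A"
  shows "(\<integral>\<^sup>+x. cross_terms a (\<lambda>i. c i * copy Y x i) \<partial>PiM UNIV (\<lambda>_. M))
    \<le> ennreal (cross_const a A) * epowr (\<Sum>i. c i) (1 + a)"
proof -
  let ?P = "PiM (UNIV :: nat set) (\<lambda>_. M)"
  interpret P: prob_space ?P by (rule prob_space_PiM) (rule prob_space_axioms)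
  define S where "S = (\<Sum>i. c i)"
  define V where "V x i = others (\<lambda>i. c i * copy Y x i) i" for x i
  have V_meas[measurable]: "(\<lambda>x. V x i) \<in> borel_measurable ?P" for i unfolding V_def by measurable
  define K1 where "K1 = 1 + A + 2 powr a * A"
  have A1: "1 \<le> ennreal A" using A by simp
  have cp: "(\<integral>\<^sup>+x. copy Y x i \<partial>?P) \<le> ennreal A" for i
    using Y1 A1 by (simp add: nn_integral_copy)
  have cpa: "(\<integral>\<^sup>+x. epowr (copy Y x i) a \<partial>?P) \<le> ennreal A" if "1 < a" for i
    using Ya[OF that] A1 by (simp add: epowr_copy nn_integral_copy)
  have EV: "(\<integral>\<^sup>+x. V x i \<partial>?P) \<le> ennreal A * S" for i
  proof -
    have "(\<integral>\<^sup>+x. V x i \<partial>?P) \<le> (\<integral>\<^sup>+x. (\<Sum>j. c j * copy Y x j) \<partial>?P)"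
      unfolding V_def by (intro nn_integral_mono others_le)
    also have "\<dots> = (\<Sum>j. c j * (\<integral>\<^sup>+x. copy Y x j \<partial>?P))"
      by (simp add: nn_integral_suminf nn_integral_cmult)
    also have "\<dots> \<le> (\<Sum>j. c j * ennreal A)"
      by (intro suminf_le mult_left_mono cp) auto
    also have "\<dots> = ennreal A * S" unfolding S_def by (simp add: mult.commute)
    finally show ?thesis .
  qed
  have EVa: "(\<integral>\<^sup>+x. epowr (V x i) a \<partial>?P) \<le> ennreal K1 * epowr S a" for i
  proof (cases "1 < a")
    case True
    have "(\<integral>\<^sup>+x. epowr (V x i) a \<partial>?P) \<le> (\<integral>\<^sup>+x. ennreal (2 powr a) * epowr S (a - 1) *
        (\<Sum>j. c j * epowr (copy Y x j) a) \<partial>?P)"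
    proof (rule nn_integral_mono)
      fix x
      have "epowr (V x i) a \<le> epowr (\<Sum>j. c j * copy Y x j) a"
        unfolding V_def using a by (intro epowr_mono others_le) simp
      also have "\<dots> \<le> ennreal (2 powr a) * epowr S (a - 1) * (\<Sum>j. c j * epowr (copy Y x j) a)"
        unfolding S_def by (rule epowr_suminf_weighted_le[OF True])
      finally show "epowr (V x i) a \<le> ennreal (2 powr a) * epowr S (a - 1) *
          (\<Sum>j. c j * epowr (copy Y x j) a)" .
    qed
    also have "\<dots> = ennreal (2 powr a) * epowr S (a - 1) * (\<Sum>j. c j *
        (\<integral>\<^sup>+x. epowr (copy Y x j) a \<partial>?P))"
      by (simp add: nn_integral_suminf nn_integral_cmult)
    also have "\<dots> \<le> ennreal (2 powr a) * epowr S (a - 1) * (\<Sum>j. c j * ennreal A)"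
      by (intro suminf_le mult_left_mono cpa True) auto
    also have "\<dots> = ennreal (2 powr a * A) * (S * epowr S (a - 1))"
      using A by (simp add: S_def ennreal_mult mult_ac)
    also have "\<dots> = ennreal (2 powr a * A) * epowr S a"
      using epowr_Suc[of S "a - 1"] by simp
    also have "\<dots> \<le> ennreal K1 * epowr S a"
      unfolding K1_def using A by (intro mult_right_mono ennreal_leI) auto
    finally show ?thesis .
  next
    case False
    show ?thesis
    proof (cases "S = 0 \<or> S = top")
      case True
      show ?thesis
      proof (cases "S = 0")
        case True
        then have "c j = 0" for j using sum_le_suminf[of c "{j}"] by (simp add: S_def)
        then show ?thesis by (simp add: V_def others_def)
      next
        case False
        then show ?thesis using True A by (simp add: ennreal_mult_top K1_def)
      qed
    next
      case *: False
      \<comment> \<open>For \<open>a \<le> 1\<close> the first moment suffices: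
        \<open>epowr x a \<le> 1 + x\<close> is used at \<open>x = V / S\<close>, so that the bound
        scales like \<open>epowr S a\<close>.\<close>
      then obtain s where s: "S = ennreal s" "0 < s"
          by (cases S) (auto simp: order.order_iff_strict)
      have "(\<integral>\<^sup>+x. epowr (V x i) a \<partial>?P) \<le> (\<integral>\<^sup>+x. epowr S a * (1 + ennreal (1 / s) * V x i) \<partial>?P)"
      proof (rule nn_integral_mono)
        fix x
        have "V x i = ennreal s * (ennreal (1 / s) * V x i)"
          using s by (simp add: mult.assoc[symmetric] ennreal_mult[symmetric])
        then have "epowr (V x i) a = epowr S a * epowr (ennreal (1 / s) * V x i) a"
          using epowr_mult[of S "ennreal (1 / s) * V x i" a] s by simp
        also have "\<dots> \<le> epowr S a * (1 + epowr (ennreal (1 / s) * V x i) 1)"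
          using a False by (intro mult_left_mono epowr_le_one_add) auto
        finally show "epowr (V x i) a \<le> epowr S a * (1 + ennreal (1 / s) * V x i)" by simp
      qed
      also have "\<dots> = epowr S a * (1 + ennreal (1 / s) * (\<integral>\<^sup>+x. V x i \<partial>?P))"
        using P.emeasure_space_1 by (simp add: nn_integral_cmult nn_integral_add)
      also have "\<dots> \<le> epowr S a * (1 + ennreal (1 / s) * (ennreal A * S))"
        by (intro mult_left_mono add_left_mono EV) auto
      also have "ennreal (1 / s) * (ennreal A * S) = ennreal A"
        using s A by (simp add: ennreal_mult[symmetric])
      also have "epowr S a * (1 + ennreal A) = ennreal (1 + A) * epowr S a"
        using A by (simp add: ennreal_plus mult.commute)
      also have "\<dots> \<le> ennreal K1 * epowr S a"
        unfolding K1_def using A by (intro mult_right_mono ennreal_leI) auto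
      finally show ?thesis .
    qed
  qed
  have V_upd: "V (x(i := \<omega>)) i = V x i" for x \<omega> i
    unfolding V_def others_def by (intro arg_cong[where f = suminf] ext) (auto simp: copy_def)
  have split: "(\<integral>\<^sup>+x. epowr (copy Y x i) b * G (V x i) \<partial>?P)
      = (\<integral>\<^sup>+x. epowr (copy Y x i) b \<partial>?P) * (\<integral>\<^sup>+x. G (V x i) \<partial>?P)"
    if [measurable]: "G \<in> borel_measurable borel" for G :: "ennreal \<Rightarrow> ennreal" and i b
  proof (cases "i = 0")
    case True
    then show ?thesis using P.emeasure_space_1 by (simp add: copy_def)
  next
    case False
    have "(\<integral>\<^sup>+x. epowr (Y (x i)) b * G (V x i) \<partial>?P)
        = (\<integral>\<^sup>+\<omega>. epowr (Y \<omega>) b \<partial>M) * (\<integral>\<^sup>+x. G (V x i) \<partial>?P)"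
      by (rule nn_integral_PiM_mult) (auto simp: V_upd)
    then show ?thesis using False nn_integral_copy[of "\<lambda>\<omega>. epowr (Y \<omega>) b" i] by (simp add: copy_def)
  qed
  have "(\<integral>\<^sup>+x. cross_terms a (\<lambda>i. c i * copy Y x i) \<partial>?P) =
      (\<integral>\<^sup>+x. (\<Sum>i. c i * (epowr (copy Y x i) 1 * epowr (V x i) a)
          + (if 1 < a then epowr (c i) a * (epowr (copy Y x i) a * V x i) else 0)) \<partial>?P)"
    unfolding cross_terms_def V_def by (simp add: epowr_mult mult.assoc cong: if_cong)
  also have "\<dots> = (\<Sum>i. c i * (\<integral>\<^sup>+x. epowr (copy Y x i) 1 * epowr (V x i) a \<partial>?P) +
      (if 1 < a then epowr (c i) a * (\<integral>\<^sup>+x. epowr (copy Y x i) a * V x i \<partial>?P) else 0))"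
    by (subst nn_integral_suminf, measurable)
       (auto intro!: arg_cong[where f = suminf] simp: nn_integral_add nn_integral_cmult)
  also have "\<dots> \<le> (\<Sum>i. c i * (ennreal (A * K1) * epowr S a)
      + (if 1 < a then epowr (c i) a * (ennreal (A * A) * S) else 0))"
  proof (intro suminf_le add_mono)
    fix i
    show "c i * (\<integral>\<^sup>+x. epowr (copy Y x i) 1 * epowr (V x i) a \<partial>?P)
        \<le> c i * (ennreal (A * K1) * epowr S a)"
    proof (rule mult_left_mono)
      have "(\<integral>\<^sup>+x. epowr (copy Y x i) 1 * epowr (V x i) a \<partial>?P)
          = (\<integral>\<^sup>+x. epowr (copy Y x i) 1 \<partial>?P) * (\<integral>\<^sup>+x. epowr (V x i) a \<partial>?P)"
        by (rule split) measurable
      also have "\<dots> \<le> ennreal A * (ennreal K1 * epowr S a)"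
        using cp[of i] by (intro mult_mono EVa) auto
      finally show "(\<integral>\<^sup>+x. epowr (copy Y x i) 1 * epowr (V x i) a \<partial>?P)
          \<le> ennreal (A * K1) * epowr S a"
        using A by (simp add: ennreal_mult K1_def mult.assoc)
    qed simp
    show "(if 1 < a then epowr (c i) a * (\<integral>\<^sup>+x. epowr (copy Y x i) a * V x i \<partial>?P) else 0) \<le>
        (if 1 < a then epowr (c i) a * (ennreal (A * A) * S) else 0)"
    proof (cases "1 < a")
      case True
      have "(\<integral>\<^sup>+x. epowr (copy Y x i) a * V x i \<partial>?P)
          = (\<integral>\<^sup>+x. epowr (copy Y x i) a \<partial>?P) * (\<integral>\<^sup>+x. V x i \<partial>?P)"
        by (rule split[of "\<lambda>x. x"]) measurable
      also have "\<dots> \<le> ennreal A * (ennreal A * S)"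
        by (intro mult_mono cpa EV True) auto
      also have "\<dots> = ennreal (A * A) * S" using A by (simp add: ennreal_mult mult.assoc)
      finally show ?thesis using True by (auto intro!: mult_left_mono)
    qed simp
  qed auto
  also have "\<dots> = ennreal (A * K1) * (S * epowr S a)
      + (if 1 < a then (\<Sum>i. epowr (c i) a) * (ennreal (A * A) * S) else 0)"
    unfolding S_def by (subst suminf_add[symmetric]) (auto simp: mult_ac)
  also have "\<dots> \<le> ennreal (A * K1) * epowr S (1 + a) + ennreal (A * A) * epowr S (1 + a)"
  proof (intro add_mono)
    show "ennreal (A * K1) * (S * epowr S a) \<le> ennreal (A * K1) * epowr S (1 + a)"
      by (simp add: epowr_Suc)
    show "(if 1 < a then (\<Sum>i. epowr (c i) a) * (ennreal (A * A) * S) else 0)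
        \<le> ennreal (A * A) * epowr S (1 + a)"
    proof (cases "1 < a")
      case True
      then have "(\<Sum>i. epowr (c i) a) * (ennreal (A * A) * S) \<le> epowr S a * (ennreal (A * A) * S)"
        unfolding S_def by (intro mult_right_mono suminf_epowr_le) auto
      then show ?thesis using True by (simp add: epowr_Suc mult_ac)
    qed simp
  qed
  also have "\<dots> = ennreal (cross_const a A) * epowr S (1 + a)"
    using A by (simp add: cross_const_def K1_def ennreal_plus distrib_right)
  finally show ?thesis unfolding S_def .
qed

lemma suminf_Suc_split:
  fixes f :: "nat \<Rightarrow> ennreal"
  shows "(\<Sum>i. if i = 0 then x else f i) = x + (\<Sum>i. if i = 0 then 0 else f i)"
  using add_others[of "\<lambda>i. if i = 0 then x else f i" 0] by (simp add: others_def cong: if_cong)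

section \<open>Moments of the tree by recursion\<close>

context weighted_branching_tree
begin

text \<open>Index 0 carries \<open>Q\<close>, to be paired with the constant copy, and coefficients
  beyond \<open>N\<close> are 0, so that random sums become series over all indices.\<close>

definition coef :: "'w \<Rightarrow> nat \<Rightarrow> ennreal" where
  "coef \<omega> i = (if i = 0 then ennreal (Q [] \<omega>) else if enat i
      \<le> N [] \<omega> then ennreal (C [i] \<omega>) else 0)"

lemma measurable_coef [measurable]: "(\<lambda>\<omega>. coef \<omega> i) \<in> borel_measurable M"
proof (cases "i = 0")
  case False
  have [measurable]: "C [i] \<in> borel_measurable M" using False by (intro measurable_root_C) simp
  have "(\<lambda>\<omega>. if enat i \<le> N [] \<omega> then ennreal (C [i] \<omega>) else 0) \<in> borel_measurable M" by measurable
  then show ?thesis using False by (simp add: coef_def)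
qed (simp add: coef_def)

lemma sum_upto_coef:
  fixes f :: "nat \<Rightarrow> ennreal \<Rightarrow> ennreal"
  assumes "\<And>i. f i 0 = 0"
  shows "sum_upto (N [] \<omega>) (\<lambda>i. f i (ennreal (C [i] \<omega>))) = (\<Sum>i. if i
      = 0 then 0 else f i (coef \<omega> i))"
  unfolding sum_upto_eq_suminf
  by (intro arg_cong[where f = suminf] ext) (auto simp: coef_def assms)

lemma smoothing_eq: "smoothing Y p = (\<Sum>i. coef (fst p) i * copy Y (snd p) i)"
proof -
  have "(\<Sum>i. coef (fst p) i * copy Y (snd p) i) = (\<Sum>i. if i
      = 0 then ennreal (Q [] (fst p)) else coef (fst p) i * Y (snd p i))"
    by (intro arg_cong[where f = suminf] ext) (auto simp: coef_def copy_def)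
  also have "\<dots> = ennreal (Q [] (fst p)) + (\<Sum>i. if i = 0 then 0 else coef (fst p) i * Y (snd p i))"
    by (rule suminf_Suc_split)
  finally show ?thesis
    unfolding smoothing_def using sum_upto_coef[of "\<lambda>i c. c * Y (snd p i)" "fst p"]
        by (simp add: add.commute)
qed

lemma measurable_fst_copies [measurable]: "fst \<in> measurable (copies_space M) M"
  and measurable_snd_copies [measurable]: "snd \<in> measurable (copies_space M) (PiM UNIV (\<lambda>_. M))"
  unfolding copies_space_def by measurable

lemma measurable_smoothing [measurable (raw)]:
  assumes [measurable]: "Y \<in> borel_measurable M"
  shows "smoothing Y \<in> borel_measurable (copies_space M)"
  unfolding smoothing_eq[abs_def] by measurable

lemma nn_integral_copies:
  assumes "f \<in> borel_measurable (copies_space M)"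
  shows "(\<integral>\<^sup>+p. f p \<partial>copies_space M) = (\<integral>\<^sup>+\<omega>. \<integral>\<^sup>+x. f (\<omega>, x) \<partial>PiM UNIV (\<lambda>_. M) \<partial>M)"
proof -
  interpret P: prob_space "PiM (UNIV :: nat set) (\<lambda>_. M)"
      by (rule prob_space_PiM) (rule prob_space_axioms)
  show ?thesis using assms unfolding copies_space_def by (simp add: P.nn_integral_fst)
qed

lemma nn_integral_copies_cross_terms_le:
  assumes [measurable]: "Y \<in> borel_measurable M" and a: "0 < a" and A: "1 \<le> A"
    and Y1: "(\<integral>\<^sup>+\<omega>. epowr (Y \<omega>) \<beta> \<partial>M) \<le> ennreal A"
    and Ya: "1 < a \<Longrightarrow> (\<integral>\<^sup>+\<omega>. epowr (Y \<omega>) (\<beta> * a) \<partial>M) \<le> ennreal A"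
  shows "(\<integral>\<^sup>+p. cross_terms a (\<lambda>i. epowr (coef (fst p) i * copy Y (snd p) i) \<beta>) \<partial>copies_space M)
    \<le> ennreal (cross_const a A) * (\<integral>\<^sup>+\<omega>. epowr (\<Sum>i. epowr (coef \<omega> i) \<beta>) (1 + a) \<partial>M)"
proof -
  have "(\<integral>\<^sup>+p. cross_terms a (\<lambda>i. epowr (coef (fst p) i * copy Y (snd p) i) \<beta>) \<partial>copies_space M)
      = (\<integral>\<^sup>+\<omega>. \<integral>\<^sup>+x. cross_terms a (\<lambda>i. epowr (coef \<omega> i) \<beta> * copy
          (\<lambda>\<omega>. epowr (Y \<omega>) \<beta>) x i) \<partial>PiM UNIV (\<lambda>_. M) \<partial>M)"
    by (subst nn_integral_copies) (auto simp: epowr_mult epowr_copy)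
  also have "\<dots> \<le> (\<integral>\<^sup>+\<omega>. ennreal (cross_const a A) * epowr (\<Sum>i. epowr (coef \<omega> i) \<beta>) (1 + a) \<partial>M)"
    using Y1 Ya by (intro nn_integral_mono nn_integral_cross_terms_le a A) (auto simp: epowr_epowr)
  also have "\<dots> = ennreal (cross_const a A) * (\<integral>\<^sup>+\<omega>. epowr (\<Sum>i. epowr (coef \<omega> i) \<beta>) (1 + a) \<partial>M)"
    by (rule nn_integral_cmult) measurable
  finally show ?thesis .
qed

text \<open>As a function of \<open>b\<close> this is the contraction factor for moments of order
  \<open>b\<close> and, after a shift of the argument, the Laplace transform of the step
  distribution.\<close>

definition root_moment :: "real \<Rightarrow> ennreal" where
  "root_moment b = (\<integral>\<^sup>+\<omega>. sum_upto (N [] \<omega>) (\<lambda>i. epowr (ennreal (C [i] \<omega>)) b) \<partial>M)"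

lemma root_moment_eq: "root_moment b = (\<integral>\<^sup>+\<omega>. (\<Sum>i. if i = 0 then 0 else epowr (coef \<omega> i) b) \<partial>M)"
  unfolding root_moment_def by (subst sum_upto_coef[of "\<lambda>i c. epowr c b"]) auto

lemma nn_integral_copies_sum_powers:
  assumes [measurable]: "Y \<in> borel_measurable M"
  shows "(\<integral>\<^sup>+p. (\<Sum>i. epowr (coef (fst p) i * copy Y (snd p) i) b) \<partial>copies_space M)
    = (\<integral>\<^sup>+\<omega>. epowr (ennreal (Q [] \<omega>)) b \<partial>M) + root_moment b * (\<integral>\<^sup>+\<omega>. epowr (Y \<omega>) b \<partial>M)"
proof -
  let ?m = "\<integral>\<^sup>+\<omega>. epowr (Y \<omega>) b \<partial>M"
  have "(\<integral>\<^sup>+p. (\<Sum>i. epowr (coef (fst p) i * copy Y (snd p) i) b) \<partial>copies_space M)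
      = (\<integral>\<^sup>+\<omega>. \<integral>\<^sup>+x. (\<Sum>i. epowr (coef \<omega> i) b * copy (\<lambda>\<omega>. epowr (Y \<omega>) b) x i) \<partial>PiM UNIV (\<lambda>_. M) \<partial>M)"
    by (subst nn_integral_copies) (auto simp: epowr_mult epowr_copy)
  also have "\<dots> = (\<integral>\<^sup>+\<omega>. (\<Sum>i. if i = 0 then epowr (ennreal (Q [] \<omega>)) b
      else epowr (coef \<omega> i) b * ?m) \<partial>M)"
    by (intro nn_integral_cong, subst nn_integral_suminf, measurable)
       (auto intro!: arg_cong[where f = suminf] simp: nn_integral_cmult nn_integral_copy coef_def)
  also have "\<dots> = (\<integral>\<^sup>+\<omega>. epowr (ennreal (Q [] \<omega>)) b + (\<Sum>i. if i
      = 0 then 0 else epowr (coef \<omega> i) b) * ?m \<partial>M)"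
    by (intro nn_integral_cong, subst suminf_Suc_split, subst ennreal_suminf_multc[symmetric])
       (intro arg_cong2[where f = "(+)"] arg_cong[where f = suminf] ext refl, auto)
  also have "\<dots> = (\<integral>\<^sup>+\<omega>. epowr (ennreal (Q [] \<omega>)) b \<partial>M) + (\<integral>\<^sup>+\<omega>. (\<Sum>i. if i
      = 0 then 0 else epowr (coef \<omega> i) b) \<partial>M) * ?m"
    by (subst nn_integral_add, measurable, subst nn_integral_multc, measurable)
  finally show ?thesis unfolding root_moment_eq .
qed

lemma epowr_suminf_coef_le:
  assumes b: "1 \<le> p"
  shows "epowr (\<Sum>i. epowr (coef \<omega> i) \<beta>) p \<le> ennreal (2 powr p) *
    (epowr (ennreal (Q [] \<omega>)) (\<beta> * p) + epowr (sum_upto (N [] \<omega>)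
        (\<lambda>i. epowr (ennreal (C [i] \<omega>)) \<beta>)) p)"
proof -
  let ?q = "epowr (ennreal (Q [] \<omega>)) \<beta>" and ?s
      = "sum_upto (N [] \<omega>) (\<lambda>i. epowr (ennreal (C [i] \<omega>)) \<beta>)"
  have "(\<Sum>i. epowr (coef \<omega> i) \<beta>) = (\<Sum>i. if i = 0 then ?q else epowr (coef \<omega> i) \<beta>)"
    by (intro arg_cong[where f = suminf] ext) (auto simp: coef_def)
  also have "\<dots> = ?q + ?s"
    by (subst suminf_Suc_split, subst sum_upto_coef[of "\<lambda>i c. epowr c \<beta>"]) auto
  also have "\<dots> \<le> 2 * max ?q ?s" by (simp add: mult_2 add_mono)
  finally have "epowr (\<Sum>i. epowr (coef \<omega> i) \<beta>) p \<le> epowr (2 * max ?q ?s) p"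
    using b by (intro epowr_mono) auto
  also have "\<dots> = ennreal (2 powr p) * epowr (max ?q ?s) p"
    using epowr_ennreal[of 2 p] by (simp add: epowr_mult)
  also have "epowr (max ?q ?s) p \<le> epowr ?q p + epowr ?s p"
    by (auto simp: max_def add_increasing add_increasing2)
  also have "epowr ?q p = epowr (ennreal (Q [] \<omega>)) (\<beta> * p)" by (rule epowr_epowr)
  finally show ?thesis by (simp add: mult_left_mono)
qed

lemma root_moment_le_one_add:
  assumes "1 \<le> p"
  shows "root_moment \<beta> \<le> 1 + (\<integral>\<^sup>+\<omega>. epowr (sum_upto (N [] \<omega>)
      (\<lambda>i. epowr (ennreal (C [i] \<omega>)) \<beta>)) p \<partial>M)"
proof -
  have [measurable]: "(\<lambda>\<omega>. sum_upto (N [] \<omega>)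
      (\<lambda>i. epowr (ennreal (C [i] \<omega>)) \<beta>)) \<in> borel_measurable M"
    using measurable_root_C by (intro borel_measurable_sum_upto) auto
  have "root_moment \<beta> \<le> (\<integral>\<^sup>+\<omega>. 1 + epowr (sum_upto (N [] \<omega>)
      (\<lambda>i. epowr (ennreal (C [i] \<omega>)) \<beta>)) p \<partial>M)"
    unfolding root_moment_def using epowr_le_one_add[of 1 p] assms by (intro nn_integral_mono) simp
  also have "\<dots> = 1 + (\<integral>\<^sup>+\<omega>. epowr (sum_upto (N [] \<omega>) (\<lambda>i. epowr (ennreal (C [i] \<omega>)) \<beta>)) p \<partial>M)"
    using emeasure_space_1 by (subst nn_integral_add) auto
  finally show ?thesis .
qed

lemma epowr_moment_finite_mono:
  assumes "0 < b" "b \<le> a" "(\<integral>\<^sup>+\<omega>. epowr (Y \<omega>) a \<partial>M) < \<infinity>" and [measurable]: "Y \<in> borel_measurable M"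
  shows "(\<integral>\<^sup>+\<omega>. epowr (Y \<omega>) b \<partial>M) < \<infinity>"
proof -
  have "(\<integral>\<^sup>+\<omega>. epowr (Y \<omega>) b \<partial>M) \<le> (\<integral>\<^sup>+\<omega>. 1 + epowr (Y \<omega>) a \<partial>M)"
    using assms by (intro nn_integral_mono epowr_le_one_add) auto
  also have "\<dots> < \<infinity>" using assms emeasure_space_1 by (subst nn_integral_add) auto
  finally show ?thesis .
qed

lemma coef_total_moment_finite:
  assumes p: "1 \<le> p" and Q: "(\<integral>\<^sup>+\<omega>. epowr (ennreal (Q [] \<omega>)) (\<beta> * p) \<partial>M) < \<infinity>"
    and C: "(\<integral>\<^sup>+\<omega>. epowr (sum_upto (N [] \<omega>) (\<lambda>i. epowr (ennreal (C [i] \<omega>)) \<beta>)) p \<partial>M) < \<infinity>"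
  shows "(\<integral>\<^sup>+\<omega>. epowr (\<Sum>i. epowr (coef \<omega> i) \<beta>) p \<partial>M) < \<infinity>"
proof -
  have [measurable]: "(\<lambda>\<omega>. sum_upto (N [] \<omega>)
      (\<lambda>i. epowr (ennreal (C [i] \<omega>)) \<beta>)) \<in> borel_measurable M"
    using measurable_root_C by (intro borel_measurable_sum_upto) auto
  have "(\<integral>\<^sup>+\<omega>. epowr (\<Sum>i. epowr (coef \<omega> i) \<beta>) p \<partial>M) \<le> (\<integral>\<^sup>+\<omega>. ennreal (2 powr p) *
    (epowr (ennreal (Q [] \<omega>)) (\<beta> * p) + epowr (sum_upto (N [] \<omega>)
        (\<lambda>i. epowr (ennreal (C [i] \<omega>)) \<beta>)) p) \<partial>M)"
    using p by (intro nn_integral_mono epowr_suminf_coef_le) simp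
  also have "\<dots> = ennreal (2 powr p) * ((\<integral>\<^sup>+\<omega>. epowr (ennreal (Q [] \<omega>)) (\<beta> * p) \<partial>M) +
      (\<integral>\<^sup>+\<omega>. epowr (sum_upto (N [] \<omega>) (\<lambda>i. epowr (ennreal (C [i] \<omega>)) \<beta>)) p \<partial>M))"
    by (subst nn_integral_cmult, measurable, subst nn_integral_add, measurable)
  also have "\<dots> < \<infinity>" using Q C by (simp add: ennreal_mult_less_top)
  finally show ?thesis .
qed

lemma tree_partial_0: "tree_partial Q N C 0 \<omega> = 0"
  by (simp add: tree_partial_def)

lemma tree_partial_le_tree_R: "tree_partial Q N C n \<omega> \<le> tree_R Q N C \<omega>"
  unfolding tree_R_eq_SUP by (rule SUP_upper) simp

lemma nn_integral_tree_partial_Suc: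
  assumes [measurable]: "f \<in> borel_measurable borel"
  shows "(\<integral>\<^sup>+\<omega>. f (tree_partial Q N C (Suc n) \<omega>) \<partial>M)
      = (\<integral>\<^sup>+p. f (smoothing (tree_partial Q N C n) p) \<partial>copies_space M)"
proof -
  have "(\<integral>\<^sup>+\<omega>. f (tree_partial Q N C (Suc n) \<omega>) \<partial>M)
      = (\<integral>\<^sup>+x. f x \<partial>distr M borel (tree_partial Q N C (Suc n)))"
    by (simp add: nn_integral_distr)
  also have "\<dots> = (\<integral>\<^sup>+p. f (smoothing (tree_partial Q N C n) p) \<partial>copies_space M)"
    unfolding distr_tree_partial_Suc by (simp add: nn_integral_distr)
  finally show ?thesis .
qed

text \<open>The power commutes with the increasing limit because the power \<open>1 / b\<close> is a
  monotone inverse; monotone convergence does the rest.\<close>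

lemma nn_integral_epowr_tree_R:
  assumes b: "0 < b"
  shows "(\<integral>\<^sup>+\<omega>. epowr (tree_R Q N C \<omega>) b \<partial>M) = (SUP n. \<integral>\<^sup>+\<omega>. epowr (tree_partial Q N C n \<omega>) b \<partial>M)"
proof -
  have "epowr (tree_R Q N C \<omega>) b = (SUP n. epowr (tree_partial Q N C n \<omega>) b)" for \<omega>
  proof (rule antisym)
    define s where "s = (SUP n. epowr (tree_partial Q N C n \<omega>) b)"
    have "tree_partial Q N C n \<omega> \<le> epowr s (1 / b)" for n
    proof -
      have "tree_partial Q N C n \<omega> = epowr (epowr (tree_partial Q N C n \<omega>) b) (1 / b)"
        using b by (simp add: epowr_epowr)
      also have "\<dots> \<le> epowr s (1 / b)" unfolding s_def using b by (intro epowr_mono SUP_upper) auto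
      finally show ?thesis .
    qed
    then have "tree_R Q N C \<omega> \<le> epowr s (1 / b)" unfolding tree_R_eq_SUP by (rule SUP_least)
    then have "epowr (tree_R Q N C \<omega>) b \<le> epowr (epowr s (1 / b)) b" using b
        by (intro epowr_mono) auto
    then show "epowr (tree_R Q N C \<omega>) b \<le> (SUP n. epowr (tree_partial Q N C n \<omega>) b)"
      using b by (simp add: epowr_epowr s_def)
    show "(SUP n. epowr (tree_partial Q N C n \<omega>) b) \<le> epowr (tree_R Q N C \<omega>) b"
      using b by (intro SUP_least epowr_mono tree_partial_le_tree_R) simp
  qed
  then show ?thesis
    using b by (simp only:) (intro nn_integral_monotone_convergence_SUP, auto simp: incseq_def
        le_fun_def intro!: epowr_mono tree_partial_mono)
qed

text \<open>Along the partial sums the moment satisfies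
  \<open>e (n + 1) \<le> B' + root_moment b * e n\<close> and starts at 0, so a factor below 1 gives
  a uniform bound. For \<open>b > 1\<close> the constant contains the mixed products, which call for
  moments of \<open>R\<close> of order 1 and, for \<open>b > 2\<close>, of order
  \<open>b - 1\<close>.\<close>

lemma moment_finite:
  assumes b: "0 < b" and \<rho>: "root_moment b < 1"
    and Qb: "(\<integral>\<^sup>+\<omega>. epowr (ennreal (Q [] \<omega>)) b \<partial>M) < \<infinity>"
    and gt1: "1 < b \<Longrightarrow> (\<integral>\<^sup>+\<omega>. tree_R Q N C \<omega> \<partial>M) < \<infinity>"
    and gt2: "2 < b \<Longrightarrow> (\<integral>\<^sup>+\<omega>. epowr (tree_R Q N C \<omega>) (b - 1) \<partial>M) < \<infinity>"
    and Cb: "1 < b \<Longrightarrow> (\<integral>\<^sup>+\<omega>. epowr (\<Sum>i. coef \<omega> i) b \<partial>M) < \<infinity>"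
  shows "(\<integral>\<^sup>+\<omega>. epowr (tree_R Q N C \<omega>) b \<partial>M) < \<infinity>"
proof -
  let ?e = "\<lambda>n. \<integral>\<^sup>+\<omega>. epowr (tree_partial Q N C n \<omega>) b \<partial>M"
  have "\<exists>B<\<infinity>. \<forall>n. ?e (Suc n) \<le> B + root_moment b * ?e n"
  proof (cases "1 < b")
    case False
    have "?e (Suc n) \<le> (\<integral>\<^sup>+\<omega>. epowr (ennreal (Q [] \<omega>)) b \<partial>M) + root_moment b * ?e n" for n
    proof -
      have "?e (Suc n) = (\<integral>\<^sup>+p. epowr (smoothing (tree_partial Q N C n) p) b \<partial>copies_space M)"
        by (rule nn_integral_tree_partial_Suc) measurable
      also have "\<dots> \<le> (\<integral>\<^sup>+p. (\<Sum>i. epowr (coef (fst p) i * copy (tree_partial Q N C n) (snd p) i) b)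
          \<partial>copies_space M)"
        unfolding smoothing_eq using b False by (intro nn_integral_mono epowr_suminf_le) auto
      finally show ?thesis unfolding nn_integral_copies_sum_powers[OF measurable_tree_partial] .
    qed
    then show ?thesis using Qb by blast
  next
    case True
    define m1 m2 where "m1 = (\<integral>\<^sup>+\<omega>. tree_R Q N C \<omega> \<partial>M)" and "m2
        = (\<integral>\<^sup>+\<omega>. epowr (tree_R Q N C \<omega>) (b - 1) \<partial>M)"
    \<comment> \<open>At least 1, as the estimate of the mixed products requires, and above each of
      the two moments whenever it is finite.\<close>
    define A where "A = 1 + enn2real m1 + enn2real m2"
    have A: "1 \<le> A" unfolding A_def by simp
    have m1: "m1 \<le> ennreal A"
    proof -
      have "m1 = ennreal (enn2real m1)" using gt1[OF True] by (simp add: m1_def)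
      also have "\<dots> \<le> ennreal A" unfolding A_def by (intro ennreal_leI) simp
      finally show ?thesis .
    qed
    have m2: "m2 \<le> ennreal A" if "2 < b"
    proof -
      have "m2 = ennreal (enn2real m2)" using gt2[OF that] by (simp add: m2_def)
      also have "\<dots> \<le> ennreal A" unfolding A_def by (intro ennreal_leI) simp
      finally show ?thesis .
    qed
    define B where "B = (\<integral>\<^sup>+\<omega>. epowr (ennreal (Q [] \<omega>)) b \<partial>M) +
      ennreal (power_const (b - 1)) * (ennreal (cross_const (b - 1) A) * (\<integral>\<^sup>+\<omega>. epowr
          (\<Sum>i. coef \<omega> i) b \<partial>M))"
    have "B < \<infinity>" unfolding B_def using Qb Cb[OF True] by (simp add: ennreal_mult_less_top)
    moreover have "?e (Suc n) \<le> B + root_moment b * ?e n" for n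
    proof -
      let ?Y = "tree_partial Q N C n"
      have "?e (Suc n) = (\<integral>\<^sup>+p. epowr (smoothing ?Y p) b \<partial>copies_space M)"
        by (rule nn_integral_tree_partial_Suc) measurable
      also have "\<dots> \<le> (\<integral>\<^sup>+p. (\<Sum>i. epowr (coef (fst p) i * copy ?Y (snd p) i) b) +
          ennreal (power_const (b - 1)) * cross_terms (b - 1)
              (\<lambda>i. coef (fst p) i * copy ?Y (snd p) i) \<partial>copies_space M)"
        unfolding smoothing_eq by (intro nn_integral_mono epowr_suminf_le_cross_terms True)
      also have "\<dots> = (\<integral>\<^sup>+p. (\<Sum>i. epowr (coef (fst p) i * copy ?Y (snd p) i) b) \<partial>copies_space M) +
          ennreal (power_const (b - 1)) * (\<integral>\<^sup>+p. cross_terms (b - 1)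
              (\<lambda>i. coef (fst p) i * copy ?Y (snd p) i) \<partial>copies_space M)"
        by (subst nn_integral_cmult[symmetric], measurable, rule nn_integral_add, measurable)
      also have "\<dots> \<le> (\<integral>\<^sup>+\<omega>. epowr (ennreal (Q [] \<omega>)) b \<partial>M) + root_moment b * ?e n +
        ennreal (power_const (b - 1)) * (ennreal (cross_const (b - 1) A) * (\<integral>\<^sup>+\<omega>. epowr
            (\<Sum>i. coef \<omega> i) b \<partial>M))"
      proof (intro add_mono mult_left_mono)
        have 1: "(\<integral>\<^sup>+\<omega>. epowr (?Y \<omega>) 1 \<partial>M) \<le> ennreal A"
          using nn_integral_mono[of M ?Y "tree_R Q N C"] m1 tree_partial_le_tree_R
              unfolding m1_def by (auto intro: order_trans)
        have 2: "(\<integral>\<^sup>+\<omega>. epowr (?Y \<omega>) (1 * (b - 1)) \<partial>M) \<le> ennreal A" if "1 < b - 1"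
        proof -
          have "(\<integral>\<^sup>+\<omega>. epowr (?Y \<omega>) (1 * (b - 1)) \<partial>M) \<le> m2"
            unfolding m2_def using that by (intro nn_integral_mono) (auto intro!: epowr_mono
                tree_partial_le_tree_R)
          also have "m2 \<le> ennreal A" using that by (intro m2) simp
          finally show ?thesis .
        qed
        show "(\<integral>\<^sup>+p. cross_terms (b - 1) (\<lambda>i. coef (fst p) i * copy ?Y (snd p) i) \<partial>copies_space M)
            \<le> ennreal (cross_const (b - 1) A) * (\<integral>\<^sup>+\<omega>. epowr (\<Sum>i. coef \<omega> i) b \<partial>M)"
          using nn_integral_copies_cross_terms_le[OF measurable_tree_partial _ A 1 2] True by simp
      qed (auto simp: nn_integral_copies_sum_powers)
      finally show ?thesis unfolding B_def by (simp add: add_ac)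
    qed
    ultimately show ?thesis by blast
  qed
  then obtain B' where B': "B' < \<infinity>" "\<And>n. ?e (Suc n) \<le> B' + root_moment b * ?e n" by blast
  obtain B where B: "B' = ennreal B" "0 \<le> B" using B'(1) by (cases B') auto
  obtain \<rho>' where \<rho>': "root_moment b = ennreal \<rho>'" "0 \<le> \<rho>'" using \<rho> by (cases "root_moment b") auto
  then have \<rho>'1: "\<rho>' < 1" using \<rho> by simp
  \<comment> \<open>The fixed point of the map that sends \<open>x\<close> to
    \<open>B + \<rho>' * x\<close>; by monotonicity the recursion never leaves the interval below
    it.\<close>
  define L where "L = B / (1 - \<rho>')"
  have L: "0 \<le> L" "B + \<rho>' * L = L" unfolding L_def using B \<rho>'1 by (auto simp: field_simps)
  have "?e n \<le> ennreal L" for n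
  proof (induction n)
    case (Suc n)
    have "?e (Suc n) \<le> ennreal B + ennreal \<rho>' * ?e n" using B'(2)[of n] B \<rho>' by simp
    also have "\<dots> \<le> ennreal B + ennreal \<rho>' * ennreal L"
        by (intro add_left_mono mult_left_mono Suc) simp
    also have "\<dots> = ennreal L" using B \<rho>' L by (simp flip: ennreal_mult ennreal_plus)
    finally show ?case .
  qed (simp add: tree_partial_0)
  then have "(SUP n. ?e n) \<le> ennreal L" by (rule SUP_least)
  then show ?thesis
    unfolding nn_integral_epowr_tree_R[OF b] by (rule order.strict_trans1) simp
qed

end

section \<open>Integrability of the tail difference\<close>

text \<open>Here \<open>q\<close> will be the exceedance of \<open>Q\<close>, which is the summand
  of index 0 in the total but does not belong to the count of children.\<close>

lemma edist_diff_add_le: "edist_diff x y \<le> edist_diff x (q + y) + q"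
proof (cases "q = top")
  case False
  have 1: "x - y \<le> (x - (q + y)) + q"
  proof -
    have "x \<le> (x - (q + y)) + (q + y)" by (cases "q + y
        \<le> x") (auto simp: diff_add_cancel_ennreal not_le less_imp_le intro: add_increasing)
    then have "x \<le> y + ((x - (q + y)) + q)" by (simp add: add_ac)
    then show ?thesis by (simp add: ennreal_minus_le_iff add_ac)
  qed
  have 2: "y - x \<le> (q + y) - x" by (intro ennreal_minus_mono) (auto simp: add_increasing)
  show ?thesis unfolding edist_diff_def using add_mono[OF 1 2] by (simp add: add_ac)
qed simp

text \<open>
  The two cases of the theorem are unified by \<open>\<alpha> = \<beta> p\<close>: for \<open>\<alpha> > 1\<close> take \<open>\<beta> = 1\<close>, \<open>p = \<alpha>\<close>, and for
  \<open>\<alpha> \<le> 1\<close> take \<open>\<beta> = \<alpha> / (1 + \<epsilon>)\<close>, \<open>p = 1 + \<epsilon>\<close>.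
\<close>

locale tree_renewal = weighted_branching_tree M Q N C
  for M :: "'w measure" and Q :: "nat list \<Rightarrow> 'w \<Rightarrow> real" and N :: "nat list \<Rightarrow> 'w \<Rightarrow> enat"
    and C :: "nat list \<Rightarrow> 'w \<Rightarrow> real" +
  fixes \<alpha> \<beta> p :: real
  assumes \<beta>: "0 < \<beta>" "\<beta> \<le> 1" and p: "1 < p" and \<alpha>_eq: "\<alpha> = \<beta> * p"
    and Q_\<alpha>: "(\<integral>\<^sup>+\<omega>. epowr (ennreal (Q [] \<omega>)) \<alpha> \<partial>M) < \<infinity>"
    and root_\<alpha>: "root_moment \<alpha> = 1"
    and coef_moment: "(\<integral>\<^sup>+\<omega>. epowr (sum_upto (N [] \<omega>) (\<lambda>i. epowr (ennreal (C [i] \<omega>)) \<beta>)) p \<partial>M) < \<infinity>"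
    and R_\<beta>: "(\<integral>\<^sup>+\<omega>. epowr (tree_R Q N C \<omega>) \<beta> \<partial>M) < \<infinity>"
    and R_\<beta>': "2 < p \<Longrightarrow> (\<integral>\<^sup>+\<omega>. epowr (tree_R Q N C \<omega>) (\<beta> * (p - 1)) \<partial>M) < \<infinity>"
begin

lemma \<alpha>_pos: "0 < \<alpha>"
  using \<beta> p by (simp add: \<alpha>_eq)

lemma root_moment_\<beta>: "root_moment \<beta> < \<infinity>"
  using root_moment_le_one_add[of p \<beta>] coef_moment p by (simp add: order.strict_trans1)

lemma Q_\<beta>: "(\<integral>\<^sup>+\<omega>. epowr (ennreal (Q [] \<omega>)) \<beta> \<partial>M) < \<infinity>"
proof (rule epowr_moment_finite_mono[OF _ _ Q_\<alpha>])
  show "\<beta> \<le> \<alpha>" using \<beta> p by (simp add: \<alpha>_eq)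
qed (use \<beta> in auto)

section \<open>The summands of the distributional equation\<close>

definition child :: "'w \<times> (nat \<Rightarrow> 'w) \<Rightarrow> nat \<Rightarrow> ennreal" where
  "child q i = coef (fst q) i * copy (tree_R Q N C) (snd q) i"

lemma measurable_child [measurable]: "(\<lambda>q. child q i) \<in> borel_measurable (copies_space M)"
  unfolding child_def by measurable

lemma child_0: "child q 0 = ennreal (Q [] (fst q))"
  by (simp add: child_def coef_def copy_def)

definition total :: "'w \<times> (nat \<Rightarrow> 'w) \<Rightarrow> ennreal" where
  "total q = (\<Sum>i. child q i)"

lemma measurable_total [measurable]: "total \<in> borel_measurable (copies_space M)"
  unfolding total_def[abs_def] by measurable

lemma total_eq_smoothing: "(total :: 'w \<times> (nat \<Rightarrow> 'w) \<Rightarrow> ennreal) = smoothing (tree_R Q N C)"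
  by (rule ext) (simp add: total_def smoothing_eq child_def)

lemma power_of_sum_eq: "power_of_sum Q N C a q = epowr (total q) a"
  unfolding power_of_sum_def total_eq_smoothing smoothing_def ..

lemma sum_upto_child:
  fixes f :: "ennreal \<Rightarrow> ennreal"
  assumes "f 0 = 0"
  shows "sum_upto (N [] (fst q)) (\<lambda>i. f (ennreal (C [i] (fst q)) * tree_R Q N C (snd q i)))
      = (\<Sum>i. if i = 0 then 0 else f (child q i))"
  unfolding sum_upto_eq_suminf
  by (intro arg_cong[where f = suminf] ext) (auto simp: child_def coef_def copy_def assms)

lemma sum_of_powers_eq: "sum_of_powers Q N C a q = (\<Sum>i. if i = 0 then 0 else epowr (child q i) a)"
  unfolding sum_of_powers_def by (rule sum_upto_child) simp

lemma suminf_child_split: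
  fixes f :: "ennreal \<Rightarrow> ennreal"
  shows "(\<Sum>i. f (child q i)) = f (ennreal (Q [] (fst q))) + (\<Sum>i. if i
      = 0 then 0 else f (child q i))"
  using suminf_Suc_split[of "f (ennreal (Q [] (fst q)))" "\<lambda>i. f (child q i)"]
  by (simp add: child_0[symmetric] cong: if_cong) (smt (verit) suminf_cong)

text \<open>Index 0 is left out: \<open>Q\<close> enters \<open>total\<close>, but the tail
  difference compares with the exceedances of the children only.\<close>

definition count :: "real \<Rightarrow> 'w \<times> (nat \<Rightarrow> 'w) \<Rightarrow> ennreal" where
  "count v q = (\<Sum>i. if i = 0 then 0 else of_bool (ennreal v < child q i))"

lemma measurable_count_pair [measurable]:
  "(\<lambda>x. count (snd x) (fst x)) \<in> borel_measurable (copies_space M \<Otimes>\<^sub>M borel)"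
  unfolding count_def by measurable

lemma measurable_count [measurable]: "count v \<in> borel_measurable (copies_space M)"
  unfolding count_def[abs_def] by measurable

lemma nn_integral_copies_fst:
  assumes [measurable]: "f \<in> borel_measurable M"
  shows "(\<integral>\<^sup>+q. f (fst q) \<partial>copies_space M) = (\<integral>\<^sup>+\<omega>. f \<omega> \<partial>M)"
proof -
  interpret P: prob_space "PiM (UNIV :: nat set) (\<lambda>_. M)"
      by (rule prob_space_PiM) (rule prob_space_axioms)
  show ?thesis by (subst nn_integral_copies) (auto simp: P.emeasure_space_1)
qed

lemma coef_total_moment: "(\<integral>\<^sup>+\<omega>. epowr (\<Sum>i. epowr (coef \<omega> i) \<beta>) p \<partial>M) < \<infinity>"
  using coef_total_moment_finite[of p \<beta>] Q_\<alpha> coef_moment p by (simp add: \<alpha>_eq)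

text \<open>Moments of order \<open>\<beta>\<close> are finite, and they give summability at almost
  every sample point. Pathwise finiteness of the quantities of order \<open>\<alpha>\<close> follows
  from it, although their expectations may be infinite.\<close>

lemma AE_suminf_child_finite: "AE q in copies_space M. (\<Sum>i. epowr (child q i) \<beta>) < \<infinity>"
proof -
  have "(\<integral>\<^sup>+q. (\<Sum>i. epowr (child q i) \<beta>) \<partial>copies_space M) = (\<integral>\<^sup>+\<omega>. epowr (ennreal (Q [] \<omega>)) \<beta> \<partial>M) +
      root_moment \<beta> * (\<integral>\<^sup>+\<omega>. epowr (tree_R Q N C \<omega>) \<beta> \<partial>M)"
    unfolding child_def by (rule nn_integral_copies_sum_powers) measurable
  then have "(\<integral>\<^sup>+q. (\<Sum>i. epowr (child q i) \<beta>) \<partial>copies_space M) < \<infinity>"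
    using root_moment_\<beta> R_\<beta> Q_\<beta> by (simp add: ennreal_mult_less_top)
  then have "AE q in copies_space M. (\<Sum>i. epowr (child q i) \<beta>) \<noteq> \<infinity>"
    by (intro nn_integral_noteq_infinite) auto
  then show ?thesis by (simp add: less_top)
qed

lemma AE_finite: "AE q in copies_space M. epowr (total q) \<alpha> < \<infinity> \<and> (\<Sum>i. epowr (child q i) \<alpha>) < \<infinity>"
  using AE_suminf_child_finite
proof eventually_elim
  case (elim q)
  show ?case
    using nn_integral_edist_diff_count_le(2,3)[OF \<beta> p refl elim] unfolding \<alpha>_eq total_def by simp
qed

lemma power_of_sum_finite:
  "AE q in copies_space M. power_of_sum Q N C \<alpha> q < \<infinity> \<and> sum_of_powers Q N C \<alpha> q < \<infinity>"
  using AE_finite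
proof eventually_elim
  case (elim q)
  have "sum_of_powers Q N C \<alpha> q \<le> (\<Sum>i. epowr (child q i) \<alpha>)"
    unfolding sum_of_powers_eq by (intro suminf_le) auto
  then show ?case using elim by (simp add: power_of_sum_eq order.strict_trans1)
qed

lemma cross_terms_finite: "(\<integral>\<^sup>+q. cross_terms (p - 1)
    (\<lambda>i. epowr (child q i) \<beta>) \<partial>copies_space M) < \<infinity>"
proof -
  define m1 m2 where "m1 = (\<integral>\<^sup>+\<omega>. epowr (tree_R Q N C \<omega>) \<beta> \<partial>M)"
    and "m2 = (\<integral>\<^sup>+\<omega>. epowr (tree_R Q N C \<omega>) (\<beta> * (p - 1)) \<partial>M)"
  define A where "A = 1 + enn2real m1 + enn2real m2"
  have A: "1 \<le> A" unfolding A_def by simp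
  have m1: "m1 \<le> ennreal A"
  proof -
    have "m1 = ennreal (enn2real m1)" using R_\<beta> by (simp add: m1_def)
    also have "\<dots> \<le> ennreal A" unfolding A_def by (intro ennreal_leI) simp
    finally show ?thesis .
  qed
  have m2: "m2 \<le> ennreal A" if "1 < p - 1"
  proof -
    have "m2 = ennreal (enn2real m2)" using R_\<beta>' that by (simp add: m2_def)
    also have "\<dots> \<le> ennreal A" unfolding A_def by (intro ennreal_leI) simp
    finally show ?thesis .
  qed
  have "(\<integral>\<^sup>+q. cross_terms (p - 1) (\<lambda>i. epowr (child q i) \<beta>) \<partial>copies_space M)
      \<le> ennreal (cross_const (p - 1) A) * (\<integral>\<^sup>+\<omega>. epowr (\<Sum>i. epowr (coef \<omega> i) \<beta>) (1 + (p - 1)) \<partial>M)"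
    unfolding child_def using p A m1 m2
    by (intro nn_integral_copies_cross_terms_le) (auto simp: m1_def m2_def)
  also have "\<dots> < \<infinity>" using coef_total_moment by (simp add: ennreal_mult_less_top)
  finally show ?thesis .
qed

text \<open>The pathwise estimate applies to the full count, with index 0 included; taking
  \<open>Q\<close> out of the count costs the moment of \<open>Q\<close> of order
  \<open>\<alpha>\<close>. The mixed products are integrable by
  \<open>cross_terms_finite\<close>.\<close>

lemma total_variation_finite:
  "(\<integral>\<^sup>+q. \<integral>\<^sup>+v. ennreal (\<alpha> * v powr (\<alpha> - 1)) *
      (if 0 < v then edist_diff (of_bool (ennreal v < total q)) (count v q)
          else 0) \<partial>lborel \<partial>copies_space M) < \<infinity>"
proof -
  have "(\<integral>\<^sup>+q. \<integral>\<^sup>+v. ennreal (\<alpha> * v powr (\<alpha> - 1)) *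
      (if 0 < v then edist_diff (of_bool (ennreal v < total q)) (count v q)
          else 0) \<partial>lborel \<partial>copies_space M)
    \<le> (\<integral>\<^sup>+q. ennreal (power_const (p - 1) + 2) * cross_terms (p - 1) (\<lambda>i. epowr (child q i) \<beta>) +
        epowr (ennreal (Q [] (fst q))) \<alpha> \<partial>copies_space M)"
  proof (rule nn_integral_mono_AE)
    show "AE q in copies_space M. (\<integral>\<^sup>+v. ennreal (\<alpha> * v powr (\<alpha> - 1)) *
      (if 0 < v then edist_diff (of_bool (ennreal v < total q)) (count v q) else 0) \<partial>lborel) \<le>
      ennreal (power_const (p - 1) + 2) * cross_terms (p - 1) (\<lambda>i. epowr (child q i) \<beta>)
          + epowr (ennreal (Q [] (fst q))) \<alpha>"
      using AE_suminf_child_finite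
    proof eventually_elim
      case (elim q)
      let ?q = "ennreal (Q [] (fst q))"
      have "(\<integral>\<^sup>+v. ennreal (\<alpha> * v powr (\<alpha> - 1)) *
          (if 0 < v then edist_diff (of_bool (ennreal v < total q)) (count v q) else 0) \<partial>lborel)
        \<le> (\<integral>\<^sup>+v. ennreal (\<alpha> * v powr (\<alpha> - 1)) * (if 0 < v then edist_diff (of_bool (ennreal v <
            (\<Sum>i. child q i))) (\<Sum>i. of_bool (ennreal v < child q i)) else 0) +
            ennreal (\<alpha> * v powr (\<alpha> - 1)) * (if 0 < v \<and> ennreal v < ?q then 1 else 0) \<partial>lborel)"
      proof (rule nn_integral_mono)
        fix v :: real
        have "edist_diff (of_bool (ennreal v < total q)) (count v q) \<le>
            edist_diff (of_bool (ennreal v < (\<Sum>i. child q i)))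
                (\<Sum>i. of_bool (ennreal v < child q i)) + of_bool (ennreal v < ?q)"
          using edist_diff_add_le[of "of_bool (ennreal v < total q)" "count v q" "of_bool (ennreal
              v < ?q)"]
            suminf_child_split[of "\<lambda>x. of_bool (ennreal v < x)" q]
          by (simp add: count_def total_def)
        then have "ennreal (\<alpha> * v powr (\<alpha> - 1)) * edist_diff (of_bool (ennreal v < total q)) (count
            v q) \<le>
            ennreal (\<alpha> * v powr (\<alpha> - 1)) * (edist_diff (of_bool (ennreal v < (\<Sum>i. child q i)))
                (\<Sum>i. of_bool (ennreal v < child q i)) + of_bool (ennreal v < ?q))"
          by (rule mult_left_mono) simp
        then show "ennreal (\<alpha> * v powr (\<alpha> - 1)) *
            (if 0 < v then edist_diff (of_bool (ennreal v < total q)) (count v q) else 0)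
          \<le> ennreal (\<alpha> * v powr (\<alpha> - 1)) * (if 0 < v then edist_diff (of_bool (ennreal v <
              (\<Sum>i. child q i))) (\<Sum>i. of_bool (ennreal v < child q i)) else 0) +
            ennreal (\<alpha> * v powr (\<alpha> - 1)) * (if 0 < v \<and> ennreal v < ?q then 1 else 0)"
          by (cases "0 < v") (auto simp: distrib_left of_bool_def)
      qed
      also have "\<dots> = (\<integral>\<^sup>+v. ennreal (\<alpha> * v powr (\<alpha> - 1)) *
          (if 0 < v then edist_diff (of_bool (ennreal v < (\<Sum>i. child q i)))
          (\<Sum>i. of_bool (ennreal v < child q i)) else 0) \<partial>lborel)
          + (\<integral>\<^sup>+v. ennreal (\<alpha> * v powr (\<alpha> - 1)) * (if 0 < v
              \<and> ennreal v < ?q then 1 else 0) \<partial>lborel)"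
        by (rule nn_integral_add) measurable
      also have "(\<integral>\<^sup>+v. ennreal (\<alpha> * v powr (\<alpha> - 1)) * (if 0 < v
          \<and> ennreal v < ?q then 1 else 0) \<partial>lborel) = epowr ?q \<alpha>"
        by (rule nn_integral_layer_cake[OF \<alpha>_pos])
      also have "(\<integral>\<^sup>+v. ennreal (\<alpha> * v powr (\<alpha> - 1)) *
          (if 0 < v then edist_diff (of_bool (ennreal v < (\<Sum>i. child q i)))
          (\<Sum>i. of_bool (ennreal v < child q i)) else 0) \<partial>lborel)
          \<le> ennreal (power_const (p - 1) + 2) * cross_terms (p - 1) (\<lambda>i. epowr (child q i) \<beta>)"
        unfolding \<alpha>_eq by (rule nn_integral_edist_diff_count_le(1)[OF \<beta> p refl elim])
      finally show ?case by (simp add: add_right_mono)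
    qed
  qed
  also have "\<dots> = ennreal (power_const (p - 1)
      + 2) * (\<integral>\<^sup>+q. cross_terms (p - 1) (\<lambda>i. epowr (child q i) \<beta>) \<partial>copies_space M) +
      (\<integral>\<^sup>+\<omega>. epowr (ennreal (Q [] \<omega>)) \<alpha> \<partial>M)"
    by (subst nn_integral_add, measurable, subst nn_integral_cmult, measurable, subst
        nn_integral_copies_fst, measurable)
  also have "\<dots> < \<infinity>" using cross_terms_finite Q_\<alpha> by (simp add: ennreal_mult_less_top)
  finally show ?thesis .
qed

text \<open>One side uses a single \<open>R\<close> for all children, the other a separate copy for
  each. The expectation of a sum sees every term alone, so only the joint law of each coefficient
  with its copy matters.\<close>

lemma expected_exceedances_eq: "expected_exceedances M Q N C v = (\<integral>\<^sup>+q. count v q \<partial>copies_space M)"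
proof -
  let ?P = "PiM (UNIV :: nat set) (\<lambda>_. M)"
  interpret P: prob_space ?P by (rule prob_space_PiM) (rule prob_space_axioms)
  have "expected_exceedances M Q N C v = (\<integral>\<^sup>+q. (\<Sum>i. if i
      = 0 then 0 else of_bool (ennreal v < coef (fst q) i * tree_R Q N C (snd q))) \<partial>(M \<Otimes>\<^sub>M M))"
    unfolding expected_exceedances_def
  proof (intro nn_integral_cong)
    fix x :: "'w \<times> 'w"
    show "sum_upto (N [] (fst x)) (\<lambda>i. of_bool (ennreal v < ennreal (C [i] (fst x)) * tree_R Q N C
        (snd x))) =
      (\<Sum>i. if i = 0 then 0 else of_bool (ennreal v < coef (fst x) i * tree_R Q N C (snd x)) ::
          ennreal)"
      by (rule sum_upto_coef[of "\<lambda>i c. of_bool (ennreal v < c * tree_R Q N C (snd x))"]) simp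
  qed
  also have "\<dots> = (\<integral>\<^sup>+\<omega>. \<integral>\<^sup>+\<omega>'. (\<Sum>i. if i
      = 0 then 0 else of_bool (ennreal v < coef \<omega> i * tree_R Q N C \<omega>')) \<partial>M \<partial>M)"
    by (subst nn_integral_fst[symmetric], measurable) (simp cong: if_cong)
  also have "\<dots> = (\<integral>\<^sup>+\<omega>. (\<Sum>i. if i = 0 then 0
      else \<integral>\<^sup>+\<omega>'. of_bool (ennreal v < coef \<omega> i * tree_R Q N C \<omega>') \<partial>M) \<partial>M)"
    by (intro nn_integral_cong, subst nn_integral_suminf, measurable) (auto intro!: arg_cong[where
        f = suminf])
  also have "\<dots> = (\<integral>\<^sup>+\<omega>. (\<Sum>i. if i = 0 then 0
      else \<integral>\<^sup>+x. of_bool (ennreal v < coef \<omega> i * tree_R Q N C (x i)) \<partial>?P) \<partial>M)"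
  proof -
    have "(\<integral>\<^sup>+x. of_bool (ennreal v < coef \<omega> i * tree_R Q N C (x i)) \<partial>?P)
        = (\<integral>\<^sup>+\<omega>'. of_bool (ennreal v < coef \<omega> i * tree_R Q N C \<omega>') \<partial>M)" for \<omega> i
      by (rule nn_integral_PiM_coordinate) measurable
    then show ?thesis by (simp cong: if_cong)
  qed
  also have "\<dots> = (\<integral>\<^sup>+\<omega>. \<integral>\<^sup>+x. count v (\<omega>, x) \<partial>?P \<partial>M)"
    unfolding count_def child_def
    by (intro nn_integral_cong, subst nn_integral_suminf, measurable)
       (auto intro!: arg_cong[where f = suminf] simp: copy_def)
  also have "\<dots> = (\<integral>\<^sup>+q. count v q \<partial>copies_space M)"
    by (rule nn_integral_copies[symmetric]) measurable
  finally show ?thesis .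
qed

text \<open>The pointwise form of Markov's inequality.\<close>

lemma (in -) of_bool_less_le_epowr:
  assumes "0 < v" "0 \<le> b"
  shows "of_bool (ennreal v < x) \<le> ennreal (v powr - b) * epowr x b"
proof (cases "ennreal v < x")
  case True
  have "1 = ennreal (v powr - b) * epowr (ennreal v) b"
    using assms by (simp add: epowr_ennreal ennreal_mult[symmetric] powr_minus)
  also have "\<dots> \<le> ennreal (v powr - b) * epowr x b"
    using assms True by (intro mult_left_mono epowr_mono) auto
  finally show ?thesis using True by simp
qed simp

lemma expected_exceedances_finite:
  assumes v: "0 < v"
  shows "expected_exceedances M Q N C v < \<infinity>"
proof -
  have "expected_exceedances M Q N C v \<le> (\<integral>\<^sup>+q. ennreal (v powr - \<beta>) * (\<Sum>i. if i
      = 0 then 0 else epowr (child q i) \<beta>) \<partial>copies_space M)"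
    unfolding expected_exceedances_eq count_def ennreal_suminf_cmult[symmetric]
    using of_bool_less_le_epowr[OF v, of \<beta>] \<beta> by (intro nn_integral_mono suminf_le) auto
  also have "\<dots> = ennreal (v powr - \<beta>) * (\<integral>\<^sup>+q. (\<Sum>i. if i
      = 0 then 0 else epowr (child q i) \<beta>) \<partial>copies_space M)"
    by (rule nn_integral_cmult) measurable
  also have "(\<integral>\<^sup>+q. (\<Sum>i. if i = 0 then 0 else epowr (child q i) \<beta>) \<partial>copies_space M)
      \<le> (\<integral>\<^sup>+q. (\<Sum>i. epowr (child q i) \<beta>) \<partial>copies_space M)"
    by (intro nn_integral_mono suminf_le) auto
  also have "\<dots> = (\<integral>\<^sup>+\<omega>. epowr (ennreal (Q [] \<omega>)) \<beta> \<partial>M)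
      + root_moment \<beta> * (\<integral>\<^sup>+\<omega>. epowr (tree_R Q N C \<omega>) \<beta> \<partial>M)"
    unfolding child_def by (rule nn_integral_copies_sum_powers) measurable
  also have "ennreal (v powr - \<beta>) * ((\<integral>\<^sup>+\<omega>. epowr (ennreal (Q [] \<omega>)) \<beta> \<partial>M)
      + root_moment \<beta> * (\<integral>\<^sup>+\<omega>. epowr (tree_R Q N C \<omega>) \<beta> \<partial>M)) < \<infinity>"
    using root_moment_\<beta> R_\<beta> Q_\<beta> by (simp add: ennreal_mult_less_top)
  finally show ?thesis by (simp add: mult_left_mono)
qed

end

section \<open>Exchanging the integrals over levels and over samples\<close>

lemma integral_enn2real:
  assumes [measurable]: "f \<in> borel_measurable L" and fin: "(\<integral>\<^sup>+x. f x \<partial>L) < \<infinity>"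
  shows "integrable L (\<lambda>x. enn2real (f x))" and "(\<integral>x. enn2real (f x) \<partial>L) = enn2real (\<integral>\<^sup>+x. f x \<partial>L)"
proof -
  have "AE x in L. f x \<noteq> \<infinity>" using fin by (intro nn_integral_noteq_infinite) auto
  then have eq: "(\<integral>\<^sup>+x. ennreal (enn2real (f x)) \<partial>L) = (\<integral>\<^sup>+x. f x \<partial>L)"
    by (intro nn_integral_cong_AE) (auto elim!: eventually_mono simp: less_top)
  then show "integrable L (\<lambda>x. enn2real (f x))"
    using fin by (intro integrableI_bounded) auto
  show "(\<integral>x. enn2real (f x) \<partial>L) = enn2real (\<integral>\<^sup>+x. f x \<partial>L)"
    unfolding eq[symmetric] by (rule integral_eq_nn_integral) auto
qed

context tree_renewal
begin

lemma count_finite: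
  assumes "(\<Sum>i. epowr (child q i) \<alpha>) < \<infinity>" "0 < v"
  shows "count v q < \<infinity>"
proof -
  have "count v q \<le> (\<Sum>i. ennreal (v powr - \<alpha>) * epowr (child q i) \<alpha>)"
    unfolding count_def using of_bool_less_le_epowr[OF assms(2), of \<alpha>] \<alpha>_pos
        by (intro suminf_le) auto
  also have "\<dots> = ennreal (v powr - \<alpha>) * (\<Sum>i. epowr (child q i) \<alpha>)" by simp
  also have "\<dots> < \<infinity>" using assms by (simp add: ennreal_mult_less_top)
  finally show ?thesis .
qed

text \<open>Fubini for this function links the two formulas for \<open>H\<close>: integrating over
  samples gives the weighted tail difference at level \<open>v\<close>, integrating over levels
  gives the difference of powers.\<close>

definition signed_exceedance :: "'w \<times> (nat \<Rightarrow> 'w) \<Rightarrow> real \<Rightarrow> real" where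
  "signed_exceedance q v =
    (if 0 < v then \<alpha> * v powr (\<alpha> - 1) * (of_bool (ennreal v < total q) - enn2real (count v q))
        else 0)"

lemma measurable_signed_exceedance [measurable]:
  "(\<lambda>(q, v). signed_exceedance q v) \<in> borel_measurable (copies_space M \<Otimes>\<^sub>M lborel)"
  unfolding signed_exceedance_def split_beta' of_bool_def by measurable

lemma sigma_finite_copies: "pair_sigma_finite (copies_space M) lborel"
proof -
  interpret c: prob_space "copies_space M" by (rule prob_space_copies)
  show ?thesis ..
qed

lemma integrable_signed_exceedance:
  "integrable (copies_space M \<Otimes>\<^sub>M lborel) (\<lambda>(q, v). signed_exceedance q v)"
proof (rule integrableI_bounded)
  have "(\<integral>\<^sup>+x. ennreal (norm (case x of (q, v) \<Rightarrow> signed_exceedance q v)) \<partial>(copies_space M \<Otimes>\<^sub>M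
      lborel))
      = (\<integral>\<^sup>+q. \<integral>\<^sup>+v. ennreal \<bar>signed_exceedance q v\<bar> \<partial>lborel \<partial>copies_space M)"
    by (subst lborel.nn_integral_fst[symmetric]) (auto simp: split_beta')
  also have "\<dots> = (\<integral>\<^sup>+q. \<integral>\<^sup>+v. ennreal (\<alpha> * v powr (\<alpha> - 1)) *
      (if 0 < v then edist_diff (of_bool (ennreal v < total q)) (count v q)
          else 0) \<partial>lborel \<partial>copies_space M)"
  proof (rule nn_integral_cong_AE)
    show "AE q in copies_space M. (\<integral>\<^sup>+v. ennreal \<bar>signed_exceedance q v\<bar> \<partial>lborel)
        = (\<integral>\<^sup>+v. ennreal (\<alpha> * v powr (\<alpha> - 1)) *
      (if 0 < v then edist_diff (of_bool (ennreal v < total q)) (count v q) else 0) \<partial>lborel)"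
      using AE_finite
    proof eventually_elim
      case (elim q)
      show ?case
      proof (rule nn_integral_cong)
        fix v :: real
        show "ennreal \<bar>signed_exceedance q v\<bar> = ennreal (\<alpha> * v powr (\<alpha> - 1)) *
          (if 0 < v then edist_diff (of_bool (ennreal v < total q)) (count v q) else 0)"
        proof (cases "0 < v")
          case True
          \<comment> \<open>A finite sum of powers admits only finitely many terms above
            \<open>v\<close>, so the conversion to reals is faithful here.\<close>
          have "count v q = ennreal (enn2real (count v q))"
            using count_finite[of q v] elim True by simp
          moreover have "of_bool (ennreal v < total q) = ennreal (of_bool (ennreal v < total q))"
            by (simp add: of_bool_def)
          ultimately have "edist_diff (of_bool (ennreal v < total q)) (count v q)
              = ennreal \<bar>of_bool (ennreal v < total q) - enn2real (count v q)\<bar>"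
            using edist_diff_ennreal[of "of_bool (ennreal v < total q)" "enn2real (count v q)"]
                by simp
          then show ?thesis
            using True \<alpha>_pos by (simp add: signed_exceedance_def abs_mult ennreal_mult)
        qed (simp add: signed_exceedance_def)
      qed
    qed
  qed
  also have "\<dots> < \<infinity>" by (rule total_variation_finite)
  finally show "(\<integral>\<^sup>+x. ennreal (norm (case x of (q, v) \<Rightarrow> signed_exceedance q v)) \<partial>(copies_space M
      \<Otimes>\<^sub>M lborel)) < \<infinity>" .
qed measurable

definition tail :: "real \<Rightarrow> real" where
  "tail v = measure M {\<omega> \<in> space M. tree_R Q N C \<omega> > ennreal v}"

lemma tail_nonneg [simp]: "0 \<le> tail v"
  by (simp add: tail_def)

lemma integral_copies_signed_exceedance:
  assumes v: "0 < v"
  shows "(\<integral>q. signed_exceedance q v \<partial>copies_space M) =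
    \<alpha> * v powr (\<alpha> - 1) * (tail v - enn2real (expected_exceedances M Q N C v))"
proof -
  interpret c: prob_space "copies_space M" by (rule prob_space_copies)
  have fin: "(\<integral>\<^sup>+q. count v q \<partial>copies_space M) < \<infinity>"
    using expected_exceedances_finite[OF v] by (simp add: expected_exceedances_eq)
  have "tail v = measure (distr M borel (tree_R Q N C)) {ennreal v<..}"
    unfolding tail_def
    by (subst measure_distr) (auto simp: vimage_def Int_def conj_commute intro!: arg_cong[where f
        = "measure M"])
  also have "\<dots> = measure (distr (copies_space M) borel total) {ennreal v<..}"
    unfolding distr_tree_R total_eq_smoothing ..
  also have "\<dots> = measure (copies_space M) {q \<in> space (copies_space M). ennreal v < total q}"
    by (subst measure_distr) (auto simp: vimage_def Int_def conj_commute intro!: arg_cong[where f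
        = "measure (copies_space M)"])
  also have "\<dots> = (\<integral>q. indicator {q \<in> space (copies_space M). ennreal v < total q} q \<partial>copies_space
      M)"
    by simp
  also have "\<dots> = (\<integral>q. of_bool (ennreal v < total q) \<partial>copies_space M)"
    by (intro Bochner_Integration.integral_cong) (auto simp: indicator_def)
  finally have tail: "(\<integral>q. of_bool (ennreal v < total q) \<partial>copies_space M) = tail v" ..
  have "integrable (copies_space M) (\<lambda>q. of_bool (ennreal v < total q) :: real)"
    by (rule c.integrable_const_bound[where B = 1]) (auto simp: of_bool_def)
  then show ?thesis
    using v integral_enn2real[OF measurable_count fin] tail
    by (simp add: signed_exceedance_def expected_exceedances_eq)
qed

text \<open>The layer-cake formula is applied to each term; both resulting powers are finite at this
  sample point, so the integral splits.\<close>

lemma integral_lborel_signed_exceedance: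
  assumes "epowr (total q) \<alpha> < \<infinity>" "(\<Sum>i. epowr (child q i) \<alpha>) < \<infinity>"
  shows "(\<integral>v. signed_exceedance q v \<partial>lborel)
      = enn2real (power_of_sum Q N C \<alpha> q) - enn2real (sum_of_powers Q N C \<alpha> q)"
proof -
  define g1 where "g1 v = ennreal (\<alpha> * v powr (\<alpha> - 1)) * (if 0 < v
      \<and> ennreal v < total q then 1 else 0)" for v
  define g2 where "g2 v = ennreal (\<alpha> * v powr (\<alpha> - 1)) * (if 0 < v then count v q else 0)" for v
  have [measurable]: "g1 \<in> borel_measurable lborel" unfolding g1_def by measurable
  have [measurable]: "g2 \<in> borel_measurable lborel" unfolding g2_def count_def by measurable
  have 1: "(\<integral>\<^sup>+v. g1 v \<partial>lborel) = power_of_sum Q N C \<alpha> q"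
    unfolding g1_def power_of_sum_eq by (rule nn_integral_layer_cake[OF \<alpha>_pos])
  have "(\<integral>\<^sup>+v. g2 v \<partial>lborel) = (\<integral>\<^sup>+v. (\<Sum>i. if i = 0 then 0 else
      ennreal (\<alpha> * v powr (\<alpha> - 1)) * (if 0 < v \<and> ennreal v < child q i then 1 else 0)) \<partial>lborel)"
    unfolding g2_def count_def
    by (intro nn_integral_cong) (auto simp: ennreal_suminf_cmult[symmetric] simp del:
        ennreal_suminf_cmult cong: if_cong intro!: arg_cong[where f = suminf])
  also have "\<dots> = (\<Sum>i. \<integral>\<^sup>+v. (if i = 0 then 0 else
      ennreal (\<alpha> * v powr (\<alpha> - 1)) * (if 0 < v \<and> ennreal v < child q i then 1 else 0)) \<partial>lborel)"
    by (rule nn_integral_suminf) measurable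
  also have "\<dots> = sum_of_powers Q N C \<alpha> q"
    unfolding sum_of_powers_eq by (intro arg_cong[where f
        = suminf] ext) (simp add: nn_integral_layer_cake[OF \<alpha>_pos])
  finally have 2: "(\<integral>\<^sup>+v. g2 v \<partial>lborel) = sum_of_powers Q N C \<alpha> q" .
  have fin1: "(\<integral>\<^sup>+v. g1 v \<partial>lborel) < \<infinity>" using assms unfolding 1 power_of_sum_eq by simp
  have "sum_of_powers Q N C \<alpha> q \<le> (\<Sum>i. epowr (child q i) \<alpha>)"
    unfolding sum_of_powers_eq by (intro suminf_le) auto
  then have fin2: "(\<integral>\<^sup>+v. g2 v \<partial>lborel) < \<infinity>" using assms unfolding 2 by simp
  have "signed_exceedance q v = enn2real (g1 v) - enn2real (g2 v)" for v
    using \<alpha>_pos by (auto simp: signed_exceedance_def g1_def g2_def enn2real_mult algebra_simps)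
  then show ?thesis
    using integral_enn2real[OF _ fin1] integral_enn2real[OF _ fin2] by (simp add: 1 2)
qed

lemma set_integrable_tail_difference:
  "set_integrable lborel {0<..} (\<lambda>v. v powr (\<alpha> - 1) * (tail v - enn2real (expected_exceedances M Q
      N C v)))"
proof -
  interpret pair_sigma_finite "copies_space M" lborel by (rule sigma_finite_copies)
  have "integrable lborel (\<lambda>v. 1 / \<alpha> * (\<integral>q. signed_exceedance q v \<partial>copies_space M))"
    using integrable_snd[OF integrable_signed_exceedance] by simp
  also have "(\<lambda>v. 1 / \<alpha> * (\<integral>q. signed_exceedance q v \<partial>copies_space M)) =
      (\<lambda>v. indicator {0<..} v *\<^sub>R (v powr (\<alpha> - 1) * (tail v - enn2real (expected_exceedances M Q N
          C v))))"
  proof (rule ext)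
    fix v
    show "1 / \<alpha> * (\<integral>q. signed_exceedance q v \<partial>copies_space M) =
      indicator {0<..} v *\<^sub>R (v powr (\<alpha> - 1) * (tail v - enn2real (expected_exceedances M Q N C
          v)))"
      using integral_copies_signed_exceedance[of v] \<alpha>_pos
      by (cases "0 < v") (auto simp: signed_exceedance_def)
  qed
  finally show ?thesis unfolding set_integrable_def .
qed

lemma integrable_power_difference:
  "integrable (copies_space M) (\<lambda>q. enn2real (power_of_sum Q N C \<alpha> q) - enn2real (sum_of_powers Q N
      C \<alpha> q))" (is ?A)
  and tail_difference_integral:
  "\<alpha> * (LINT v:{0<..}|lborel. v powr (\<alpha> - 1) * (tail v - enn2real (expected_exceedances M Q N C
      v))) =
    (\<integral>q. enn2real (power_of_sum Q N C \<alpha> q) - enn2real (sum_of_powers Q N C \<alpha> q) \<partial>copies_space M)"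
        (is ?B)
proof -
  interpret pair_sigma_finite "copies_space M" lborel by (rule sigma_finite_copies)
  have [measurable]: "power_of_sum Q N C \<alpha> \<in> borel_measurable (copies_space M)"
    unfolding power_of_sum_eq[abs_def] by measurable
  have [measurable]: "sum_of_powers Q N C \<alpha> \<in> borel_measurable (copies_space M)"
    unfolding sum_of_powers_eq[abs_def] by measurable
  have ae: "AE q in copies_space M. (\<integral>v. signed_exceedance q v \<partial>lborel)
      = enn2real (power_of_sum Q N C \<alpha> q) - enn2real (sum_of_powers Q N C \<alpha> q)"
    using AE_finite by eventually_elim (rule integral_lborel_signed_exceedance, auto)
  have int: "integrable (copies_space M) (\<lambda>q. \<integral>v. signed_exceedance q v \<partial>lborel)"
    using integrable_fst[OF integrable_signed_exceedance] by simp
  show ?A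
    using int by (rule integrable_cong_AE_imp) (use ae in auto)
  have "(\<integral>q. enn2real (power_of_sum Q N C \<alpha> q) - enn2real (sum_of_powers Q N C \<alpha> q) \<partial>copies_space
      M) =
      (\<integral>q. \<integral>v. signed_exceedance q v \<partial>lborel \<partial>copies_space M)"
    using ae int by (intro integral_cong_AE) auto
  also have "\<dots> = (\<integral>v. \<integral>q. signed_exceedance q v \<partial>copies_space M \<partial>lborel)"
    using Fubini_integral[of signed_exceedance] integrable_signed_exceedance by simp
  also have "\<dots> = (\<integral>v. \<alpha> * (indicator {0<..} v *\<^sub>R (v powr (\<alpha> - 1) * (tail v - enn2real
      (expected_exceedances M Q N C v)))) \<partial>lborel)"
  proof (intro Bochner_Integration.integral_cong refl)
    fix v
    show "(\<integral>q. signed_exceedance q v \<partial>copies_space M) =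
      \<alpha> * (indicator {0<..} v *\<^sub>R (v powr (\<alpha> - 1) * (tail v - enn2real (expected_exceedances M Q N
          C v))))"
      using integral_copies_signed_exceedance[of v]
      by (cases "0 < v") (auto simp: signed_exceedance_def)
  qed
  finally show ?B by (simp add: set_lebesgue_integral_def)
qed

end

section \<open>Tail asymptotics\<close>

text \<open>The change of variables is carried out for \<open>lebesgue\<close> and transferred back
  to \<open>lborel\<close>; the extension \<open>h\<close> of \<open>f\<close> by zero is Borel
  measurable, which justifies the transfers.\<close>

lemma lborel_integral_exp_substitution:
  fixes f :: "real \<Rightarrow> real"
  assumes f: "set_integrable lborel {0<..} f"
  shows "integrable lborel (\<lambda>t. exp t * f (exp t))" and "(\<integral>t. exp t * f (exp t) \<partial>lborel)
      = (LINT v:{0<..}|lborel. f v)"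
proof -
  define h where "h v = indicator {0<..} v *\<^sub>R f v" for v :: real
  have h_int: "integrable lborel h" using f by (simp add: set_integrable_def h_def[abs_def])
  then have h_meas[measurable]: "h \<in> borel_measurable borel" by simp
  have h_exp: "h (exp t) = f (exp t)" for t by (simp add: h_def)
  have [measurable]: "(\<lambda>t. exp t * f (exp t)) \<in> borel_measurable borel"
    unfolding h_exp[symmetric] by measurable
  have "integrable lebesgue h" using h_int by (subst integrable_completion) auto
  then have abs: "f absolutely_integrable_on {0<..}"
    by (simp add: set_integrable_def h_def[abs_def])
  have range: "range exp = {0::real<..}"
    by (auto simp: image_iff) (metis exp_ln)
  have "(\<lambda>t. \<bar>exp t\<bar> * f (exp t)) absolutely_integrable_on UNIV \<and>
      integral UNIV (\<lambda>t. \<bar>exp t\<bar> * f (exp t)) = integral {0<..} f"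
    using has_absolute_integral_change_of_variables_1'[of UNIV exp exp f "integral {0<..} f"] abs
    unfolding range by (auto intro!: derivative_eq_intros inj_onI)
  then have 1: "(\<lambda>t. exp t * f (exp t)) absolutely_integrable_on UNIV"
    and 2: "integral UNIV (\<lambda>t. exp t * f (exp t)) = integral {0<..} f" by auto
  have 3: "integrable lebesgue (\<lambda>t. exp t * f (exp t))"
    using 1 by (simp add: set_integrable_def)
  then show "integrable lborel (\<lambda>t. exp t * f (exp t))"
    by (subst (asm) integrable_completion) auto
  have "(\<integral>t. exp t * f (exp t) \<partial>lborel) = (\<integral>t. exp t * f (exp t) \<partial>lebesgue)"
    by (rule integral_completion[symmetric]) simp
  also have "\<dots> = integral UNIV (\<lambda>t. exp t * f (exp t))"
    using set_lebesgue_integral_eq_integral(2)[OF 1] by (simp add: set_lebesgue_integral_def)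
  also have "\<dots> = (LINT v:{0<..}|lebesgue. f v)"
    unfolding 2 using set_lebesgue_integral_eq_integral(2)[OF abs] by simp
  also have "\<dots> = (LINT v:{0<..}|lborel. f v)"
    unfolding set_lebesgue_integral_def h_def[symmetric] by (rule integral_completion) simp
  finally show "(\<integral>t. exp t * f (exp t) \<partial>lborel) = (LINT v:{0<..}|lborel. f v)" .
qed

section \<open>The step distribution of the walk\<close>

context weighted_branching_tree
begin

text \<open>The measure \<open>E[\<Sum>\<^sub>i 1(log C\<^sub>i \<in> du) C\<^sub>i\<^sup>a]\<close>; index \<open>0\<close> (the term \<open>Q\<close>) is excluded.\<close>

definition step_weight :: "real \<Rightarrow> nat \<Rightarrow> 'w \<Rightarrow> ennreal" where
  "step_weight a i \<omega> = (if i = 0 then 0 else epowr (coef \<omega> i) a)"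

text \<open>At a vanishing coefficient this is a default value; \<open>step_weight\<close> is 0
  there, so it never reaches the step measure.\<close>

definition log_coef :: "nat \<Rightarrow> 'w \<Rightarrow> real" where
  "log_coef i \<omega> = ln (enn2real (coef \<omega> i))"

text \<open>An image of the product of counting measure and \<open>M\<close> with a density, so that
  integrals against it are double integrals over index and sample.\<close>

definition step_measure :: "real \<Rightarrow> real measure" where
  "step_measure a = distr (density (count_space UNIV \<Otimes>\<^sub>M M) (\<lambda>(i, \<omega>). step_weight a i \<omega>)) borel
      (\<lambda>(i, \<omega>). log_coef i \<omega>)"

lemma measurable_step [measurable]:
  "step_weight a i \<in> borel_measurable M" "log_coef i \<in> borel_measurable M"
  unfolding step_weight_def[abs_def] log_coef_def[abs_def] by (cases "i = 0"; simp)+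

lemma measurable_step_pair [measurable]:
  "(\<lambda>(i, \<omega>). step_weight a i \<omega>) \<in> borel_measurable (count_space UNIV \<Otimes>\<^sub>M M)"
  "(\<lambda>(i, \<omega>). log_coef i \<omega>) \<in> borel_measurable (count_space UNIV \<Otimes>\<^sub>M M)"
  by (rule measurable_pair_measure_countable1, auto)+

lemma nn_integral_step_measure:
  assumes [measurable]: "f \<in> borel_measurable borel"
  shows "(\<integral>\<^sup>+u. f u \<partial>step_measure a) = (\<Sum>i. \<integral>\<^sup>+\<omega>. step_weight a i \<omega> * f (log_coef i \<omega>) \<partial>M)"
proof -
  have m: "(\<lambda>x. f (case x of (i, \<omega>) \<Rightarrow> log_coef i \<omega>)) \<in> borel_measurable (count_space UNIV \<Otimes>\<^sub>M M)"
    by (rule measurable_compose[OF measurable_step_pair(2)]) simp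
  have "(\<integral>\<^sup>+u. f u \<partial>step_measure a) =
      (\<integral>\<^sup>+x. (case x of (i, \<omega>) \<Rightarrow> step_weight a i \<omega>) * f (case x of (i, \<omega>) \<Rightarrow> log_coef i \<omega>)
      \<partial>(count_space UNIV \<Otimes>\<^sub>M M))"
    unfolding step_measure_def
    by (subst nn_integral_distr, simp, simp, subst nn_integral_density[OF measurable_step_pair(1)
        m]) simp
  also have "\<dots> = (\<integral>\<^sup>+i. \<integral>\<^sup>+\<omega>. step_weight a i \<omega> * f (log_coef i \<omega>) \<partial>M \<partial>count_space UNIV)"
    using measurable_step_pair(1) m by (subst nn_integral_fst[symmetric]) auto
  finally show ?thesis by (simp add: nn_integral_count_space_nat)
qed

lemma sets_step_measure [simp, measurable_cong]: "sets (step_measure a) = sets borel"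
  by (simp add: step_measure_def)

lemma suminf_step_weight: "(\<Sum>i. \<integral>\<^sup>+\<omega>. step_weight a i \<omega> \<partial>M) = root_moment a"
  unfolding root_moment_eq by (subst nn_integral_suminf) (auto simp: step_weight_def[abs_def]
      intro!: arg_cong[where f = suminf])

lemma coef_less_top: "coef \<omega> i < top"
  by (simp add: coef_def)

lemma coef_pos: "coef \<omega> i \<noteq> 0 \<Longrightarrow> 0 < enn2real (coef \<omega> i)"
  using coef_less_top[of \<omega> i] by (simp add: enn2real_positive_iff zero_less_iff_neq_zero)

lemma step_weight_eq: "step_weight a i \<omega> = (if i
    = 0 then 0 else ennreal (enn2real (coef \<omega> i) powr a))"
  using coef_less_top[of \<omega> i] by (auto simp: step_weight_def epowr_def)

lemma real_distribution_step_measure: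
  assumes "root_moment a = 1"
  shows "real_distribution (step_measure a)"
proof -
  have "emeasure (step_measure a) (space (step_measure a)) = (\<integral>\<^sup>+u. 1 \<partial>step_measure a)" by simp
  also have "\<dots> = 1" by (subst nn_integral_step_measure) (auto simp: suminf_step_weight assms)
  finally have "prob_space (step_measure a)" by (rule prob_spaceI)
  then show ?thesis by (simp add: real_distribution_def real_distribution_axioms_def)
qed

text \<open>For \<open>x > 0\<close>, \<open>x powr a * exp (- \<theta> * ln x)\<close> is
  \<open>x powr (a - \<theta>)\<close>; this connects the Laplace transform with the moments of the
  weights.\<close>

lemma nn_integral_step_measure_exp:
  "(\<integral>\<^sup>+u. ennreal (exp (- \<theta> * u)) \<partial>step_measure a) = root_moment (a - \<theta>)"
proof -
  have "step_weight a i \<omega> * ennreal (exp (- \<theta> * log_coef i \<omega>)) = step_weight (a - \<theta>) i \<omega>" for i \<omega>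
  proof (cases "i = 0 \<or> enn2real (coef \<omega> i) = 0")
    case False
    define x where "x = enn2real (coef \<omega> i)"
    have x: "x > 0" using False enn2real_nonneg[of "coef \<omega> i"] unfolding x_def by linarith
    have "x powr a * exp (- \<theta> * ln x) = x powr (a - \<theta>)"
      using x by (simp add: powr_def exp_add[symmetric] algebra_simps)
    then show ?thesis using False by (simp add: step_weight_eq log_coef_def x_def[symmetric]
        ennreal_mult[symmetric])
  qed (auto simp: step_weight_eq)
  then show ?thesis by (subst nn_integral_step_measure) (auto simp: suminf_step_weight)
qed

text \<open>The step measure is a sum over children, with positive weight wherever the coefficient
  is positive. A null set for it is therefore null for the law of each single
  \<open>ln (C [j])\<close>, and one nonarithmetic child is enough.\<close>

lemma nonarithmetic_step_measure:
  assumes j: "1 \<le> j"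
    and na: "nonarithmetic (distr (restrict_space M {\<omega> \<in> space M. enat j
        \<le> N [] \<omega> \<and> C [j] \<omega> > 0}) borel (\<lambda>\<omega>. ln (C [j] \<omega>)))"
    and d: "0 < d"
  shows "emeasure (step_measure a) (- {d * of_int k | k. True}) \<noteq> 0"
proof
  define A where "A = {d * of_int k | k. True}"
  define \<Omega> where "\<Omega> = {\<omega> \<in> space M. enat j \<le> N [] \<omega> \<and> C [j] \<omega> > 0}"
  have [measurable]: "C [j] \<in> borel_measurable M" using measurable_root_C[OF j] .
  have \<Omega>[measurable]: "\<Omega> \<in> sets M" unfolding \<Omega>_def by measurable
  have "A = range (\<lambda>k::int. d * of_int k)" unfolding A_def by auto
  then have "countable A" by simp
  then have [measurable]: "A \<in> sets borel" by (rule sets.countable[rotated]) simp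
  assume "emeasure (step_measure a) (- {d * of_int k | k. True}) = 0"
  then have "(\<integral>\<^sup>+u. indicator (- A) u \<partial>step_measure a) = 0"
    unfolding A_def[symmetric] by (subst nn_integral_indicator) auto
  then have "(\<Sum>i. \<integral>\<^sup>+\<omega>. step_weight a i \<omega> * indicator (- A) (log_coef i \<omega>) \<partial>M) = 0"
    by (subst (asm) nn_integral_step_measure) auto
  then have "(\<integral>\<^sup>+\<omega>. step_weight a j \<omega> * indicator (- A) (log_coef j \<omega>) \<partial>M) = 0"
    using sum_le_suminf[of "\<lambda>i. \<integral>\<^sup>+\<omega>. step_weight a i \<omega> * indicator (- A) (log_coef i \<omega>) \<partial>M" "{j}"]
        by simp
  then have ae: "AE \<omega> in M. step_weight a j \<omega> * indicator (- A) (log_coef j \<omega>) = 0"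
    by (subst (asm) nn_integral_0_iff_AE) auto
  have "AE \<omega> in M. \<not> (\<omega> \<in> \<Omega> \<and> ln (C [j] \<omega>) \<in> - A)"
    using ae
  proof eventually_elim
    case (elim \<omega>)
    show ?case
    proof
      assume *: "\<omega> \<in> \<Omega> \<and> ln (C [j] \<omega>) \<in> - A"
      then have "coef \<omega> j = ennreal (C [j] \<omega>)" "0 < C [j] \<omega>" using j by (auto simp: coef_def \<Omega>_def)
      then show False using elim * j by (auto simp: step_weight_eq log_coef_def)
    qed
  qed
  moreover have "{\<omega> \<in> space M. \<omega> \<in> \<Omega> \<and> ln (C [j] \<omega>) \<in> - A} \<in> sets M" by measurable
  ultimately have "emeasure M {\<omega> \<in> space M. \<omega> \<in> \<Omega> \<and> ln (C [j] \<omega>) \<in> - A} = 0"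
    by (subst (asm) AE_iff_measurable[OF _ refl]) auto
  moreover have "emeasure (distr (restrict_space M \<Omega>) borel (\<lambda>\<omega>. ln (C [j] \<omega>))) (- A) =
      emeasure M {\<omega> \<in> space M. \<omega> \<in> \<Omega> \<and> ln (C [j] \<omega>) \<in> - A}"
  proof -
    have m: "(\<lambda>\<omega>. ln (C [j] \<omega>)) \<in> borel_measurable (restrict_space M \<Omega>)"
      by (rule measurable_restrict_space1) measurable
    have "emeasure (distr (restrict_space M \<Omega>) borel (\<lambda>\<omega>. ln (C [j] \<omega>))) (- A) =
        emeasure (restrict_space M \<Omega>) ((\<lambda>\<omega>. ln (C [j] \<omega>)) -` (- A) \<inter> space (restrict_space M \<Omega>))"
      by (rule emeasure_distr[OF m]) simp
    also have "\<dots> = emeasure M ((\<lambda>\<omega>. ln (C [j] \<omega>)) -` (- A) \<inter> space (restrict_space M \<Omega>))"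
      by (rule emeasure_restrict_space) (auto simp: space_restrict_space)
    also have "(\<lambda>\<omega>. ln (C [j] \<omega>)) -` (- A) \<inter> space (restrict_space M \<Omega>)
        = {\<omega> \<in> space M. \<omega> \<in> \<Omega> \<and> ln (C [j] \<omega>) \<in> - A}"
      using sets.sets_into_space[OF \<Omega>] by (auto simp: space_restrict_space)
    finally show ?thesis .
  qed
  ultimately have "emeasure (distr (restrict_space M \<Omega>) borel (\<lambda>\<omega>. ln (C [j] \<omega>))) (- A) = 0" by simp
  moreover have "emeasure (distr (restrict_space M \<Omega>) borel (\<lambda>\<omega>. ln (C [j] \<omega>))) (- A) \<noteq> 0"
    using na d unfolding nonarithmetic_def \<Omega>_def A_def by blast
  ultimately show False by simp
qed

end

text \<open>At \<open>\<theta>\<close> the Laplace transform of the step is below 1; the moment of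
  \<open>R\<close> of order \<open>\<alpha> - \<theta>'\<close> limits the growth of the scaled tail
  to the smaller rate \<open>\<theta>'\<close>.\<close>

locale tree_renewal_limit = tree_renewal +
  fixes \<theta> \<theta>' m :: real
  assumes \<theta>: "0 < \<theta>'" "\<theta>' < \<theta>" "\<theta>' < \<alpha>"
    and root_\<theta>: "root_moment (\<alpha> - \<theta>) < 1"
    and R_\<theta>': "(\<integral>\<^sup>+\<omega>. epowr (tree_R Q N C \<omega>) (\<alpha> - \<theta>') \<partial>M) < \<infinity>"
    and mean: "integrable (step_measure \<alpha>) (\<lambda>u. u)" "(\<integral>u. u \<partial>step_measure \<alpha>) = m" "0 < m"
    and nonarith: "\<And>d. d > 0 \<Longrightarrow> emeasure (step_measure \<alpha>) (- {d * of_int k | k. True}) \<noteq> 0"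
begin

definition scaled_tail :: "real \<Rightarrow> real" where
  "scaled_tail t = exp (\<alpha> * t) * tail (exp t)"

definition scaled_difference :: "real \<Rightarrow> real" where
  "scaled_difference t = exp (\<alpha> * t) * (tail (exp t) - enn2real (expected_exceedances M Q N C (exp
      t)))"

lemma tail_antimono: "s \<le> t \<Longrightarrow> tail t \<le> tail s"
  unfolding tail_def by (intro finite_measure_mono) (auto intro: le_less_trans ennreal_leI)

lemma measurable_tail [measurable]: "tail \<in> borel_measurable borel"
proof -
  have "mono (\<lambda>t. - tail t)" using tail_antimono by (simp add: mono_def)
  then have "(\<lambda>t. - (- tail t)) \<in> borel_measurable borel"
    by (intro borel_measurable_uminus borel_measurable_mono)
  then show ?thesis by simp
qed

lemma emeasure_tail: "emeasure M {\<omega> \<in> space M. tree_R Q N C \<omega> > ennreal v} = ennreal (tail v)"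
  unfolding tail_def by (rule emeasure_eq_measure)

text \<open>Given a coefficient \<open>c > 0\<close>, the event \<open>c R > v\<close> is
  \<open>R > v / c\<close>; a zero coefficient never exceeds a positive level.\<close>

lemma expected_exceedances_eq_suminf:
  assumes v: "0 < v"
  shows "expected_exceedances M Q N C v =
    (\<Sum>i. \<integral>\<^sup>+\<omega>. (if i = 0 \<or> coef \<omega> i = 0 then 0 else ennreal (tail (v / enn2real (coef \<omega> i)))) \<partial>M)"
proof -
  let ?P = "PiM (UNIV :: nat set) (\<lambda>_. M)"
  have "expected_exceedances M Q N C v = (\<integral>\<^sup>+\<omega>. \<integral>\<^sup>+x. count v (\<omega>, x) \<partial>?P \<partial>M)"
    unfolding expected_exceedances_eq by (rule nn_integral_copies) measurable
  also have "\<dots> = (\<integral>\<^sup>+\<omega>. (\<Sum>i. (if i = 0 \<or> coef \<omega> i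
      = 0 then 0 else ennreal (tail (v / enn2real (coef \<omega> i))))) \<partial>M)"
  proof (rule nn_integral_cong)
    fix \<omega>
    have "(\<integral>\<^sup>+x. count v (\<omega>, x) \<partial>?P) = (\<Sum>i. \<integral>\<^sup>+x. (if i
        = 0 then 0 else of_bool (ennreal v < coef \<omega> i * copy (tree_R Q N C) x i)) \<partial>?P)"
      unfolding count_def child_def fst_conv snd_conv by (rule nn_integral_suminf) measurable
    also have "\<dots> = (\<Sum>i. (if i = 0 \<or> coef \<omega> i
        = 0 then 0 else ennreal (tail (v / enn2real (coef \<omega> i)))))"
    proof (intro arg_cong[where f = suminf] ext)
      fix i
      show "(\<integral>\<^sup>+x. (if i = 0 then 0 else of_bool (ennreal v < coef \<omega> i * copy (tree_R Q N C) x i))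
          \<partial>?P) =
        (if i = 0 \<or> coef \<omega> i = 0 then 0 else ennreal (tail (v / enn2real (coef \<omega> i))))"
      proof (cases "i = 0 \<or> coef \<omega> i = 0")
        case False
        define c where "c = enn2real (coef \<omega> i)"
        have c: "coef \<omega> i = ennreal c" "0 < c"
          unfolding c_def using False coef_less_top[of \<omega> i] coef_pos[of \<omega> i] by simp_all
        have iff: "ennreal v < ennreal c * y \<longleftrightarrow> ennreal (v / c) < y" for y
        proof (cases y)
          case (real r)
          then show ?thesis using c v by (auto simp: ennreal_mult[symmetric] ennreal_less_iff
              field_simps)
        qed (use c in \<open>simp add: ennreal_mult_top\<close>)
        have "(\<integral>\<^sup>+x. of_bool (ennreal v < coef \<omega> i * tree_R Q N C (x i)) \<partial>?P)
            = (\<integral>\<^sup>+\<omega>'. of_bool (ennreal (v / c) < tree_R Q N C \<omega>') \<partial>M)"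
          unfolding c(1) iff by (rule nn_integral_PiM_coordinate) measurable
        also have "\<dots> = (\<integral>\<^sup>+\<omega>'. indicator {\<omega> \<in> space M. tree_R Q N C \<omega> > ennreal (v / c)} \<omega>' \<partial>M)"
          by (intro nn_integral_cong) (auto simp: indicator_def)
        also have "\<dots> = ennreal (tail (v / c))"
          by (simp add: emeasure_tail)
        finally show ?thesis using False by (simp add: copy_def c_def)
      qed (auto cong: if_cong)
    qed
    finally show "(\<integral>\<^sup>+x. count v (\<omega>, x) \<partial>?P) = (\<Sum>i. (if i = 0 \<or> coef \<omega> i
        = 0 then 0 else ennreal (tail (v / enn2real (coef \<omega> i)))))" .
  qed
  also have "\<dots> = (\<Sum>i. \<integral>\<^sup>+\<omega>. (if i = 0 \<or> coef \<omega> i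
      = 0 then 0 else ennreal (tail (v / enn2real (coef \<omega> i)))) \<partial>M)"
    by (rule nn_integral_suminf) measurable
  finally show ?thesis .
qed

text \<open>The weight of order \<open>\<alpha>\<close> cancels the factor
  \<open>exp (- \<alpha> * log_coef)\<close> of the shifted scaled tail, which leaves the tail at
  \<open>exp t\<close> divided by the coefficient.\<close>

lemma nn_integral_scaled_tail:
  "(\<integral>\<^sup>+u. ennreal (scaled_tail (t - u)) \<partial>step_measure \<alpha>)
      = ennreal (exp (\<alpha> * t)) * expected_exceedances M Q N C (exp t)"
proof -
  have [measurable]: "scaled_tail \<in> borel_measurable borel" unfolding scaled_tail_def[abs_def]
      by measurable
  have "(\<integral>\<^sup>+u. ennreal (scaled_tail (t - u)) \<partial>step_measure \<alpha>)
      = (\<Sum>i. \<integral>\<^sup>+\<omega>. step_weight \<alpha> i \<omega> * ennreal (scaled_tail (t - log_coef i \<omega>)) \<partial>M)"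
    by (rule nn_integral_step_measure) measurable
  also have "\<dots> = (\<Sum>i. \<integral>\<^sup>+\<omega>. ennreal (exp (\<alpha> * t)) * (if i = 0 \<or> coef \<omega> i
      = 0 then 0 else ennreal (tail (exp t / enn2real (coef \<omega> i)))) \<partial>M)"
  proof (intro arg_cong[where f = suminf] ext nn_integral_cong)
    fix i \<omega>
    show "step_weight \<alpha> i \<omega> * ennreal (scaled_tail (t - log_coef i \<omega>)) =
      ennreal (exp (\<alpha> * t)) * (if i = 0 \<or> coef \<omega> i
          = 0 then 0 else ennreal (tail (exp t / enn2real (coef \<omega> i))))"
    proof (cases "i = 0 \<or> coef \<omega> i = 0")
      case False
      define x where "x = enn2real (coef \<omega> i)"
      have x: "0 < x"
        unfolding x_def using False by (intro coef_pos) simp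
      have "x powr \<alpha> * (exp (\<alpha> * (t - ln x)) * tail (exp (t - ln x)))
          = exp (\<alpha> * t) * tail (exp t / x)"
        using x by (simp add: exp_diff powr_def right_diff_distrib)
      then show ?thesis using False
        by (simp add: step_weight_eq log_coef_def scaled_tail_def x_def[symmetric]
            ennreal_mult[symmetric])
    qed (auto simp: step_weight_eq)
  qed
  also have "\<dots> = ennreal (exp (\<alpha> * t)) * expected_exceedances M Q N C (exp t)"
    by (subst expected_exceedances_eq_suminf) (auto simp: nn_integral_cmult)
  finally show ?thesis .
qed

lemma tail_le: "0 < v \<Longrightarrow> tail v \<le> v powr - (\<alpha> - \<theta>') * enn2real
    (\<integral>\<^sup>+\<omega>. epowr (tree_R Q N C \<omega>) (\<alpha> - \<theta>') \<partial>M)"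
proof -
  assume v: "0 < v"
  let ?I = "\<integral>\<^sup>+\<omega>. epowr (tree_R Q N C \<omega>) (\<alpha> - \<theta>') \<partial>M"
  have "ennreal (tail v) = (\<integral>\<^sup>+\<omega>. indicator {\<omega> \<in> space M. tree_R Q N C \<omega> > ennreal v} \<omega> \<partial>M)"
    by (simp add: emeasure_tail)
  also have "\<dots> \<le> (\<integral>\<^sup>+\<omega>. ennreal (v powr - (\<alpha> - \<theta>')) * epowr (tree_R Q N C \<omega>) (\<alpha> - \<theta>') \<partial>M)"
  proof (rule nn_integral_mono)
    fix \<omega> assume "\<omega> \<in> space M"
    then show "indicator {\<omega> \<in> space M. tree_R Q N C \<omega> > ennreal v} \<omega>
        \<le> ennreal (v powr - (\<alpha> - \<theta>')) * epowr (tree_R Q N C \<omega>) (\<alpha> - \<theta>')"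
      using of_bool_less_le_epowr[OF v, of "\<alpha> - \<theta>'" "tree_R Q N C \<omega>"] \<theta>
          by (auto simp: indicator_def of_bool_def)
  qed
  also have "\<dots> = ennreal (v powr - (\<alpha> - \<theta>')) * ?I"
    by (rule nn_integral_cmult) measurable
  also have "\<dots> = ennreal (v powr - (\<alpha> - \<theta>') * enn2real ?I)"
    using R_\<theta>' by (simp add: ennreal_mult)
  finally show ?thesis by simp
qed

lemma scaled_difference_eq:
  "scaled_difference t = exp t * (exp t powr (\<alpha> - 1) * (tail (exp t) - enn2real
      (expected_exceedances M Q N C (exp t))))"
proof -
  have "exp (\<alpha> * t) = exp t * exp t powr (\<alpha> - 1)"
    by (simp add: powr_def exp_add[symmetric] left_diff_distrib)
  then show ?thesis by (simp only: scaled_difference_def mult.assoc)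
qed

abbreviation tail_moment :: real where
  "tail_moment \<equiv> enn2real (\<integral>\<^sup>+\<omega>. epowr (tree_R Q N C \<omega>) (\<alpha> - \<theta>') \<partial>M)"

lemma measurable_scaled_tail [measurable]: "scaled_tail \<in> borel_measurable borel"
  unfolding scaled_tail_def[abs_def] by measurable

lemma scaled_tail_nonneg: "0 \<le> scaled_tail t"
  by (simp add: scaled_tail_def)

lemma scaled_tail_decay:
  assumes "s \<le> t"
  shows "scaled_tail t \<le> exp (\<alpha> * (t - s)) * scaled_tail s"
proof -
  have "scaled_tail t \<le> exp (\<alpha> * t) * tail (exp s)"
    unfolding scaled_tail_def using assms by (intro mult_left_mono tail_antimono) auto
  also have "\<dots> = exp (\<alpha> * (t - s)) * exp (\<alpha> * s) * tail (exp s)"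
    by (simp add: right_diff_distrib exp_diff)
  finally show ?thesis by (simp add: scaled_tail_def)
qed

lemma scaled_tail_growth: "scaled_tail t \<le> tail_moment * exp (\<theta>' * t)"
proof -
  have e: "exp t powr - (\<alpha> - \<theta>') = exp (- ((\<alpha> - \<theta>') * t))" by (simp add: powr_def left_diff_distrib)
  have "exp (\<alpha> * t) * exp (- ((\<alpha> - \<theta>') * t)) = exp (\<alpha> * t + - ((\<alpha> - \<theta>') * t))"
    by (rule exp_add[symmetric])
  also have "\<alpha> * t + - ((\<alpha> - \<theta>') * t) = \<theta>' * t" by (simp add: left_diff_distrib)
  finally have e2: "exp (\<alpha> * t) * exp (- ((\<alpha> - \<theta>') * t)) = exp (\<theta>' * t)" .
  have "scaled_tail t \<le> exp (\<alpha> * t) * (exp t powr - (\<alpha> - \<theta>') * tail_moment)"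
    unfolding scaled_tail_def by (intro mult_left_mono tail_le) auto
  also have "\<dots> = tail_moment * exp (\<theta>' * t)"
    unfolding e e2[symmetric] by (simp only: mult_ac)
  finally show ?thesis .
qed

lemma integrable_scaled_difference: "integrable lborel scaled_difference"
  using lborel_integral_exp_substitution(1)[OF set_integrable_tail_difference]
  by (simp only: scaled_difference_eq[symmetric])

lemma integrable_scaled_tail: "integrable (step_measure \<alpha>) (\<lambda>u. scaled_tail (t - u))"
proof (rule integrableI_bounded)
  have "(\<integral>\<^sup>+u. ennreal (norm (scaled_tail (t - u))) \<partial>step_measure \<alpha>)
      = (\<integral>\<^sup>+u. ennreal (scaled_tail (t - u)) \<partial>step_measure \<alpha>)"
    by (simp add: scaled_tail_nonneg)
  also have "\<dots> < \<infinity>"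
    unfolding nn_integral_scaled_tail using expected_exceedances_finite[of "exp t"]
        by (simp add: ennreal_mult_less_top)
  finally show "(\<integral>\<^sup>+u. ennreal (norm (scaled_tail (t - u))) \<partial>step_measure \<alpha>) < \<infinity>" .
qed measurable

lemma scaled_tail_renewal: "scaled_tail t
    = scaled_difference t + (\<integral>u. scaled_tail (t - u) \<partial>step_measure \<alpha>)"
proof -
  have "(\<integral>u. scaled_tail (t - u) \<partial>step_measure \<alpha>)
      = enn2real (\<integral>\<^sup>+u. ennreal (scaled_tail (t - u)) \<partial>step_measure \<alpha>)"
    by (rule integral_eq_nn_integral) (simp_all add: scaled_tail_nonneg)
  also have "\<dots> = exp (\<alpha> * t) * enn2real (expected_exceedances M Q N C (exp t))"
    unfolding nn_integral_scaled_tail by (simp add: enn2real_mult)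
  finally show ?thesis by (simp add: scaled_tail_def scaled_difference_def right_diff_distrib)
qed

sublocale S: renewal_equation "step_measure \<alpha>" scaled_tail scaled_difference \<alpha> \<theta> \<theta>' tail_moment
proof (intro renewal_equation.intro renewal_equation_axioms.intro)
  show "real_distribution (step_measure \<alpha>)" by (rule real_distribution_step_measure[OF root_\<alpha>])
  show "(\<integral>\<^sup>+u. ennreal (exp (- \<theta> * u)) \<partial>step_measure \<alpha>) < 1"
    using root_\<theta> nn_integral_step_measure_exp[of \<alpha> \<theta>] by simp
  show "0 \<le> \<alpha>" using \<alpha>_pos by simp
qed (rule measurable_scaled_tail scaled_tail_nonneg scaled_tail_decay scaled_tail_growth
    integrable_scaled_difference integrable_scaled_tail scaled_tail_renewal mean \<theta> | assumption)+

theorem tail_limit: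
  "((\<lambda>t. t powr \<alpha> * tail t) \<longlongrightarrow> 1 / m * (LINT v:{0<..}|lborel. v powr (\<alpha> - 1) * (tail v - enn2real
      (expected_exceedances M Q N C v)))) at_top"
proof -
  have "(scaled_tail \<longlongrightarrow> integral\<^sup>L lborel scaled_difference / m) at_top"
    using S.renewal_limit[OF nonarith] mean by simp
  then have "((\<lambda>t. scaled_tail (ln t)) \<longlongrightarrow> integral\<^sup>L lborel scaled_difference / m) at_top"
    by (rule filterlim_compose[OF _ ln_at_top])
  moreover have "\<forall>\<^sub>F t in at_top. scaled_tail (ln t) = t powr \<alpha> * tail t"
    using eventually_gt_at_top[of 0] by eventually_elim (simp add: scaled_tail_def powr_def)
  ultimately have "((\<lambda>t. t powr \<alpha> * tail t) \<longlongrightarrow> integral\<^sup>L lborel scaled_difference / m) at_top"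
    by (rule Lim_transform_eventually)
  moreover have "integral\<^sup>L lborel scaled_difference
      = (LINT v:{0<..}|lborel. v powr (\<alpha> - 1) * (tail v - enn2real (expected_exceedances M Q N C
      v)))"
    using lborel_integral_exp_substitution(2)[OF set_integrable_tail_difference]
        unfolding scaled_difference_eq[symmetric] by simp
  ultimately show ?thesis by simp
qed

end

text \<open>The transform is 1 at 0 and its right derivative there is minus the mean, hence
  negative. Finiteness at \<open>\<theta>0\<close> justifies differentiation under the
  integral.\<close>

lemma (in real_distribution) laplace_transform_less_one:
  assumes \<theta>0: "0 < \<theta>0" and fin: "(\<integral>\<^sup>+u. ennreal (exp (- \<theta>0 * u)) \<partial>M) < \<infinity>"
    and int: "integrable M (\<lambda>u. u)" and pos: "0 < (\<integral>u. u \<partial>M)"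
  shows "\<forall>\<^sub>F \<theta> in at_right 0. (\<integral>\<^sup>+u. ennreal (exp (- \<theta> * u)) \<partial>M) < 1"
proof -
  have exp_int0: "integrable M (\<lambda>u. exp (- \<theta>0 * u))"
    using fin by (intro integrableI_bounded) auto
  define s where "s \<theta> u = (1 - exp (- \<theta> * u)) / \<theta>" for \<theta> u :: real
  \<comment> \<open>A majorant of the difference quotients for
    \<open>\<theta> \<le> \<theta>0 / 2\<close>. They are at most \<open>u\<close> for
    \<open>u \<ge> 0\<close>; for negative \<open>u\<close>, half of the exponent
    \<open>\<theta>0\<close> dominates the exponential and the other half the factor
    \<open>\<bar>u\<bar>\<close>.\<close>
  define w where "w u = \<bar>u\<bar> + 2 / \<theta>0 * exp (- \<theta>0 * u)" for u
  have w_int: "integrable M w" unfolding w_def using int exp_int0 by auto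
  have bound: "\<bar>s \<theta> u\<bar> \<le> w u" if \<theta>: "0 < \<theta>" "\<theta> \<le> \<theta>0 / 2" for \<theta> u
  proof (cases "0 \<le> u")
    case True
    have "1 - exp (- \<theta> * u) \<le> \<theta> * u" using exp_ge_add_one_self[of "- \<theta> * u"] by simp
    moreover have "0 \<le> 1 - exp (- \<theta> * u)" using True \<theta> by simp
    ultimately have "\<bar>s \<theta> u\<bar> \<le> u" unfolding s_def using \<theta> by (simp add: field_simps)
    then show ?thesis unfolding w_def using \<theta>0 True by (simp add: add_increasing2)
  next
    case False
    define x where "x = - u"
    have x: "0 < x" using False by (simp add: x_def)
    have "1 - \<theta> * x \<le> exp (- (\<theta> * x))" using exp_ge_add_one_self[of "- (\<theta> * x)"] by simp
    then have "(1 - \<theta> * x) * exp (\<theta> * x) \<le> 1"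
      by (simp add: exp_minus field_simps)
    then have "exp (\<theta> * x) - 1 \<le> \<theta> * x * exp (\<theta> * x)" by (simp add: algebra_simps)
    moreover have "0 \<le> exp (\<theta> * x) - 1" using x \<theta> by simp
    ultimately have "\<bar>s \<theta> u\<bar> \<le> x * exp (\<theta> * x)"
      unfolding s_def x_def using \<theta> by (simp add: field_simps)
    also have "\<dots> \<le> x * exp (\<theta>0 / 2 * x)" using x \<theta> by (intro mult_left_mono) auto
    also have "x \<le> 2 / \<theta>0 * exp (\<theta>0 / 2 * x)"
      using exp_ge_add_one_self[of "\<theta>0 / 2 * x"] \<theta>0 by (simp add: field_simps)
    then have "x * exp (\<theta>0 / 2 * x) \<le> 2 / \<theta>0 * exp (\<theta>0 / 2 * x) * exp (\<theta>0 / 2 * x)"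
      by (intro mult_right_mono) auto
    also have "\<dots> = 2 / \<theta>0 * exp (- \<theta>0 * u)"
      by (simp add: x_def mult.assoc exp_add[symmetric])
    also have "\<dots> \<le> w u" unfolding w_def by simp
    finally show ?thesis .
  qed
  have lim: "((\<lambda>\<theta>. s \<theta> u) \<longlongrightarrow> u) (at_right 0)" for u
  proof -
    have "((\<lambda>\<theta>. - exp (- \<theta> * u)) has_real_derivative u) (at 0)"
      by (auto intro!: derivative_eq_intros)
    from DERIV_D[OF this] have "((\<lambda>h. s h u) \<longlongrightarrow> u) (at 0)"
      by (simp add: s_def)
    then show ?thesis by (rule filterlim_mono) (auto simp: at_within_le_at)
  qed
  have "((\<lambda>\<theta>. \<integral>u. s \<theta> u \<partial>M) \<longlongrightarrow> (\<integral>u. u \<partial>M)) (at_right 0)"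
  proof (rule tendsto_at_right_sequentially[of 0 "\<theta>0 / 2"])
    fix X :: "nat \<Rightarrow> real" assume X: "\<And>n. 0 < X n" "\<And>n. X n < \<theta>0 / 2" "X \<longlonglongrightarrow> 0"
    have X': "filterlim X (at_right 0) sequentially"
      unfolding filterlim_at using X(3) less_imp_neq[OF X(1)] X(1)
          by (auto intro!: always_eventually)
    show "(\<lambda>n. \<integral>u. s (X n) u \<partial>M) \<longlonglongrightarrow> (\<integral>u. u \<partial>M)"
    proof (rule integral_dominated_convergence[OF _ _ w_int])
      show "AE u in M. (\<lambda>n. s (X n) u) \<longlonglongrightarrow> u"
        using filterlim_compose[OF lim X'] by simp
      show "AE u in M. norm (s (X n) u) \<le> w u" for n
        using bound[of "X n"] X(1,2)[of n] by simp
      show "(\<lambda>u. s (X n) u) \<in> borel_measurable M" for n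
        unfolding s_def by measurable
    qed measurable
  qed (use \<theta>0 in simp)
  then have "\<forall>\<^sub>F \<theta> in at_right 0. 0 < (\<integral>u. s \<theta> u \<partial>M)"
    using pos by (rule order_tendstoD)
  moreover have "\<forall>\<^sub>F \<theta> in at_right 0. \<theta> \<in> {0<..<\<theta>0 / 2}"
    by (rule eventually_at_right_real) (use \<theta>0 in simp)
  ultimately show ?thesis
  proof eventually_elim
    case (elim \<theta>)
    then have \<theta>: "0 < \<theta>" "\<theta> \<le> \<theta>0 / 2" by auto
    have s_int: "integrable M (s \<theta>)"
    proof (rule Bochner_Integration.integrable_bound[OF w_int])
      show "s \<theta> \<in> borel_measurable M" unfolding s_def by measurable
      show "AE u in M. norm (s \<theta> u) \<le> norm (w u)"
        using order_trans[OF bound[OF \<theta>] abs_ge_self] by simp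
    qed
    have eq: "exp (- \<theta> * u) = 1 - \<theta> * s \<theta> u" for u using \<theta> by (simp add: s_def)
    have e_int: "integrable M (\<lambda>u. exp (- \<theta> * u))"
      unfolding eq using s_int by auto
    have "(\<integral>u. exp (- \<theta> * u) \<partial>M) = 1 - \<theta> * (\<integral>u. s \<theta> u \<partial>M)"
      unfolding eq using s_int prob_space by simp
    also have "\<dots> < 1" using elim \<theta> by simp
    finally have "(\<integral>u. exp (- \<theta> * u) \<partial>M) < 1" .
    then show ?case
      using e_int by (subst nn_integral_eq_integral) auto
  qed
qed

section \<open>Mean of the step distribution and interpolation of moments\<close>

context weighted_branching_tree
begin

text \<open>A real-valued twin of \<open>step_weight\<close>, as Bochner integrals against a density
  require.\<close>

definition real_step_weight :: "real \<Rightarrow> nat \<Rightarrow> 'w \<Rightarrow> real" where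
  "real_step_weight a i \<omega> = (if i = 0 then 0 else enn2real (coef \<omega> i) powr a)"

lemma step_weight_real: "step_weight a i \<omega> = ennreal (real_step_weight a i \<omega>)"
  by (simp add: step_weight_eq real_step_weight_def)

lemma real_step_weight_nonneg [simp]: "0 \<le> real_step_weight a i \<omega>"
  by (simp add: real_step_weight_def)

lemma measurable_real_step_weight [measurable]:
  "real_step_weight a i \<in> borel_measurable M"
  "(\<lambda>(i, \<omega>). real_step_weight a i \<omega>) \<in> borel_measurable (count_space UNIV \<Otimes>\<^sub>M M)"
proof -
  show m: "real_step_weight a i \<in> borel_measurable M" for i
    unfolding real_step_weight_def[abs_def] by (cases "i = 0"; simp)
  show "(\<lambda>(i, \<omega>). real_step_weight a i \<omega>) \<in> borel_measurable (count_space UNIV \<Otimes>\<^sub>M M)"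
    by (rule measurable_pair_measure_countable1) (auto simp: m)
qed

text \<open>From \<open>ln y \<le> y\<close> at \<open>y = x powr - (a - \<beta>)\<close> for
  \<open>x < 1\<close>. The negative part of the logarithm is thus paid for by the lower order
  \<open>\<beta>\<close>.\<close>

lemma real_step_weight_ln_le:
  assumes "0 < \<beta>" "\<beta> < a"
  shows "real_step_weight a i \<omega> * max 0 (- log_coef i \<omega>) \<le> 1 / (a - \<beta>) * real_step_weight \<beta> i \<omega>"
proof (cases "i = 0 \<or> enn2real (coef \<omega> i) = 0 \<or> 1 \<le> enn2real (coef \<omega> i)")
  case False
  define x where "x = enn2real (coef \<omega> i)"
  have "x \<noteq> 0" "\<not> 1 \<le> x" using False by (auto simp: x_def)
  moreover have "0 \<le> x" by (simp add: x_def)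
  ultimately have x: "0 < x" "x < 1" by auto
  define \<delta> where "\<delta> = a - \<beta>"
  have \<delta>: "0 < \<delta>" using assms by (simp add: \<delta>_def)
  have "\<delta> * (- ln x) = ln (x powr - \<delta>)" using x by (simp add: ln_powr)
  also have "\<dots> \<le> x powr - \<delta>" using x ln_le_minus_one[of "x powr - \<delta>"] by simp
  finally have "- ln x \<le> x powr - \<delta> / \<delta>" using \<delta> by (simp add: field_simps)
  then have "x powr a * (- ln x) \<le> x powr a * (x powr - \<delta> / \<delta>)" by (intro mult_left_mono) auto
  also have "\<dots> = 1 / \<delta> * x powr \<beta>" by (simp add: \<delta>_def powr_add[symmetric])
  finally show ?thesis using False x by (simp add: real_step_weight_def log_coef_def
      x_def[symmetric] \<delta>_def)
qed (use assms in \<open>auto simp: real_step_weight_def log_coef_def max_def\<close>)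

text \<open>Integrability is given for the signed sum \<open>S\<close> only, while the step measure
  asks for absolute integrability over index and sample. The negative parts are integrable through
  the moment of order \<open>\<beta>\<close>. Pathwise the positive parts are summable as well, so
  \<open>S\<close> is a difference of finite sums, and the sum of absolute values is at most
  \<open>\<bar>S\<bar>\<close> plus twice the negative parts.\<close>

lemma step_measure_mean:
  assumes a: "0 < a" and \<beta>: "0 < \<beta>" "\<beta> < a" and root_a: "root_moment a
      = 1" and root_\<beta>: "root_moment \<beta> < \<infinity>"
    and int: "integrable M (\<lambda>\<omega>. sum_upto (N [] \<omega>) (\<lambda>i. C [i] \<omega> powr a * ln (C [i] \<omega>)))"
  shows "integrable (step_measure a) (\<lambda>u. u)"
    and "(\<integral>u. u \<partial>step_measure a) = (\<integral>\<omega>. sum_upto (N [] \<omega>) (\<lambda>i. C [i] \<omega> powr a * ln (C [i] \<omega>)) \<partial>M)"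
proof -
  define f where "f i \<omega> = real_step_weight a i \<omega> * log_coef i \<omega>" for i \<omega>
  define fp where "fp i \<omega> = real_step_weight a i \<omega> * max 0 (log_coef i \<omega>)" for i \<omega>
  define fm where "fm i \<omega> = real_step_weight a i \<omega> * max 0 (- log_coef i \<omega>)" for i \<omega>
  have f_split: "f i \<omega> = fp i \<omega> - fm i \<omega>" "\<bar>f i \<omega>\<bar> = fp i \<omega> + fm i \<omega>" for i \<omega>
    by (auto simp: f_def fp_def fm_def max_def abs_mult algebra_simps)
  have nn[simp]: "0 \<le> fp i \<omega>" "0 \<le> fm i \<omega>" for i \<omega> by (auto simp: fp_def fm_def)
  have [measurable]: "f i \<in> borel_measurable M" "fp i \<in> borel_measurable M" "fm i \<in>
      borel_measurable M" for i
    unfolding f_def fp_def fm_def by measurable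
  have f_meas: "(\<lambda>(i, \<omega>). f i \<omega>) \<in> borel_measurable (count_space UNIV \<Otimes>\<^sub>M M)"
    by (rule measurable_pair_measure_countable1) auto
  define S where "S \<omega> = sum_upto (N [] \<omega>) (\<lambda>i. C [i] \<omega> powr a * ln (C [i] \<omega>))" for \<omega>
  have fm_fin: "(\<integral>\<^sup>+\<omega>. (\<Sum>i. ennreal (fm i \<omega>)) \<partial>M) < \<infinity>"
  proof -
    have "(\<integral>\<^sup>+\<omega>. (\<Sum>i. ennreal (fm i \<omega>)) \<partial>M)
        \<le> (\<integral>\<^sup>+\<omega>. (\<Sum>i. ennreal (1 / (a - \<beta>)) * step_weight \<beta> i \<omega>) \<partial>M)"
      unfolding step_weight_real fm_def using \<beta> real_step_weight_ln_le[OF \<beta>]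
      by (intro nn_integral_mono suminf_le) (auto simp: ennreal_mult[symmetric] intro!: ennreal_leI)
    also have "\<dots> = ennreal (1 / (a - \<beta>)) * root_moment \<beta>"
      unfolding suminf_step_weight[symmetric] by (simp add: nn_integral_cmult nn_integral_suminf)
    also have "\<dots> < \<infinity>" using root_\<beta> by (simp add: ennreal_mult_less_top)
    finally show ?thesis .
  qed
  have ae_fm: "AE \<omega> in M. (\<Sum>i. ennreal (fm i \<omega>)) \<noteq> \<infinity>"
    by (rule nn_integral_noteq_infinite) (use fm_fin in auto)
  have ae_a: "AE \<omega> in M. (\<Sum>i. step_weight a i \<omega>) \<noteq> \<infinity>"
    by (rule nn_integral_noteq_infinite) (auto simp: nn_integral_suminf suminf_step_weight root_a)
  have ae: "AE \<omega> in M. integrable (count_space UNIV) (\<lambda>i. f i \<omega>) \<and> S \<omega>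
      = (\<integral>i. f i \<omega> \<partial>count_space UNIV) \<and>
      (\<Sum>i. ennreal \<bar>f i \<omega>\<bar>) \<le> ennreal \<bar>S \<omega>\<bar> + 2 * (\<Sum>i. ennreal (fm i \<omega>))"
    using ae_fm ae_a AE_C_nonneg
  proof eventually_elim
    case (elim \<omega>)
    obtain T where T: "(\<Sum>i. step_weight a i \<omega>) = ennreal T" "0 \<le> T"
      using elim(2) that by (cases "\<Sum>i. step_weight a i \<omega>") (simp_all only: infinity_ennreal_def
          simp_thms)
    \<comment> \<open>Each weight of order \<open>a\<close> is at most the total \<open>T\<close>,
      so every logarithm is at most \<open>ln T / a\<close>, and the positive parts sum to at most
      \<open>T * L\<close>.\<close>
    define L where "L = max 0 (ln T / a)"
    have fp_le: "fp i \<omega> \<le> real_step_weight a i \<omega> * L" for i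
    proof (cases "i = 0 \<or> enn2real (coef \<omega> i) = 0")
      case False
      define x where "x = enn2real (coef \<omega> i)"
      have "x \<noteq> 0" "0 \<le> x" using False by (auto simp: x_def)
      then have x: "0 < x" by simp
      have "step_weight a i \<omega> = (\<Sum>j\<in>{i}. step_weight a j \<omega>)" by simp
      also have "\<dots> \<le> (\<Sum>i. step_weight a i \<omega>)" by (rule sum_le_suminf) auto
      finally have le: "step_weight a i \<omega> \<le> ennreal T" unfolding T(1) .
      have "step_weight a i \<omega> = ennreal (x powr a)" using False by (simp add: step_weight_eq x_def)
      then have "x powr a \<le> T" using le T(2) by simp
      then have "ln (x powr a) \<le> ln T" using x by (intro ln_mono) auto
      then have "ln x \<le> ln T / a" using x a by (simp add: ln_powr field_simps)
      then have "max 0 (log_coef i \<omega>) \<le> L" unfolding L_def log_coef_def x_def by auto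
      then show ?thesis unfolding fp_def by (intro mult_left_mono) auto
    qed (auto simp: fp_def real_step_weight_def)
    have "(\<Sum>i. ennreal (fp i \<omega>)) \<le> (\<Sum>i. step_weight a i \<omega> * ennreal L)"
    proof (intro suminf_le)
      have L0: "0 \<le> L" by (simp add: L_def)
      show "ennreal (fp i \<omega>) \<le> step_weight a i \<omega> * ennreal L" for i
        using ennreal_leI[OF fp_le[of i]] L0 by (simp add: step_weight_real ennreal_mult)
    qed auto
    also have "\<dots> < \<infinity>" by (simp add: T ennreal_mult_less_top)
    finally have fp_fin: "(\<Sum>i. ennreal (fp i \<omega>)) < \<infinity>" .
    have fp_int: "integrable (count_space UNIV) (\<lambda>i. fp i \<omega>)"
      using fp_fin by (intro integrableI_bounded) (auto simp: nn_integral_count_space_nat)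
    have fm_int: "integrable (count_space UNIV) (\<lambda>i. fm i \<omega>)"
    proof (rule integrableI_bounded)
      show "(\<integral>\<^sup>+i. ennreal (norm (fm i \<omega>)) \<partial>count_space UNIV) < \<infinity>"
        using elim(1) by (simp add: nn_integral_count_space_nat less_top[symmetric])
    qed simp
    have f_int: "integrable (count_space UNIV) (\<lambda>i. f i \<omega>)"
      unfolding f_split using fp_int fm_int by simp
    \<comment> \<open>On reals \<open>sum_upto\<close> is an unordered sum; the absolute summability
      just obtained identifies it with an integral against counting measure.\<close>
    have "S \<omega> = infsum (\<lambda>i. f i \<omega>) UNIV"
      unfolding S_def sum_upto_def
    proof (rule infsum_cong_neutral)
      fix i assume "i \<in> UNIV - {i. 1 \<le> i \<and> enat i \<le> N [] \<omega>}"
      then show "f i \<omega> = 0" by (auto simp: f_def real_step_weight_def coef_def)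
    next
      fix i assume "i \<in> {i. 1 \<le> i \<and> enat i \<le> N [] \<omega>} \<inter> UNIV"
      then show "C [i] \<omega> powr a * ln (C [i] \<omega>) = f i \<omega>"
        using elim by (auto simp: f_def real_step_weight_def coef_def log_coef_def)
    qed auto
    also have "\<dots> = infsetsum (\<lambda>i. f i \<omega>) UNIV"
      using f_int by (intro infsetsum_infsum[symmetric]) (simp add:
          Infinite_Set_Sum.abs_summable_on_def)
    also have "\<dots> = (\<integral>i. f i \<omega> \<partial>count_space UNIV)" by (rule infsetsum_def)
    finally have S_eq: "S \<omega> = (\<integral>i. f i \<omega> \<partial>count_space UNIV)" .
    define P Mn where "P = (\<integral>i. fp i \<omega> \<partial>count_space UNIV)" and "Mn = (\<integral>i. fm i \<omega> \<partial>count_space UNIV)"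
    have P: "(\<Sum>i. ennreal (fp i \<omega>)) = ennreal P"
      unfolding P_def nn_integral_count_space_nat[symmetric] using fp_int
          by (intro nn_integral_eq_integral) auto
    have Mn: "(\<Sum>i. ennreal (fm i \<omega>)) = ennreal Mn"
      unfolding Mn_def nn_integral_count_space_nat[symmetric] using fm_int
          by (intro nn_integral_eq_integral) auto
    have "0 \<le> P" "0 \<le> Mn" by (auto simp: P_def Mn_def)
    have "S \<omega> = P - Mn" unfolding S_eq f_split P_def Mn_def using fp_int fm_int by simp
    have "(\<Sum>i. ennreal \<bar>f i \<omega>\<bar>) = ennreal P + ennreal Mn"
      unfolding f_split(2) P[symmetric] Mn[symmetric] by (subst suminf_add) auto
    also have "\<dots> = ennreal (P + Mn)" using \<open>0 \<le> P\<close> \<open>0 \<le> Mn\<close> by simp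
    also have "\<dots> \<le> ennreal (\<bar>S \<omega>\<bar> + 2 * Mn)" using \<open>S \<omega> = P - Mn\<close> by (intro ennreal_leI) simp
    also have "\<dots> = ennreal \<bar>S \<omega>\<bar> + 2 * (\<Sum>i. ennreal (fm i \<omega>))"
      using \<open>0 \<le> Mn\<close> by (simp add: Mn ennreal_plus ennreal_mult)
    finally show ?case using f_int S_eq by simp
  qed
  have S_int: "integrable M S" using int by (simp add: S_def[abs_def])
  interpret pair_sigma_finite "count_space (UNIV :: nat set)" M
    by (intro pair_sigma_finite.intro sigma_finite_measure_count_space sigma_finite_measure_axioms)
  have f_int: "integrable (count_space UNIV \<Otimes>\<^sub>M M) (\<lambda>(i, \<omega>). f i \<omega>)"
  proof (rule integrableI_bounded[OF f_meas])
    have "(\<integral>\<^sup>+x. ennreal (norm (case x of (i, \<omega>) \<Rightarrow> f i \<omega>)) \<partial>(count_space UNIV \<Otimes>\<^sub>M M))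
        = (\<integral>\<^sup>+\<omega>. \<integral>\<^sup>+i. ennreal \<bar>f i \<omega>\<bar> \<partial>count_space UNIV \<partial>M)"
      using f_meas by (subst nn_integral_snd[symmetric]) (auto simp: split_beta')
    also have "\<dots> = (\<integral>\<^sup>+\<omega>. (\<Sum>i. ennreal \<bar>f i \<omega>\<bar>) \<partial>M)" by (simp add: nn_integral_count_space_nat)
    also have "\<dots> \<le> (\<integral>\<^sup>+\<omega>. ennreal \<bar>S \<omega>\<bar> + 2 * (\<Sum>i. ennreal (fm i \<omega>)) \<partial>M)"
      using ae by (intro nn_integral_mono_AE) auto
    also have "\<dots> = (\<integral>\<^sup>+\<omega>. ennreal \<bar>S \<omega>\<bar> \<partial>M) + 2 * (\<integral>\<^sup>+\<omega>. (\<Sum>i. ennreal (fm i \<omega>)) \<partial>M)"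
      using S_int by (subst nn_integral_add) (auto simp: nn_integral_cmult)
    also have "\<dots> < \<infinity>"
      using S_int fm_fin by (auto simp: integrable_iff_bounded ennreal_mult_less_top)
    finally show "(\<integral>\<^sup>+x. ennreal (norm (case x of (i, \<omega>) \<Rightarrow> f i \<omega>)) \<partial>(count_space UNIV \<Otimes>\<^sub>M M)) < \<infinity>" .
  qed
  define D where "D = density (count_space UNIV \<Otimes>\<^sub>M M)
      (\<lambda>x. ennreal (case x of (i, \<omega>) \<Rightarrow> real_step_weight a i \<omega>))"
  have sm: "step_measure a = distr D borel (\<lambda>(i, \<omega>). log_coef i \<omega>)"
    unfolding step_measure_def D_def step_weight_real by (simp add: split_beta')
  have lc: "(\<lambda>(i, \<omega>). log_coef i \<omega>) \<in> borel_measurable D"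
    using measurable_step_pair(2) by (simp add: D_def)
  have eqf: "(\<lambda>x. (case x of (i, \<omega>) \<Rightarrow> real_step_weight a i \<omega>) *\<^sub>R (case x of (i, \<omega>) \<Rightarrow> log_coef i
      \<omega>)) = (\<lambda>(i, \<omega>). f i \<omega>)"
    by (auto simp: f_def)
  have ae_nn: "AE x in count_space UNIV \<Otimes>\<^sub>M M. 0 \<le> (case x of (i, \<omega>) \<Rightarrow> real_step_weight a i \<omega>)"
    by (simp add: split_beta')
  show "integrable (step_measure a) (\<lambda>u. u)"
    unfolding sm
  proof (subst integrable_distr_eq[OF lc])
    show "integrable D (\<lambda>x. case x of (i, \<omega>) \<Rightarrow> log_coef i \<omega>)"
      unfolding D_def using f_int
      by (simp only: integrable_density[OF measurable_step_pair(2) measurable_real_step_weight(2)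
          ae_nn] eqf)
  qed simp
  have "(\<integral>u. u \<partial>step_measure a) = (\<integral>x. (case x of (i, \<omega>) \<Rightarrow> log_coef i \<omega>) \<partial>D)"
    unfolding sm by (subst integral_distr[OF lc]) auto
  also have "\<dots> = (\<integral>x. (case x of (i, \<omega>) \<Rightarrow> f i \<omega>) \<partial>(count_space UNIV \<Otimes>\<^sub>M M))"
    unfolding D_def by (simp only: integral_density[OF measurable_step_pair(2)
        measurable_real_step_weight(2) ae_nn] eqf)
  also have "\<dots> = (\<integral>\<omega>. \<integral>i. f i \<omega> \<partial>count_space UNIV \<partial>M)"
    using integral_snd[of f] f_int by simp
  also have "\<dots> = (\<integral>\<omega>. S \<omega> \<partial>M)"
    using ae integrable_snd[of f] f_int S_int by (intro integral_cong_AE) auto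
  finally show "(\<integral>u. u \<partial>step_measure a)
      = (\<integral>\<omega>. sum_upto (N [] \<omega>) (\<lambda>i. C [i] \<omega> powr a * ln (C [i] \<omega>)) \<partial>M)"
    by (simp add: S_def)
qed

text \<open>The power of order \<open>b\<close> is a weighted geometric mean of the powers of orders
  \<open>b1\<close> and \<open>b2\<close>, and Young's inequality bounds it by the arithmetic
  mean.\<close>

lemma epowr_interpolate:
  assumes "0 < l" "l < 1" "b = l * b1 + (1 - l) * b2"
  shows "epowr x b \<le> ennreal l * epowr x b1 + ennreal (1 - l) * epowr x b2"
proof (cases x)
  case (real r)
  have "r powr b \<le> l * r powr b1 + (1 - l) * r powr b2"
  proof (cases "r = 0")
    case False
    have "r powr b = (r powr b1) powr l * (r powr b2) powr (1 - l)"
      by (simp add: assms(3) powr_powr powr_add[symmetric] mult.commute)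
    also have "\<dots> \<le> l * r powr b1 + (1 - l) * r powr b2"
      using assms real False by (intro Youngs_inequality_0) auto
    finally show ?thesis .
  qed simp
  then have "ennreal (r powr b) \<le> ennreal (l * r powr b1 + (1 - l) * r powr b2)"
      by (rule ennreal_leI)
  then show ?thesis using assms real by (simp add: epowr_ennreal ennreal_mult)
qed (use assms in \<open>simp add: ennreal_mult_top\<close>)

text \<open>Convexity in the exponent; the left end point enters with positive weight, which makes
  the bound strict.\<close>

lemma root_moment_interpolate:
  assumes "root_moment b1 < 1" "root_moment b2 = 1" "b1 < b" "b < b2"
  shows "root_moment b < 1"
proof -
  define l where "l = (b2 - b) / (b2 - b1)"
  have l: "0 < l" "l < 1" using assms by (auto simp: l_def)
  have "l * (b2 - b1) = b2 - b" using assms by (simp add: l_def)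
  then have b: "b = l * b1 + (1 - l) * b2" by (simp add: algebra_simps)
  have "root_moment b \<le> (\<integral>\<^sup>+\<omega>. (\<Sum>i. ennreal l * (if i
      = 0 then 0 else epowr (coef \<omega> i) b1) + ennreal (1 - l) * (if i
      = 0 then 0 else epowr (coef \<omega> i) b2)) \<partial>M)"
    unfolding root_moment_eq using epowr_interpolate[OF l b]
        by (intro nn_integral_mono suminf_le) auto
  also have "\<dots> = (\<integral>\<^sup>+\<omega>. ennreal l * (\<Sum>i. if i
      = 0 then 0 else epowr (coef \<omega> i) b1) + ennreal (1 - l) * (\<Sum>i. if i
      = 0 then 0 else epowr (coef \<omega> i) b2) \<partial>M)"
    by (intro nn_integral_cong, subst suminf_add[symmetric]) (simp_all only: summableI
        ennreal_suminf_cmult)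
  also have "\<dots> = ennreal l * root_moment b1 + ennreal (1 - l) * root_moment b2"
    unfolding root_moment_eq by (subst nn_integral_add, measurable, subst nn_integral_cmult,
        measurable, subst nn_integral_cmult, measurable)
  also have "\<dots> < 1"
  proof -
    obtain x where x: "root_moment b1 = ennreal x" "0 \<le> x" using assms(1)
        by (cases "root_moment b1") auto
    have "x < 1" using assms(1) x by simp
    have "ennreal l * root_moment b1 + ennreal (1 - l) * root_moment b2 = ennreal (l * x + (1 - l))"
      using x l assms(2) by (simp add: ennreal_mult)
    also have "\<dots> < 1"
    proof -
      have "l * x < l * 1" using l \<open>x < 1\<close> by (intro mult_strict_left_mono) auto
      then have "l * x + (1 - l) < 1" by simp
      then show ?thesis using ennreal_less_one_iff by blast
    qed
    finally show ?thesis .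
  qed
  finally show ?thesis .
qed

end

section \<open>Moments of order below \<open>\<alpha>\<close> for
  \<open>\<alpha> > 1\<close>\<close>

context weighted_branching_tree
begin

text \<open>The order is raised in steps of one, since \<open>moment_finite\<close> at
  \<open>b > 2\<close> calls for the order \<open>b - 1\<close>. Interpolation between 1 and
  \<open>\<alpha>\<close> keeps the contraction factor below 1 at every order on the way.\<close>

lemma moments_finite:
  assumes root_1: "root_moment 1 < 1" and root_\<alpha>: "root_moment \<alpha> = 1"
    and Q_\<alpha>: "(\<integral>\<^sup>+\<omega>. epowr (ennreal (Q [] \<omega>)) \<alpha> \<partial>M) < \<infinity>"
    and coef_\<alpha>: "(\<integral>\<^sup>+\<omega>. epowr (\<Sum>i. coef \<omega> i) \<alpha> \<partial>M) < \<infinity>"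
    and b: "1 \<le> b" "b < \<alpha>"
  shows "(\<integral>\<^sup>+\<omega>. epowr (tree_R Q N C \<omega>) b \<partial>M) < \<infinity>"
proof -
  have Qb: "(\<integral>\<^sup>+\<omega>. epowr (ennreal (Q [] \<omega>)) b \<partial>M) < \<infinity>" if "1 \<le> b" "b < \<alpha>" for b
    using that by (intro epowr_moment_finite_mono[OF _ _ Q_\<alpha>]) auto
  have Cb: "(\<integral>\<^sup>+\<omega>. epowr (\<Sum>i. coef \<omega> i) b \<partial>M) < \<infinity>" if "1 \<le> b" "b < \<alpha>" for b
    using that by (intro epowr_moment_finite_mono[OF _ _ coef_\<alpha>]) auto
  have root_b: "root_moment b < 1" if "1 \<le> b" "b < \<alpha>" for b
    using that root_1 root_moment_interpolate[OF root_1 root_\<alpha>, of b] by (cases "b = 1") auto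
  have "b \<le> real n \<Longrightarrow> (\<integral>\<^sup>+\<omega>. epowr (tree_R Q N C \<omega>) b \<partial>M) < \<infinity>" if "1 \<le> b" "b < \<alpha>" for n b
    using that
  proof (induction n arbitrary: b)
    case (Suc n)
    have first: "(\<integral>\<^sup>+\<omega>. epowr (tree_R Q N C \<omega>) 1 \<partial>M) < \<infinity>"
    proof (rule moment_finite)
      show "(\<integral>\<^sup>+\<omega>. epowr (ennreal (Q [] \<omega>)) 1 \<partial>M) < \<infinity>" using Suc.prems by (intro Qb) auto
    qed (use root_1 in simp_all)
    show ?case
    proof (rule moment_finite)
      show "(\<integral>\<^sup>+\<omega>. tree_R Q N C \<omega> \<partial>M) < \<infinity>" using first by simp
      show "(\<integral>\<^sup>+\<omega>. epowr (tree_R Q N C \<omega>) (b - 1) \<partial>M) < \<infinity>" if "2 < b"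
        using Suc.prems that by (intro Suc.IH) auto
      show "root_moment b < 1" using Suc.prems by (intro root_b)
      show "(\<integral>\<^sup>+\<omega>. epowr (ennreal (Q [] \<omega>)) b \<partial>M) < \<infinity>" using Suc.prems by (intro Qb)
      show "(\<integral>\<^sup>+\<omega>. epowr (\<Sum>i. coef \<omega> i) b \<partial>M) < \<infinity>" using Suc.prems by (intro Cb)
    qed (use Suc.prems in simp)
  qed simp
  moreover obtain n :: nat where "b \<le> real n" using real_arch_simple by blast
  ultimately show ?thesis using b by blast
qed

end

theorem theorem4p1:
  fixes M :: "'w measure"
    and Q :: "nat list \<Rightarrow> 'w \<Rightarrow> real"
    and N :: "nat list \<Rightarrow> 'w \<Rightarrow> enat"
    and C :: "nat list \<Rightarrow> 'w \<Rightarrow> real"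
    and \<alpha> m :: real
  assumes tree: "weighted_branching_tree M Q N C"
    and Q_pos: "measure M {\<omega> \<in> space M. Q [] \<omega> > 0} > 0"
    and nonarith: "\<exists>j\<ge>1.
          measure M {\<omega> \<in> space M. enat j \<le> N [] \<omega> \<and> C [j] \<omega> > 0} > 0 \<and>
          nonarithmetic
            (distr (restrict_space M {\<omega> \<in> space M. enat j \<le> N [] \<omega> \<and> C [j] \<omega> > 0})
               borel (\<lambda>\<omega>. ln (C [j] \<omega>)))"
    and alpha: "\<alpha> > 0"
    and Q_moment: "(\<integral>\<^sup>+\<omega>. ennreal (Q [] \<omega> powr \<alpha>) \<partial>M) < \<infinity>"
    and m_def: "m = (\<integral>\<omega>. sum_upto (N [] \<omega>) (\<lambda>i. C [i] \<omega> powr \<alpha> * ln (C [i] \<omega>)) \<partial>M)"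
    and m_finite: "integrable M (\<lambda>\<omega>. sum_upto (N [] \<omega>) (\<lambda>i. C [i] \<omega> powr \<alpha> * ln (C [i] \<omega>)))"
    and m_pos: "0 < m"
    and unit_moment: "(\<integral>\<^sup>+\<omega>. sum_upto (N [] \<omega>) (\<lambda>i. ennreal (C [i] \<omega> powr \<alpha>)) \<partial>M) = 1"
    and case_gt_1: "\<alpha> > 1 \<Longrightarrow>
          (\<integral>\<^sup>+\<omega>. sum_upto (N [] \<omega>) (\<lambda>i. ennreal (C [i] \<omega>)) \<partial>M) < 1 \<and>
          (\<integral>\<^sup>+\<omega>. epowr (sum_upto (N [] \<omega>) (\<lambda>i. ennreal (C [i] \<omega>))) \<alpha> \<partial>M) < \<infinity>"
    and case_le_1: "\<alpha> \<le> 1 \<Longrightarrow>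
          \<exists>\<epsilon>. 0 < \<epsilon> \<and> \<epsilon> < 1 \<and>
            (\<integral>\<^sup>+\<omega>. epowr (sum_upto (N [] \<omega>) (\<lambda>i. ennreal (C [i] \<omega> powr (\<alpha> / (1 + \<epsilon>)))))
                    (1 + \<epsilon>) \<partial>M) < \<infinity>"
  shows "\<exists>H::real. 0 \<le> H \<and>
    ((\<lambda>t. t powr \<alpha> * measure M {\<omega> \<in> space M. tree_R Q N C \<omega> > ennreal t}) \<longlongrightarrow> H) at_top \<and>
    (\<forall>v>0. expected_exceedances M Q N C v < \<infinity>) \<and>
    set_integrable lborel {0<..}
      (\<lambda>v. v powr (\<alpha> - 1) * (measure M {\<omega> \<in> space M. tree_R Q N C \<omega> > ennreal v}
                              - enn2real (expected_exceedances M Q N C v))) \<and>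
    H = 1 / m * (LINT v:{0<..}|lborel.
          v powr (\<alpha> - 1) * (measure M {\<omega> \<in> space M. tree_R Q N C \<omega> > ennreal v}
                              - enn2real (expected_exceedances M Q N C v))) \<and>
    (AE p in copies_space M. power_of_sum Q N C \<alpha> p < \<infinity> \<and> sum_of_powers Q N C \<alpha> p < \<infinity>) \<and>
    integrable (copies_space M)
      (\<lambda>p. enn2real (power_of_sum Q N C \<alpha> p) - enn2real (sum_of_powers Q N C \<alpha> p)) \<and>
    H = (\<integral>p. enn2real (power_of_sum Q N C \<alpha> p) - enn2real (sum_of_powers Q N C \<alpha> p)
           \<partial>(copies_space M)) / (\<alpha> * m)"
proof -
  interpret weighted_branching_tree M Q N C by (rule tree)
  have Q_\<alpha>: "(\<integral>\<^sup>+\<omega>. epowr (ennreal (Q [] \<omega>)) \<alpha> \<partial>M) < \<infinity>"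
  proof -
    have "(\<integral>\<^sup>+\<omega>. epowr (ennreal (Q [] \<omega>)) \<alpha> \<partial>M) = (\<integral>\<^sup>+\<omega>. ennreal (Q [] \<omega> powr \<alpha>) \<partial>M)"
      using nonneg_marks by (intro nn_integral_cong_AE) (auto elim!: eventually_mono simp:
          epowr_ennreal)
    then show ?thesis using Q_moment by simp
  qed
  have powr_eq: "AE \<omega> in M. sum_upto (N [] \<omega>) (\<lambda>i. epowr (ennreal (C [i] \<omega>)) b)
      = sum_upto (N [] \<omega>) (\<lambda>i. ennreal (C [i] \<omega> powr b))" for b
    using AE_C_nonneg by eventually_elim (rule sum_upto_cong, simp add: epowr_ennreal)
  have root_\<alpha>: "root_moment \<alpha> = 1"
    unfolding root_moment_def unit_moment[symmetric] using powr_eq by (rule nn_integral_cong_AE)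
  define coef_moment where
    "coef_moment \<beta> p = (\<integral>\<^sup>+\<omega>. epowr (sum_upto (N [] \<omega>)
        (\<lambda>i. epowr (ennreal (C [i] \<omega>)) \<beta>)) p \<partial>M)" for \<beta> p
  \<comment> \<open>For \<open>\<alpha> \<le> 1\<close> the bound \<open>\<epsilon> < 1\<close>
    gives \<open>p < 2\<close>, so the moment of order \<open>\<beta> * (p - 1)\<close> is called
    for only when \<open>\<alpha> > 1\<close>.\<close>
  obtain \<beta> p where \<beta>: "0 < \<beta>" "\<beta> \<le> 1" and p: "1 < p" and \<alpha>_eq: "\<alpha> = \<beta> * p"
    and coef_fin: "coef_moment \<beta> p < \<infinity>"
    and cases: "1 < \<alpha> \<and> \<beta> = 1 \<and> p = \<alpha> \<or> \<alpha> \<le> 1 \<and> p < 2"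
  proof (cases "1 < \<alpha>")
    case True
    then show ?thesis
      using case_gt_1[OF True] that[of 1 \<alpha>] by (simp add: coef_moment_def)
  next
    case False
    then obtain \<epsilon> where \<epsilon>: "0 < \<epsilon>" "\<epsilon> < 1"
      and fin: "(\<integral>\<^sup>+\<omega>. epowr (sum_upto (N [] \<omega>) (\<lambda>i. ennreal (C [i] \<omega> powr (\<alpha> / (1 + \<epsilon>))))) (1
          + \<epsilon>) \<partial>M) < \<infinity>"
      using case_le_1 by auto
    have "coef_moment (\<alpha> / (1 + \<epsilon>)) (1 + \<epsilon>) =
        (\<integral>\<^sup>+\<omega>. epowr (sum_upto (N [] \<omega>) (\<lambda>i. ennreal (C [i] \<omega> powr (\<alpha> / (1 + \<epsilon>))))) (1 + \<epsilon>) \<partial>M)"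
      unfolding coef_moment_def using powr_eq[of "\<alpha> / (1 + \<epsilon>)"]
      by (intro nn_integral_cong_AE) (auto elim!: eventually_mono)
    then show ?thesis
      using \<epsilon> False alpha fin that[of "\<alpha> / (1 + \<epsilon>)" "1 + \<epsilon>"] by (simp add: field_simps)
  qed
  have \<beta>_less: "\<beta> < \<alpha>" using \<beta> p by (simp add: \<alpha>_eq)
  have root_\<beta>: "root_moment \<beta> < \<infinity>"
    using root_moment_le_one_add[of p \<beta>] coef_fin p
        by (simp add: coef_moment_def order.strict_trans1)
  interpret E: real_distribution "step_measure \<alpha>"
    by (rule real_distribution_step_measure[OF root_\<alpha>])
  note mean = step_measure_mean[OF alpha \<beta>(1) \<beta>_less root_\<alpha> root_\<beta> m_finite]
  have "\<forall>\<^sub>F \<theta> in at_right 0. (\<integral>\<^sup>+u. ennreal (exp (- \<theta> * u)) \<partial>step_measure \<alpha>) < 1"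
  proof (rule E.laplace_transform_less_one)
    \<comment> \<open>At \<open>\<alpha> - \<beta>\<close> the Laplace transform equals
      \<open>root_moment \<beta>\<close>, which is finite.\<close>
    show "0 < \<alpha> - \<beta>" using \<beta>_less by simp
    show "(\<integral>\<^sup>+u. ennreal (exp (- (\<alpha> - \<beta>) * u)) \<partial>step_measure \<alpha>) < \<infinity>"
      unfolding nn_integral_step_measure_exp using root_\<beta> by simp
  qed (use mean m_pos m_def in auto)
  moreover have "\<forall>\<^sub>F \<theta> in at_right 0. \<theta> \<in> {0<..<\<alpha> - \<beta>}"
    by (rule eventually_at_right_real) (use \<beta>_less in simp)
  ultimately have "\<forall>\<^sub>F \<theta> in at_right 0. root_moment (\<alpha> - \<theta>) < 1 \<and> 0 < \<theta> \<and> \<theta> < \<alpha> - \<beta>"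
    unfolding nn_integral_step_measure_exp by eventually_elim auto
  then obtain \<theta> where \<theta>: "root_moment (\<alpha> - \<theta>) < 1" "0 < \<theta>" "\<theta> < \<alpha> - \<beta>"
    using eventually_happens'[OF trivial_limit_at_right_real] by blast
  \<comment> \<open>Halfway between \<open>\<alpha> - \<theta>\<close> and \<open>\<alpha>\<close>:
    interpolation gives the contraction at \<open>b\<close>, and \<open>\<theta> / 2\<close> becomes
    the growth rate, strictly below \<open>\<theta>\<close>.\<close>
  define b where "b = \<alpha> - \<theta> / 2"
  have b: "\<alpha> - \<theta> < b" "b < \<alpha>" "\<beta> < b" using \<theta> by (auto simp: b_def)
  have root_b: "root_moment b < 1" using root_moment_interpolate[OF \<theta>(1) root_\<alpha> b(1,2)] .
  have R_moments: "(\<integral>\<^sup>+\<omega>. epowr (tree_R Q N C \<omega>) b \<partial>M) < \<infinity> \<and> (2 < p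
      \<longrightarrow> (\<integral>\<^sup>+\<omega>. epowr (tree_R Q N C \<omega>) (\<beta> * (p - 1)) \<partial>M) < \<infinity>)"
    using cases
  proof
    assume *: "\<alpha> \<le> 1 \<and> p < 2"
    have "(\<integral>\<^sup>+\<omega>. epowr (ennreal (Q [] \<omega>)) b \<partial>M) < \<infinity>"
      using b \<beta> by (intro epowr_moment_finite_mono[OF _ _ Q_\<alpha>]) auto
    with root_b have "(\<integral>\<^sup>+\<omega>. epowr (tree_R Q N C \<omega>) b \<partial>M) < \<infinity>"
      by (rule moment_finite[rotated]) (use * b \<beta> in simp_all)
    then show ?thesis using * by simp
  next
    assume *: "1 < \<alpha> \<and> \<beta> = 1 \<and> p = \<alpha>"
    have root_1: "root_moment 1 < 1"
      using case_gt_1 * by (simp add: root_moment_def)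
    have "(\<integral>\<^sup>+\<omega>. epowr (\<Sum>i. coef \<omega> i) \<alpha> \<partial>M) < \<infinity>"
      using coef_total_moment_finite[of p \<beta>] Q_\<alpha> coef_fin * by (simp add: coef_moment_def)
    note R = moments_finite[OF root_1 root_\<alpha> Q_\<alpha> this]
    show ?thesis using R[of b] R[of "\<alpha> - 1"] b * by auto
  qed
  have nonarith': "emeasure (step_measure \<alpha>) (- {d * of_int k | k. True}) \<noteq> 0" if "d > 0" for d
  proof -
    obtain j where j: "1 \<le> j" "nonarithmetic
            (distr (restrict_space M {\<omega> \<in> space M. enat j \<le> N [] \<omega> \<and> C [j] \<omega> > 0})
               borel (\<lambda>\<omega>. ln (C [j] \<omega>)))"
      using nonarith by blast
    show ?thesis by (rule nonarithmetic_step_measure[OF j(1) j(2) that])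
  qed
  interpret L: tree_renewal_limit M Q N C \<alpha> \<beta> p \<theta> "\<theta> / 2" m
  proof unfold_locales
    show "(\<integral>\<^sup>+\<omega>. epowr (tree_R Q N C \<omega>) \<beta> \<partial>M) < \<infinity>"
      using R_moments b \<beta> by (intro epowr_moment_finite_mono[of \<beta> b]) auto
  qed (use \<beta> p \<alpha>_eq Q_\<alpha> root_\<alpha> coef_fin R_moments \<theta> mean m_def m_pos nonarith' in \<open>auto simp:
      coef_moment_def b_def\<close>)
  define H where "H = 1 / m * (LINT v:{0<..}|lborel.
          v powr (\<alpha> - 1) * (measure M {\<omega> \<in> space M. tree_R Q N C \<omega> > ennreal v}
                              - enn2real (expected_exceedances M Q N C v)))"
  have lim: "((\<lambda>t. t powr \<alpha> * measure M {\<omega> \<in> space M. tree_R Q N C \<omega> > ennreal t}) \<longlongrightarrow> H) at_top"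
    using L.tail_limit unfolding L.tail_def H_def .
  \<comment> \<open>The sign is read off the limit of nonnegative quantities; neither integral
    formula shows it.\<close>
  have "0 \<le> H"
    by (rule tendsto_lowerbound[OF lim]) (auto intro!: always_eventually)
  have "\<alpha> * m * H = (\<integral>p. enn2real (power_of_sum Q N C \<alpha> p) - enn2real (sum_of_powers Q N C \<alpha> p)
      \<partial>(copies_space M))"
    unfolding L.tail_difference_integral[symmetric] L.tail_def H_def using m_pos by simp
  then have "H = (\<integral>p. enn2real (power_of_sum Q N C \<alpha> p) - enn2real (sum_of_powers Q N C \<alpha> p)
      \<partial>(copies_space M)) / (\<alpha> * m)"
    using alpha m_pos by (simp add: field_simps)
  moreover have "set_integrable lborel {0<..}
      (\<lambda>v. v powr (\<alpha> - 1) * (measure M {\<omega> \<in> space M. tree_R Q N C \<omega> > ennreal v}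
                              - enn2real (expected_exceedances M Q N C v)))"
    using L.set_integrable_tail_difference unfolding L.tail_def .
  ultimately show ?thesis
    using \<open>0 \<le> H\<close> lim L.expected_exceedances_finite L.power_of_sum_finite
        L.integrable_power_difference H_def
    by blast
qed

end
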